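(* Let $N \geq 1$ and let $\lambda_1^{(N)} \leq \cdots \leq \lambda_N^{(N)}$ be the ordered eigenvalues of an $N \times N$ GUE random matrix. Then the random vector $(\lambda_1^{(N)},\ldots,\lambda_N^{(N)})$ has a log-concave probability law on $\mathbb{R}^N$.
   Context: An $N\times N$ GUE random matrix is a Hermitian random matrix $X$ with density proportional to $e^{-\mathrm{tr}(X^2)}$. Its ordered eigenvalues $\lambda_1^{(N)} \leq \cdots \leq \lambda_N^{(N)}$ have joint density on $\mathbb{R}^N$ $$p_N(t_1,\ldots,t_N) = C_N \prod_{1 \leq i<j \leq N}(t_j-t_i)^2 \exp\Big\{-\sum_{i=1}^N t_i^2\Big\} \mathbf{1}\{t_1 \leq \cdots \leq t_N\},$$ where $C_N$ is the normalisation constant. A probability measure $\mu$ on $\mathbb{R}^n$ is log-concave if for all Borel sets $A,B \subseteq \mathbb{R}^n$ and all $\lambda \in (0,1)$, $\mu(\lambda A + (1-\lambda)B) \geq \mu(A)^\lambda \mu(B)^{1-\lambda}$, where $\lambda A + (1-\lambda) B = \{\lambda a + (1-\lambda) b : a \in A, b \in B\}$. If $\mu$ has a density $f$ with respect to Lebesgue measure, this is equivalent to $f$ being expressible as $f = e^{-V}$ with $V:\mathbb{R}^n \to \mathbb{R}\cup\{+\infty\}$ convex. *)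

theory Defs
  imports "HOL-Probability.Probability"
begin

definition hermitian :: "complex^'n^'n \<Rightarrow> bool" where
  "hermitian A \<longleftrightarrow> (\<forall>i j. A $ j $ i = cnj (A $ i $ j))"

(* The N^2 real coordinates of a Hermitian matrix A are packed into a real N x N matrix B:
   the diagonal of B is that of A; for i < j, B_ij = Re A_ij and B_ji = Im A_ij. *)
definition hermitian_of_coords :: "real^('n::{finite,linorder})^('n::{finite,linorder}) \<Rightarrow> complex^('n::{finite,linorder})^('n::{finite,linorder})" where
  "hermitian_of_coords B = (\<chi> i j.
     if i = j then complex_of_real (B $ i $ i)
     else if i < j then Complex (B $ i $ j) (B $ j $ i)
     else Complex (B $ j $ i) (- (B $ i $ j)))"

(* Lebesgue measure on the real vector space of Hermitian matrices, seen as a Borel measure on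
   all complex matrices. Another choice of linear coordinates changes it by a constant factor
   only, which is immaterial for a density given up to proportionality. *)
definition hermitian_lborel :: "(complex^('n::{finite,linorder})^('n::{finite,linorder})) measure" where
  "hermitian_lborel = distr lborel borel hermitian_of_coords"

(* For Hermitian A the trace of A^2 is real, so Re loses nothing. *)
definition GUE_matrix :: "'a measure \<Rightarrow> ('a \<Rightarrow> complex^('n::{finite,linorder})^('n::{finite,linorder})) \<Rightarrow> bool" where
  "GUE_matrix M X \<longleftrightarrow>
     (\<forall>\<omega>\<in>space M. hermitian (X \<omega>)) \<and>
     (\<exists>c::real. distributed M hermitian_lborel X (\<lambda>A. ennreal (c * exp (- Re (trace (A ** A))))))"

(* t lists the eigenvalues, i.e. the roots of the characteristic polynomial with
   multiplicity, in increasing order. *)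
definition ordered_eigenvalues :: "complex^('n::{finite,linorder})^('n::{finite,linorder}) \<Rightarrow> real^('n::{finite,linorder})" where
  "ordered_eigenvalues A = (THE t.
     (\<forall>i j. i \<le> j \<longrightarrow> t $ i \<le> t $ j) \<and>
     (\<forall>z::complex. det (mat z - A) = (\<Prod>i\<in>UNIV. z - complex_of_real (t $ i))))"

(* For Borel A and B the Minkowski combination is analytic but need not be Borel, whereas
   emeasure is 0 by convention off the sigma-algebra. Its measure is therefore taken as an inner
   measure; analytic sets being universally measurable, this is the value of the completed
   measure (and the measure itself on Borel sets). *)
definition inner_emeasure :: "'a measure \<Rightarrow> 'a set \<Rightarrow> ennreal" where
  "inner_emeasure \<mu> S = (SUP C\<in>{C \<in> sets \<mu>. C \<subseteq> S}. emeasure \<mu> C)"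

definition log_concave_prob :: "('a::euclidean_space) measure \<Rightarrow> bool" where
  "log_concave_prob \<mu> \<longleftrightarrow>
     prob_space \<mu> \<and> sets \<mu> = sets borel \<and>
     (\<forall>A\<in>sets borel. \<forall>B\<in>sets borel. \<forall>l::real. 0 < l \<and> l < 1 \<longrightarrow>
        inner_emeasure \<mu> {l *\<^sub>R a + (1 - l) *\<^sub>R b | a b. a \<in> A \<and> b \<in> B}
          \<ge> ennreal (measure \<mu> A powr l * measure \<mu> B powr (1 - l)))"

end

theory Submission
  imports Defs
begin

text \<open>A polynomial $p$ acts on Hermitian matrices by $A \mapsto p(A)$, and acts on their eigenvalues
  coordinatewise. At a matrix with eigenvalues $t$ its Jacobian is the product over all $(i,j)$ of the
  divided differences of $p$ at $(t_i,t_j)$. Hence the image of Lebesgue measure under the eigenvalue map,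
  divided by the squared Vandermonde, transforms under increasing $p$ exactly like Lebesgue measure on
  the chamber $t_1 < \dots < t_N$. Increasing polynomials approximate, together with their
  derivatives, functions that map one product of disjoint intervals affinely onto another, so this
  measure is a multiple of Lebesgue measure. Repeated eigenvalues are negligible by Sard's theorem.
  The resulting density is log-concave, and the Prekopa-Leindler inequality gives the
  log-concavity of the law.\<close>

subsection \<open>The Prekopa-Leindler inequality\<close>

text \<open>Parametrising Hermitian matrices by eigenvalues and eigenvectors would call for
  coordinates on the unitary group modulo its diagonal torus. The maps A -> p(A) avoid this: they
  live on the whole matrix space, their derivative comes from the product rule, and no eigenvector
  is ever differentiated. Only an inclusion of the image is controlled, so each polynomial gives a
  one-sided estimate between two boxes; exchanging the boxes gives the reverse one. The density is
  found only up to a factor \<open>\<kappa>\<close>, which is enough: log-concavity ignores constant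
  factors, and total mass one is inherited from the law of the matrix. The measure with the
  Vandermonde factor divided out is blind to matrices with repeated eigenvalues, hence the separate
  null set argument for them. The density is log-concave because, on the chamber, every difference
  t_j - t_i with i < j is a positive linear function.\<close>

lemma brunn_minkowski_real:
  fixes A B C :: "real set"
  assumes [measurable]: "A \<in> sets borel" "B \<in> sets borel" "C \<in> sets borel"
    and "A \<noteq> {}" "B \<noteq> {}" "bounded A" "bounded B"
    and sub: "\<And>a b. a \<in> A \<Longrightarrow> b \<in> B \<Longrightarrow> a + b \<in> C"
  shows "emeasure lborel A + emeasure lborel B \<le> emeasure lborel C"
proof (rule ennreal_le_epsilon)
  fix e :: real assume "0 < e"
  have bA: "bdd_above A" and bB: "bdd_below B"
    using assms bounded_imp_bdd_above bounded_imp_bdd_below by auto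
  obtain a where a: "a \<in> A" "Sup A - e/2 < a"
    using less_cSup_iff[OF \<open>A \<noteq> {}\<close> bA, of "Sup A - e/2"] \<open>0 < e\<close> by auto
  obtain b where b: "b \<in> B" "b < Inf B + e/2"
    using cInf_less_iff[OF \<open>B \<noteq> {}\<close> bB, of "Inf B + e/2"] \<open>0 < e\<close> by auto
  \<comment> \<open>A and B need not attain their bounds, so a is taken near the top of A and b near
    the bottom of B. The translates A + b and a + B both lie in C, and up to length e the first lies
    to the left of the second. A Borel superset C is used since the sumset itself need not be
    Borel.\<close>
  define A' where "A' = {x. x - b \<in> A}"
  define B' where "B' = {x. x - a \<in> B}"
  have [measurable]: "A' \<in> sets borel" "B' \<in> sets borel"
    unfolding A'_def B'_def by measurable
  have shift: "emeasure lborel {x. x - t \<in> S} = emeasure lborel S"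
    if [measurable]: "S \<in> sets borel" for S :: "real set" and t
  proof -
    have "emeasure lborel {x. x - t \<in> S} = (\<integral>\<^sup>+x. indicator {x. x - t \<in> S} x \<partial>lborel)"
      by simp
    also have "\<dots> = (\<integral>\<^sup>+x. indicator {x. x - t \<in> S} (t + 1 * x) \<partial>lborel)"
      using nn_integral_real_affine[of "indicator {x. x - t \<in> S}" 1 t] by (simp del: nn_integral_indicator)
    also have "\<dots> = (\<integral>\<^sup>+x. indicator S x \<partial>lborel)"
      by (intro nn_integral_cong) (auto simp: indicator_def)
    finally show ?thesis by simp
  qed
  have "A' \<union> B' \<subseteq> C"
    using sub[OF _ b(1)] sub[OF a(1)] unfolding A'_def B'_def
    by (force simp: algebra_simps)
  have "A' \<inter> B' \<subseteq> {Sup A + Inf B - e/2 .. Sup A + Inf B + e/2}"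
    using cSup_upper[OF _ bA] cInf_lower[OF _ bB] a b unfolding A'_def B'_def
    by (force simp: algebra_simps)
  then have "emeasure lborel (A' \<inter> B') \<le> emeasure lborel {Sup A + Inf B - e/2 .. Sup A + Inf B + e/2}"
    by (intro emeasure_mono) auto
  also have "\<dots> = ennreal e" using \<open>0 < e\<close> by simp
  finally have "emeasure lborel (A' \<inter> B') \<le> ennreal e" .
  moreover have "emeasure lborel (A' \<union> B') \<le> emeasure lborel C"
    using \<open>A' \<union> B' \<subseteq> C\<close> by (intro emeasure_mono) auto
  moreover have "emeasure lborel A + emeasure lborel B = emeasure lborel A' + emeasure lborel B'"
    unfolding A'_def B'_def by (simp add: shift)
  moreover have "\<dots> = emeasure lborel (A' \<union> B') + emeasure lborel (A' \<inter> B')"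
    by (rule emeasure_Un_Int) auto
  ultimately show "emeasure lborel A + emeasure lborel B \<le> emeasure lborel C + ennreal e"
    by (simp add: add_mono)
qed

lemma emeasure_scale_real:
  fixes S :: "real set"
  assumes [measurable]: "S \<in> sets borel" and "0 < l"
  shows "emeasure lborel {x. x / l \<in> S} = ennreal l * emeasure lborel S"
proof -
  have "emeasure lborel {x. x / l \<in> S} = (\<integral>\<^sup>+x. indicator {x. x / l \<in> S} x \<partial>lborel)"
    by simp
  also have "\<dots> = ennreal l * (\<integral>\<^sup>+x. indicator {x. x / l \<in> S} (0 + l * x) \<partial>lborel)"
    using nn_integral_real_affine[of "indicator {x. x / l \<in> S}" l 0] \<open>0 < l\<close>
    by (simp del: nn_integral_indicator)
  also have "(\<integral>\<^sup>+x. indicator {x. x / l \<in> S} (0 + l * x) \<partial>lborel) = (\<integral>\<^sup>+x. indicator S x \<partial>lborel)"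
    using \<open>0 < l\<close> by (intro nn_integral_cong) (auto simp: indicator_def)
  finally show ?thesis by simp
qed

lemma layer_cake:
  fixes f :: "real \<Rightarrow> real"
  assumes [measurable]: "f \<in> borel_measurable borel"
  shows "(\<integral>\<^sup>+x. ennreal (f x) \<partial>lborel) = (\<integral>\<^sup>+s. indicator {0<..} s * emeasure lborel {x. s < f x} \<partial>lborel)"
proof -
  have "(\<integral>\<^sup>+x. ennreal (f x) \<partial>lborel) = (\<integral>\<^sup>+x. (\<integral>\<^sup>+s. indicator {0<..} s * indicator {x. s < f x} x \<partial>lborel) \<partial>lborel)"
  proof (intro nn_integral_cong)
    fix x
    have "(\<integral>\<^sup>+s. indicator {0<..} s * indicator {x. s < f x} x \<partial>lborel) = (\<integral>\<^sup>+s. indicator {0<..<f x} s \<partial>lborel)"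
      by (intro nn_integral_cong) (auto simp: indicator_def)
    also have "\<dots> = ennreal (f x)"
      by (cases "0 \<le> f x") (auto simp: ennreal_neg)
    finally show "ennreal (f x) = (\<integral>\<^sup>+s. indicator {0<..} s * indicator {x. s < f x} x \<partial>lborel)" by simp
  qed
  also have "\<dots> = (\<integral>\<^sup>+s. (\<integral>\<^sup>+x. indicator {0<..} s * indicator {x. s < f x} x \<partial>lborel) \<partial>lborel)"
    by (rule lborel_pair.Fubini'[symmetric]) measurable
  also have "\<dots> = (\<integral>\<^sup>+s. indicator {0<..} s * emeasure lborel {x. s < f x} \<partial>lborel)"
    by (intro nn_integral_cong) (simp add: nn_integral_cmult)
  finally show ?thesis .
qed

text \<open>With both suprema equal to 1, the level sets of f and g are both nonempty for s < 1 and
  both empty for s > 1, so the one-dimensional Brunn-Minkowski inequality applies level by level and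
  is integrated over s. This yields the arithmetic mean of the integrals, which is stronger than the
  geometric one.\<close>

lemma prekopa_leindler_real_normalized:
  fixes f g h :: "real \<Rightarrow> real"
  assumes [measurable]: "f \<in> borel_measurable borel" "g \<in> borel_measurable borel" "h \<in> borel_measurable borel"
    and l: "0 < l" "l < 1"
    and f: "\<And>x. f x \<le> 1" "\<And>s. s < 1 \<Longrightarrow> \<exists>x. s < f x" "\<And>x. f x > 0 \<Longrightarrow> \<bar>x\<bar> \<le> R"
    and g: "\<And>x. g x \<le> 1" "\<And>s. s < 1 \<Longrightarrow> \<exists>x. s < g x" "\<And>x. g x > 0 \<Longrightarrow> \<bar>x\<bar> \<le> R"
    and h: "\<And>x y s. 0 < s \<Longrightarrow> s < f x \<Longrightarrow> s < g y \<Longrightarrow> s < h (l * x + (1 - l) * y)"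
  shows "ennreal l * (\<integral>\<^sup>+x. ennreal (f x) \<partial>lborel) + ennreal (1 - l) * (\<integral>\<^sup>+x. ennreal (g x) \<partial>lborel)
       \<le> (\<integral>\<^sup>+x. ennreal (h x) \<partial>lborel)"
proof -
  have m[measurable]: "(\<lambda>s. emeasure lborel {x. s < k x}) \<in> borel_measurable borel"
    if [measurable]: "k \<in> borel_measurable borel" for k :: "real \<Rightarrow> real"
  proof -
    have "(\<lambda>s. emeasure lborel {x \<in> space lborel. s < k x}) \<in> borel_measurable borel"
      by measurable
    then show ?thesis by simp
  qed
  have "ennreal l * (\<integral>\<^sup>+x. ennreal (f x) \<partial>lborel) + ennreal (1 - l) * (\<integral>\<^sup>+x. ennreal (g x) \<partial>lborel)
     = (\<integral>\<^sup>+s. indicator {0<..} s * (ennreal l * emeasure lborel {x. s < f x} + ennreal (1 - l) * emeasure lborel {x. s < g x}) \<partial>lborel)"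
    by (simp add: layer_cake nn_integral_add nn_integral_cmult distrib_left mult.left_commute)
  also have "\<dots> \<le> (\<integral>\<^sup>+s. indicator {0<..} s * emeasure lborel {x. s < h x} \<partial>lborel)"
  proof (intro nn_integral_mono)
    fix s :: real
    consider "s \<le> 0" | "0 < s" "s < 1" | "1 \<le> s" by linarith
    then show "indicator {0<..} s * (ennreal l * emeasure lborel {x. s < f x} + ennreal (1 - l) * emeasure lborel {x. s < g x})
       \<le> indicator {0<..} s * emeasure lborel {x. s < h x}"
    proof cases
      case 2
      define A B where "A = {x. x / l \<in> {x. s < f x}}" and "B = {x. x / (1 - l) \<in> {x. s < g x}}"
      have "emeasure lborel A + emeasure lborel B \<le> emeasure lborel {x. s < h x}"
      proof (rule brunn_minkowski_real)
        show "A \<in> sets borel" "B \<in> sets borel" unfolding A_def B_def by measurable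
        show "{x. s < h x} \<in> sets borel" by measurable
        obtain x where "s < f x" using f(2) 2 by auto
        then have "l * x \<in> A" using l by (simp add: A_def)
        then show "A \<noteq> {}" by auto
        obtain x where "s < g x" using g(2) 2 by auto
        then have "(1 - l) * x \<in> B" using l by (simp add: B_def)
        then show "B \<noteq> {}" by auto
        have "\<bar>x\<bar> \<le> l * R" if "x \<in> A" for x
          using that f(3)[of "x / l"] 2 l by (auto simp: A_def abs_divide field_simps)
        then show "bounded A" by (auto simp: bounded_iff)
        have "\<bar>x\<bar> \<le> (1 - l) * R" if "x \<in> B" for x
          using that g(3)[of "x / (1 - l)"] 2 l by (auto simp: B_def abs_divide field_simps)
        then show "bounded B" by (auto simp: bounded_iff)
        fix a b assume "a \<in> A" "b \<in> B"
        then show "a + b \<in> {x. s < h x}"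
          using h[of s "a / l" "b / (1 - l)"] 2 l by (auto simp: A_def B_def)
      qed
      moreover have "emeasure lborel A = ennreal l * emeasure lborel {x. s < f x}"
        unfolding A_def using l by (intro emeasure_scale_real) auto
      moreover have "emeasure lborel B = ennreal (1 - l) * emeasure lborel {x. s < g x}"
        unfolding B_def using l by (intro emeasure_scale_real) auto
      ultimately show ?thesis using 2 by simp
    next
      case 3
      have "{x. s < f x} = {}" "{x. s < g x} = {}"
        using f(1) g(1) 3 by (auto simp: not_less intro: order_trans)
      then show ?thesis by simp
    qed simp
  qed
  finally show ?thesis by (simp add: layer_cake)
qed

lemma bounded_nn_integral_real:
  fixes f :: "real \<Rightarrow> real"
  assumes "\<And>x. f x \<le> K" "\<And>x. f x > 0 \<Longrightarrow> \<bar>x\<bar> \<le> R" "0 \<le> K" "0 \<le> R"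
  shows "(\<integral>\<^sup>+x. ennreal (f x) \<partial>lborel) \<le> ennreal (K * (2 * R))"
proof -
  have "(\<integral>\<^sup>+x. ennreal (f x) \<partial>lborel) \<le> (\<integral>\<^sup>+x. ennreal K * indicator {-R..R} x \<partial>lborel)"
  proof (intro nn_integral_mono)
    fix x show "ennreal (f x) \<le> ennreal K * indicator {-R..R} x"
      using assms(1)[of x] assms(2)[of x]
      by (cases "f x > 0") (auto simp: indicator_def ennreal_neg ennreal_leI split: if_splits)
  qed
  also have "\<dots> = ennreal (K * (2 * R))"
    using assms by (simp add: nn_integral_cmult ennreal_mult)
  finally show ?thesis .
qed

text \<open>Rescaling reduces to suprema equal to 1, and weighted AM-GM then passes from the
  arithmetic to the geometric mean. The bounds K and R keep the integrals of f and g finite, so that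
  \<open>enn2real\<close> loses nothing.\<close>

lemma prekopa_leindler_real:
  fixes f g h :: "real \<Rightarrow> real"
  assumes [measurable]: "f \<in> borel_measurable borel" "g \<in> borel_measurable borel" "h \<in> borel_measurable borel"
    and l: "0 < l" "l < 1"
    and f: "\<And>x. 0 \<le> f x" "\<And>x. f x \<le> K" "\<And>x. f x > 0 \<Longrightarrow> \<bar>x\<bar> \<le> R"
    and g: "\<And>x. 0 \<le> g x" "\<And>x. g x \<le> K" "\<And>x. g x > 0 \<Longrightarrow> \<bar>x\<bar> \<le> R"
    and h: "\<And>x y. f x powr l * g y powr (1 - l) \<le> h (l * x + (1 - l) * y)"
  shows "ennreal (enn2real (\<integral>\<^sup>+x. f x \<partial>lborel) powr l * enn2real (\<integral>\<^sup>+x. g x \<partial>lborel) powr (1 - l))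
       \<le> (\<integral>\<^sup>+x. h x \<partial>lborel)"
proof (cases "(\<exists>x. 0 < f x) \<and> (\<exists>x. 0 < g x)")
  case False
  then have "(\<forall>x. f x = 0) \<or> (\<forall>x. g x = 0)"
    using f(1) g(1) by (metis less_eq_real_def)
  then show ?thesis by (auto simp: l)
next
  case True
  have R: "0 \<le> R" using True f(3) by force
  have K: "0 \<le> K" using f order_trans by blast
  \<comment> \<open>Dividing f by a and g by b divides their weighted geometric mean by c, so h has
    to be divided by c.\<close>
  define a b c where "a = Sup (range f)" and "b = Sup (range g)" and "c = a powr l * b powr (1 - l)"
  have bf: "bdd_above (range f)" and bg: "bdd_above (range g)"
    using f(2) g(2) by (auto intro!: bdd_aboveI)
  have fa: "f x \<le> a" and gb: "g x \<le> b" for x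
    unfolding a_def b_def using bf bg by (auto intro: cSup_upper)
  have ab: "0 < a" "0 < b" using True fa gb by (meson less_le_trans)+
  then have c: "0 < c" by (simp add: c_def)
  have "ennreal l * (\<integral>\<^sup>+x. ennreal (f x / a) \<partial>lborel) + ennreal (1 - l) * (\<integral>\<^sup>+x. ennreal (g x / b) \<partial>lborel)
      \<le> (\<integral>\<^sup>+x. ennreal (h x / c) \<partial>lborel)"
  proof (rule prekopa_leindler_real_normalized[where R = R])
    show "f x / a \<le> 1" "g x / b \<le> 1" for x using fa gb ab by auto
    show "\<exists>x. s < f x / a" if "s < 1" for s
    proof -
      have "s * a < Sup (range f)" unfolding a_def[symmetric] using that ab by simp
      then show ?thesis using less_cSup_iff[OF _ bf] ab by (auto simp: field_simps)
    qed
    show "\<exists>x. s < g x / b" if "s < 1" for s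
    proof -
      have "s * b < Sup (range g)" unfolding b_def[symmetric] using that ab by simp
      then show ?thesis using less_cSup_iff[OF _ bg] ab by (auto simp: field_simps)
    qed
    show "\<bar>x\<bar> \<le> R" if "f x / a > 0" for x using that ab f(3) by (simp add: zero_less_divide_iff)
    show "\<bar>x\<bar> \<le> R" if "g x / b > 0" for x using that ab g(3) by (simp add: zero_less_divide_iff)
    fix x y s :: real assume s: "0 < s" "s < f x / a" "s < g y / b"
    have "s = s powr l * s powr (1 - l)"
      using s l by (simp add: powr_add[symmetric])
    also have "\<dots> < (f x / a) powr l * (g y / b) powr (1 - l)"
      using s l by (intro mult_strict_mono powr_less_mono2) auto
    also have "\<dots> = (f x powr l * g y powr (1 - l)) / c"
      using s f(1) g(1) ab by (simp add: c_def powr_divide)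
    also have "\<dots> \<le> h (l * x + (1 - l) * y) / c"
      using h[of x y] c by (simp add: divide_right_mono)
    finally show "s < h (l * x + (1 - l) * y) / c" .
  qed (use l in measurable)
  moreover define F G where "F = enn2real (\<integral>\<^sup>+x. ennreal (f x) \<partial>lborel)"
    and "G = enn2real (\<integral>\<^sup>+x. ennreal (g x) \<partial>lborel)"
  have F: "(\<integral>\<^sup>+x. ennreal (f x) \<partial>lborel) = ennreal F"
    unfolding F_def using le_less_trans[OF bounded_nn_integral_real[of f K R]] f(2,3) R K by simp
  have G: "(\<integral>\<^sup>+x. ennreal (g x) \<partial>lborel) = ennreal G"
    unfolding G_def using le_less_trans[OF bounded_nn_integral_real[of g K R]] g(2,3) R K by simp
  have FG: "0 \<le> F" "0 \<le> G" by (simp_all add: F_def G_def)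
  have div: "(\<integral>\<^sup>+x. ennreal (k x / d) \<partial>lborel) = ennreal (1/d) * (\<integral>\<^sup>+x. ennreal (k x) \<partial>lborel)"
    if "0 < d" and [measurable]: "k \<in> borel_measurable borel" for k :: "real \<Rightarrow> real" and d
    using that by (subst nn_integral_cmult[symmetric]) (auto simp: ennreal_mult'[symmetric])
  ultimately have "ennreal (l * (F / a) + (1 - l) * (G / b)) \<le> ennreal (1/c) * (\<integral>\<^sup>+x. ennreal (h x) \<partial>lborel)"
    using l ab c FG by (simp add: div F G ennreal_mult'[symmetric] ennreal_plus[symmetric] del: ennreal_plus)
  moreover have "(F/a) powr l * (G/b) powr (1 - l) \<le> l * (F / a) + (1 - l) * (G / b)"
    by (cases "F = 0 \<or> G = 0") (use FG ab l Youngs_inequality_0[of l "1 - l" "F/a" "G/b"] in auto)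
  ultimately have "ennreal ((F/a) powr l * (G/b) powr (1 - l)) \<le> ennreal (1/c) * (\<integral>\<^sup>+x. ennreal (h x) \<partial>lborel)"
    using ennreal_leI order_trans by blast
  then have "ennreal c * ennreal ((F/a) powr l * (G/b) powr (1 - l)) \<le> ennreal c * (ennreal (1/c) * (\<integral>\<^sup>+x. ennreal (h x) \<partial>lborel))"
    by (rule mult_left_mono) simp
  also have "\<dots> = (\<integral>\<^sup>+x. ennreal (h x) \<partial>lborel)"
    using c by (simp add: mult.assoc[symmetric] ennreal_mult'[symmetric])
  finally have "ennreal c * ennreal ((F/a) powr l * (G/b) powr (1 - l)) \<le> (\<integral>\<^sup>+x. ennreal (h x) \<partial>lborel)" .
  moreover have "c * ((F/a) powr l * (G/b) powr (1 - l)) = F powr l * G powr (1 - l)"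
    using ab FG by (simp add: c_def powr_divide)
  ultimately show ?thesis
    unfolding F_def[symmetric] G_def[symmetric] using c by (simp add: ennreal_mult'[symmetric])
qed

text \<open>Induction on the coordinates: integrating out one of them preserves the hypothesis, by
  the one-dimensional inequality on slices. The bounds belong to the induction too: a marginal of
  functions bounded by K is bounded by K * (2 * R) and keeps its support in the same cube.\<close>

lemma prekopa_leindler_PiM:
  fixes f g h :: "('i \<Rightarrow> real) \<Rightarrow> real"
  assumes "finite I" and l: "0 < l" "l < 1" and "0 \<le> R"
    and "f \<in> borel_measurable (Pi\<^sub>M I (\<lambda>_. lborel))" "g \<in> borel_measurable (Pi\<^sub>M I (\<lambda>_. lborel))"
      "h \<in> borel_measurable (Pi\<^sub>M I (\<lambda>_. lborel))"
    and "\<And>k x. k \<in> {f, g, h} \<Longrightarrow> 0 \<le> k x \<and> k x \<le> K \<and> (k x > 0 \<longrightarrow> (\<forall>i\<in>I. \<bar>x i\<bar> \<le> R))"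
    and "\<And>x y. x \<in> extensional I \<Longrightarrow> y \<in> extensional I \<Longrightarrow>
          f x powr l * g y powr (1 - l) \<le> h (\<lambda>i\<in>I. l * x i + (1 - l) * y i)"
  shows "ennreal (enn2real (\<integral>\<^sup>+x. f x \<partial>Pi\<^sub>M I (\<lambda>_. lborel)) powr l * enn2real (\<integral>\<^sup>+x. g x \<partial>Pi\<^sub>M I (\<lambda>_. lborel)) powr (1 - l))
       \<le> (\<integral>\<^sup>+x. h x \<partial>Pi\<^sub>M I (\<lambda>_. lborel))"
  using assms(1,5-)
proof (induction I arbitrary: f g h K rule: finite_induct)
  case empty
  interpret product_sigma_finite "\<lambda>_::'i. lborel :: real measure" by standard
  have "f (\<lambda>_. undefined) powr l * g (\<lambda>_. undefined) powr (1 - l) \<le> h (\<lambda>_. undefined)"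
    using empty(5)[of "\<lambda>_. undefined" "\<lambda>_. undefined"] by simp
  then show ?case
    using empty(4) by (simp add: nn_integral_empty ennreal_leI)
next
  case (insert i I)
  interpret product_sigma_finite "\<lambda>_::'i. lborel :: real measure" by standard
  let ?P = "\<lambda>I. Pi\<^sub>M I (\<lambda>_. lborel) :: ('i \<Rightarrow> real) measure"
  define J where "J k x = (\<integral>\<^sup>+t. ennreal (k (x(i := t))) \<partial>lborel)" for k :: "('i \<Rightarrow> real) \<Rightarrow> real" and x
  have meas: "k \<in> borel_measurable (?P (insert i I))" if "k \<in> {f, g, h}" for k
    using insert.prems that by auto
  have J_meas: "J k \<in> borel_measurable (?P I)" if "k \<in> {f, g, h}" for k
  proof -
    have [measurable]: "k \<in> borel_measurable (?P (insert i I))" by (rule meas[OF that])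
    have "(\<lambda>(x, t). ennreal (k (x(i := t)))) \<in> borel_measurable (?P I \<Otimes>\<^sub>M lborel)"
      by measurable
    then show ?thesis
      unfolding J_def by (rule sigma_finite_measure.borel_measurable_nn_integral[OF sigma_finite_lborel])
  qed
  have slice: "(\<lambda>t. k (x(i := t))) \<in> borel_measurable borel"
    if "k \<in> {f, g, h}" "x \<in> extensional I" for k x
  proof -
    have [measurable]: "k \<in> borel_measurable (?P (insert i I))" by (rule meas[OF that(1)])
    have "x \<in> space (?P I)" using that by (simp add: space_PiM PiE_def)
    then show ?thesis by measurable
  qed
  have K: "0 \<le> K" using insert.prems(4)[of f] order_trans by blast
  have J_le: "J k x \<le> ennreal (K * (2 * R))" if "k \<in> {f, g, h}" for k x
    unfolding J_def
  proof (rule bounded_nn_integral_real)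
    show "k (x(i := t)) \<le> K" for t using insert.prems(4)[OF that] by simp
    show "\<bar>t\<bar> \<le> R" if "0 < k (x(i := t))" for t
    proof -
      have "\<forall>j\<in>insert i I. \<bar>(x(i := t)) j\<bar> \<le> R"
        using insert.prems(4)[OF \<open>k \<in> {f, g, h}\<close>, of "x(i := t)"] that by blast
      then show ?thesis by simp
    qed
  qed (use K \<open>0 \<le> R\<close> in auto)
  \<comment> \<open>The induction hypothesis speaks of real functions, and the marginals
    \<open>J\<close> are finite by \<open>J_le\<close>.\<close>
  define r where "r k x = enn2real (J k x)" for k x
  have J_r: "J k x = ennreal (r k x)" if "k \<in> {f, g, h}" for k x
    unfolding r_def using le_less_trans[OF J_le[OF that]] by simp
  have int: "(\<integral>\<^sup>+x. ennreal (k x) \<partial>?P (insert i I)) = (\<integral>\<^sup>+x. ennreal (r k x) \<partial>?P I)"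
    if "k \<in> {f, g, h}" for k
  proof -
    have [measurable]: "k \<in> borel_measurable (?P (insert i I))" by (rule meas[OF that])
    show ?thesis
      by (subst product_nn_integral_insert[OF insert.hyps])
        (auto simp: J_r[OF that, symmetric] J_def)
  qed
  have "ennreal (enn2real (\<integral>\<^sup>+x. r f x \<partial>?P I) powr l * enn2real (\<integral>\<^sup>+x. r g x \<partial>?P I) powr (1 - l))
       \<le> (\<integral>\<^sup>+x. r h x \<partial>?P I)"
  proof (rule insert.IH)
    show "r f \<in> borel_measurable (?P I)" "r g \<in> borel_measurable (?P I)" "r h \<in> borel_measurable (?P I)"
      unfolding r_def using J_meas by auto
    fix x y :: "'i \<Rightarrow> real" assume xy: "x \<in> extensional I" "y \<in> extensional I"
    let ?z = "\<lambda>i\<in>I. l * x i + (1 - l) * y i"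
    have "ennreal (r f x powr l * r g y powr (1 - l)) \<le> J h ?z"
      unfolding r_def J_def
    proof (rule prekopa_leindler_real[where K = K and R = R])
      show "(\<lambda>t. f (x(i := t))) \<in> borel_measurable borel" "(\<lambda>t. g (y(i := t))) \<in> borel_measurable borel"
        "(\<lambda>t. h (?z(i := t))) \<in> borel_measurable borel"
        using xy by (auto intro!: slice simp del: fun_upd_apply)
      show "f (x(i := s)) powr l * g (y(i := t)) powr (1 - l) \<le> h (?z(i := l * s + (1 - l) * t))" for s t
      proof -
        have "f (x(i := s)) powr l * g (y(i := t)) powr (1 - l)
            \<le> h (\<lambda>j\<in>insert i I. l * (x(i := s)) j + (1 - l) * (y(i := t)) j)"
          using xy by (intro insert.prems(5)) (auto simp: extensional_def)
        also have "(\<lambda>j\<in>insert i I. l * (x(i := s)) j + (1 - l) * (y(i := t)) j) = ?z(i := l * s + (1 - l) * t)"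
          using insert.hyps by (auto simp: fun_eq_iff)
        finally show ?thesis .
      qed
      show "\<bar>t\<bar> \<le> R" if "0 < f (x(i := t))" for t
        using insert.prems(4)[of f "x(i := t)", THEN conjunct2, THEN conjunct2, rule_format, of i] that by simp
      show "\<bar>t\<bar> \<le> R" if "0 < g (y(i := t))" for t
        using insert.prems(4)[of g "y(i := t)", THEN conjunct2, THEN conjunct2, rule_format, of i] that by simp
    qed (use l insert.prems(4) in auto)
    then show "r f x powr l * r g y powr (1 - l) \<le> r h ?z"
      by (simp add: J_r) (simp add: r_def)
  next
    fix k' x assume "k' \<in> {r f, r g, r h}"
    then obtain k where k: "k \<in> {f, g, h}" "k' = r k" by auto
    have "r k x \<le> K * (2 * R)"
      using J_le[OF k(1), of x] K \<open>0 \<le> R\<close> unfolding J_r[OF k(1)] by simp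
    \<comment> \<open>If coordinate j is out of range, the whole slice vanishes, and so does its
      integral.\<close>
    moreover have "\<bar>x j\<bar> \<le> R" if "0 < r k x" "j \<in> I" for j
    proof (rule ccontr)
      assume "\<not> \<bar>x j\<bar> \<le> R"
      moreover have "j \<noteq> i" using that insert.hyps by auto
      ultimately have "\<not> 0 < k (x(i := t))" for t
        using insert.prems(4)[OF k(1), of "x(i := t)", THEN conjunct2, THEN conjunct2, rule_format, of j] \<open>j \<in> I\<close>
        by auto
      then have "k (x(i := t)) = 0" for t
        using insert.prems(4)[OF k(1), of "x(i := t)", THEN conjunct1] by (rule order_antisym[OF leI])
      then show False using that by (simp add: r_def J_def)
    qed
    ultimately show "0 \<le> k' x \<and> k' x \<le> K * (2 * R) \<and> (0 < k' x \<longrightarrow> (\<forall>i\<in>I. \<bar>x i\<bar> \<le> R))"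
      using k(2) by (auto simp: r_def)
  qed
  then show ?case by (simp add: int)
qed

theorem prekopa_leindler:
  fixes f g h :: "'a::euclidean_space \<Rightarrow> real"
  assumes l: "0 < l" "l < 1"
    and [measurable]: "f \<in> borel_measurable borel" "g \<in> borel_measurable borel" "h \<in> borel_measurable borel"
    and b: "\<And>k x. k \<in> {f, g, h} \<Longrightarrow> 0 \<le> k x \<and> k x \<le> K \<and> (k x > 0 \<longrightarrow> norm x \<le> R)"
    and h: "\<And>x y. f x powr l * g y powr (1 - l) \<le> h (l *\<^sub>R x + (1 - l) *\<^sub>R y)"
  shows "ennreal (enn2real (\<integral>\<^sup>+x. f x \<partial>lborel) powr l * enn2real (\<integral>\<^sup>+x. g x \<partial>lborel) powr (1 - l))
       \<le> (\<integral>\<^sup>+x. h x \<partial>lborel)"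
proof -
  let ?E = "\<lambda>x :: 'a \<Rightarrow> real. \<Sum>b\<in>Basis. x b *\<^sub>R b"
  let ?P = "Pi\<^sub>M Basis (\<lambda>_. lborel) :: ('a \<Rightarrow> real) measure"
  have E[measurable]: "?E \<in> measurable ?P borel" by measurable
  have int: "(\<integral>\<^sup>+x. ennreal (k x) \<partial>lborel) = (\<integral>\<^sup>+x. ennreal (k (?E x)) \<partial>?P)"
    if [measurable]: "k \<in> borel_measurable borel" for k :: "'a \<Rightarrow> real"
    by (subst lborel_eq) (simp add: nn_integral_distr)
  have "ennreal (enn2real (\<integral>\<^sup>+x. f (?E x) \<partial>?P) powr l * enn2real (\<integral>\<^sup>+x. g (?E x) \<partial>?P) powr (1 - l))
       \<le> (\<integral>\<^sup>+x. h (?E x) \<partial>?P)"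
  \<comment> \<open>Each coordinate is bounded by the norm. R itself may be negative when all three
    functions vanish, hence the maximum with 0.\<close>
  proof (rule prekopa_leindler_PiM[OF finite_Basis l, where R = "max R 0" and K = K])
    fix x y :: "'a \<Rightarrow> real"
    have "?E (\<lambda>i\<in>Basis. l * x i + (1 - l) * y i) = l *\<^sub>R ?E x + (1 - l) *\<^sub>R ?E y"
      by (simp add: scaleR_add_left scaleR_sum_right sum.distrib)
    then show "f (?E x) powr l * g (?E y) powr (1 - l) \<le> h (?E (\<lambda>i\<in>Basis. l * x i + (1 - l) * y i))"
      using h[of "?E x" "?E y"] by simp
  next
    fix k' and x :: "'a \<Rightarrow> real"
    assume "k' \<in> {\<lambda>x. f (?E x), \<lambda>x. g (?E x), \<lambda>x. h (?E x)}"
    then obtain k where k: "k \<in> {f, g, h}" "k' = (\<lambda>x. k (?E x))" by auto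
    have "\<bar>x i\<bar> \<le> norm (?E x)" if "i \<in> Basis" for i
    proof -
      have "x i = ?E x \<bullet> i" using that by (simp add: inner_sum_left inner_Basis if_distrib cong: if_cong)
      then show ?thesis using Basis_le_norm[OF that, of "?E x"] by simp
    qed
    then show "0 \<le> k' x \<and> k' x \<le> K \<and> (0 < k' x \<longrightarrow> (\<forall>i\<in>Basis. \<bar>x i\<bar> \<le> max R 0))"
      using b[OF k(1), of "?E x"] k(2) by (force intro: order_trans)
  qed auto
  then show ?thesis by (simp add: int)
qed

text \<open>Compact subsets suffice, since their Minkowski combinations are compact.\<close>

theorem log_concave_prob_density:
  fixes F :: "'a::euclidean_space \<Rightarrow> real"
  assumes [measurable]: "F \<in> borel_measurable borel"
    and F: "\<And>x. 0 \<le> F x" "\<And>r. \<exists>K. \<forall>x. norm x \<le> r \<longrightarrow> F x \<le> K"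
    and lc: "\<And>x y l. 0 < l \<Longrightarrow> l < 1 \<Longrightarrow> F x powr l * F y powr (1 - l) \<le> F (l *\<^sub>R x + (1 - l) *\<^sub>R y)"
    and prob: "prob_space (density lborel F)"
  shows "log_concave_prob (density lborel F)"
  unfolding log_concave_prob_def
proof (intro conjI ballI allI impI)
  let ?\<mu> = "density lborel F"
  interpret prob_space ?\<mu> by fact
  show "prob_space ?\<mu>" "sets ?\<mu> = sets borel" using prob by auto
  fix A B :: "'a set" and l :: real
  assume A: "A \<in> sets borel" and B: "B \<in> sets borel" and "0 < l \<and> l < 1"
  then have l: "0 < l" "l < 1" by auto
  define S where "S A B = {l *\<^sub>R a + (1 - l) *\<^sub>R b |a b. a \<in> A \<and> b \<in> B}" for A B :: "'a set"
  have compact_case: "ennreal (measure ?\<mu> A' powr l * measure ?\<mu> B' powr (1 - l)) \<le> inner_emeasure ?\<mu> (S A B)"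
    if "compact A'" "compact B'" "A' \<subseteq> A" "B' \<subseteq> B" for A' B'
  proof -
    have "compact ((\<lambda>(a, b). l *\<^sub>R a + (1 - l) *\<^sub>R b) ` (A' \<times> B'))"
      using that by (intro compact_continuous_image compact_Times)
        (auto intro!: continuous_intros simp: case_prod_beta)
    also have "(\<lambda>(a, b). l *\<^sub>R a + (1 - l) *\<^sub>R b) ` (A' \<times> B') = S A' B'"
      by (auto simp: S_def)
    finally have S: "compact (S A' B')" .
    obtain R where R: "\<And>x. x \<in> A' \<union> B' \<union> S A' B' \<Longrightarrow> norm x \<le> R"
      using compact_imp_bounded[OF \<open>compact A'\<close>] compact_imp_bounded[OF \<open>compact B'\<close>]
        compact_imp_bounded[OF S] bounded_Un unfolding bounded_iff[symmetric] by (metis bounded_iff)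
    obtain K where K: "\<And>x. norm x \<le> R \<Longrightarrow> F x \<le> K" using F(2) by blast
    have [measurable]: "A' \<in> sets borel" "B' \<in> sets borel" "S A' B' \<in> sets borel"
      using that(1,2) S by (simp_all only: borel_compact)
    have int: "(\<integral>\<^sup>+x. F x * indicator T x \<partial>lborel) = emeasure ?\<mu> T" if [measurable]: "T \<in> sets borel" for T
      by (subst emeasure_density) (auto intro!: nn_integral_cong simp: ennreal_mult' F split: split_indicator)
    have "ennreal (enn2real (\<integral>\<^sup>+x. F x * indicator A' x \<partial>lborel) powr l
           * enn2real (\<integral>\<^sup>+x. F x * indicator B' x \<partial>lborel) powr (1 - l))
       \<le> (\<integral>\<^sup>+x. F x * indicator (S A' B') x \<partial>lborel)"
    proof (rule prekopa_leindler[OF l, where K = "max K 0" and R = R])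
      fix x y :: 'a
      \<comment> \<open>Outside A' or B' the left side is 0, because \<open>0 powr l = 0\<close>;
        inside, the combined point lies in \<open>S A' B'\<close>.\<close>
      show "(F x * indicator A' x) powr l * (F y * indicator B' y) powr (1 - l)
          \<le> F (l *\<^sub>R x + (1 - l) *\<^sub>R y) * indicator (S A' B') (l *\<^sub>R x + (1 - l) *\<^sub>R y)"
        using lc[OF l, of x y] F(1) l by (auto simp: S_def split: split_indicator)
    next
      fix k x
      assume "k \<in> {\<lambda>x. F x * indicator A' x, \<lambda>x. F x * indicator B' x, \<lambda>x. F x * indicator (S A' B') x}"
      then obtain T where k: "k = (\<lambda>x. F x * indicator T x)" "T \<subseteq> A' \<union> B' \<union> S A' B'" by auto
      show "0 \<le> k x \<and> k x \<le> max K 0 \<and> (0 < k x \<longrightarrow> norm x \<le> R)"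
        using k(2) F(1)[of x] R[of x] K[of x] by (auto simp: k(1) indicator_def le_max_iff_disj)
    qed auto
    also have "\<dots> = emeasure ?\<mu> (S A' B')" by (rule int) simp
    also have "\<dots> \<le> inner_emeasure ?\<mu> (S A B)"
      unfolding inner_emeasure_def
    proof (rule SUP_upper)
      have "S A' B' \<subseteq> S A B" using that by (auto simp: S_def)
      then show "S A' B' \<in> {C \<in> sets ?\<mu>. C \<subseteq> S A B}" by simp
    qed
    finally show ?thesis by (simp add: int measure_def)
  qed
  \<comment> \<open>Inner regularity, phrased with a sequence so that the limit can be taken inside
    the powers.\<close>
  have approx: "\<exists>K. (\<forall>n. compact (K n) \<and> K n \<subseteq> A) \<and> (\<lambda>n. measure ?\<mu> (K n)) \<longlonglongrightarrow> measure ?\<mu> A"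
    if A: "A \<in> sets borel" for A
  proof -
    have eq: "emeasure ?\<mu> A = (SUP K \<in> {K. K \<subseteq> A \<and> compact K}. emeasure ?\<mu> K)"
      using A by (intro inner_regular) auto
    have "emeasure ?\<mu> ` {K. K \<subseteq> A \<and> compact K} \<noteq> {}" by (auto intro: exI[of _ "{}"])
    from ennreal_Sup_countable_SUP[OF this] obtain X :: "nat \<Rightarrow> ennreal" where X: "incseq X"
      "range X \<subseteq> emeasure ?\<mu> ` {K. K \<subseteq> A \<and> compact K}" "emeasure ?\<mu> A = (SUP i. X i)"
      unfolding eq by auto
    have lim: "X \<longlonglongrightarrow> emeasure ?\<mu> A" unfolding X(3) by (rule LIMSEQ_SUP[OF X(1)])
    have "\<forall>n. \<exists>K. (K \<subseteq> A \<and> compact K) \<and> X n = emeasure ?\<mu> K" using X(2) by (blast dest: subsetD[OF _ rangeI])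
    then obtain K where K: "\<And>n. K n \<subseteq> A \<and> compact (K n)" "\<And>n. X n = emeasure ?\<mu> (K n)"
      by metis
    have "(\<lambda>n. enn2real (X n)) \<longlonglongrightarrow> enn2real (emeasure ?\<mu> A)"
      using lim by (intro tendsto_enn2real) (auto simp: emeasure_eq_measure)
    then show ?thesis using K by (intro exI[of _ K]) (simp add: measure_def)
  qed
  obtain KA KB where K: "\<And>n. compact (KA n) \<and> KA n \<subseteq> A" "(\<lambda>n. measure ?\<mu> (KA n)) \<longlonglongrightarrow> measure ?\<mu> A"
    "\<And>n. compact (KB n) \<and> KB n \<subseteq> B" "(\<lambda>n. measure ?\<mu> (KB n)) \<longlonglongrightarrow> measure ?\<mu> B"
    using approx[OF A] approx[OF B] by metis
  \<comment> \<open>Both exponents are positive, so \<open>powr\<close> is continuous here even when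
    a limit measure is 0.\<close>
  have "(\<lambda>n. ennreal (measure ?\<mu> (KA n) powr l * measure ?\<mu> (KB n) powr (1 - l)))
      \<longlonglongrightarrow> ennreal (measure ?\<mu> A powr l * measure ?\<mu> B powr (1 - l))"
    using l K by (intro tendsto_intros tendsto_powr') auto
  then show "ennreal (measure ?\<mu> A powr l * measure ?\<mu> B powr (1 - l))
      \<le> inner_emeasure ?\<mu> {l *\<^sub>R a + (1 - l) *\<^sub>R b |a b. a \<in> A \<and> b \<in> B}"
    unfolding S_def[symmetric] by (rule LIMSEQ_le_const2) (use K compact_case in auto)
qed

subsection \<open>Unitary conjugation\<close>

definition ctranspose :: "complex^'n^'m \<Rightarrow> complex^'m^'n" where
  "ctranspose A = (\<chi> i j. cnj (A $ j $ i))"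

definition unitary :: "complex^'n^'n \<Rightarrow> bool" where
  "unitary U \<longleftrightarrow> ctranspose U ** U = mat 1"

definition diagm :: "real^'n \<Rightarrow> complex^'n^'n" where
  "diagm t = (\<chi> i j. if i = j then complex_of_real (t $ i) else 0)"

lemma ctranspose_mult: "ctranspose (A ** B) = ctranspose B ** ctranspose A"
  by (simp add: ctranspose_def matrix_matrix_mult_def vec_eq_iff mult.commute)

lemma ctranspose_ctranspose [simp]: "ctranspose (ctranspose A) = A"
  by (simp add: ctranspose_def vec_eq_iff)

lemma ctranspose_diagm [simp]: "ctranspose (diagm t) = diagm t"
  by (simp add: ctranspose_def diagm_def vec_eq_iff)

lemma hermitian_iff: "hermitian A \<longleftrightarrow> ctranspose A = A"
  unfolding hermitian_def ctranspose_def vec_eq_iff by (auto simp: eq_commute)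

lemma unitaryD: "unitary U \<Longrightarrow> ctranspose U ** U = mat 1" "unitary U \<Longrightarrow> U ** ctranspose U = mat 1"
  by (auto simp: unitary_def matrix_left_right_inverse)

lemma unitary_cancel:
  assumes "unitary U"
  shows "ctranspose U ** (U ** A) = A" "U ** (ctranspose U ** A) = A"
  using unitaryD[OF assms] by (simp_all add: matrix_mul_assoc)

lemma diagm_mult_component: "(diagm t ** A) $ i $ j = complex_of_real (t $ i) * A $ i $ j"
  by (simp add: diagm_def matrix_matrix_mult_def if_distrib[of "\<lambda>x. x * _"] cong: if_cong)

lemma mult_diagm_component: "(A ** diagm t) $ i $ j = A $ i $ j * complex_of_real (t $ j)"
proof -
  have "(A ** diagm t) $ i $ j = (\<Sum>k\<in>UNIV. if k = j then A $ i $ k * complex_of_real (t $ k) else 0)"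
    unfolding diagm_def matrix_matrix_mult_def vec_lambda_beta by (intro sum.cong) auto
  then show ?thesis by simp
qed

lemma hermitian_conj:
  "hermitian A \<Longrightarrow> hermitian (U ** A ** ctranspose U)"
  by (simp add: hermitian_iff ctranspose_mult matrix_mul_assoc)

lemma hermitian_diagm [simp]: "hermitian (diagm t)"
  by (simp add: hermitian_iff)

subsection \<open>The spectral theorem\<close>

definition hip :: "complex^'n \<Rightarrow> complex^'n \<Rightarrow> complex" where
  "hip x y = (\<Sum>i\<in>UNIV. cnj (x $ i) * y $ i)"

lemma inner_eq_Re_hip: "x \<bullet> y = Re (hip x y)"
  by (simp add: hip_def inner_vec_def inner_complex_def)

lemma hip_cnj: "hip y x = cnj (hip x y)"
  by (simp add: hip_def mult.commute)

lemma hip_self: "hip x x = complex_of_real ((norm x)\<^sup>2)"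
proof -
  have "Im (hip x x) = 0" by (simp add: hip_def)
  then show ?thesis by (simp add: complex_eq_iff inner_eq_Re_hip[symmetric] power2_norm_eq_inner)
qed

lemma hip_linear:
  "hip x (y + z) = hip x y + hip x z" "hip x (y - z) = hip x y - hip x z" "hip x (r *\<^sub>R y) = complex_of_real r * hip x y"
  "hip (r *\<^sub>R x) y = complex_of_real r * hip x y" "hip x 0 = 0"
  unfolding hip_def
  by (simp_all add: distrib_left sum.distrib right_diff_distrib sum_subtractf sum_distrib_left scaleR_conv_of_real[where 'a = complex] mult_ac)

lemma hip_hermitian:
  assumes "hermitian A"
  shows "hip (A *v x) y = hip x (A *v y)"
proof -
  have "hip (A *v x) y = (\<Sum>i\<in>UNIV. \<Sum>j\<in>UNIV. cnj (A $ i $ j) * cnj (x $ j) * y $ i)"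
    by (simp add: hip_def matrix_vector_mult_def sum_distrib_right)
  also have "\<dots> = (\<Sum>j\<in>UNIV. \<Sum>i\<in>UNIV. cnj (A $ i $ j) * cnj (x $ j) * y $ i)"
    by (rule sum.swap)
  also have "\<dots> = hip x (A *v y)"
  proof -
    have "cnj (A $ i $ j) = A $ j $ i" for i j
      using assms unfolding hermitian_def by metis
    then have "cnj (A $ i $ j) * cnj (x $ j) * y $ i = cnj (x $ j) * (A $ j $ i * y $ i)" for i j
      by (simp only: mult_ac)
    then show ?thesis by (simp only: hip_def matrix_vector_mult_def sum_distrib_left vec_lambda_beta)
  qed
  finally show ?thesis .
qed

lemma matrix_vector_linear_real:
  fixes A :: "complex^'n^'m"
  shows "linear ((*v) A)"
  by (rule linearI)
    (simp_all add: matrix_vector_mult_def vec_eq_iff distrib_left sum.distrib scaleR_sum_right)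

text \<open>Maximise the Rayleigh quotient on the unit sphere of the complement of the u i, which A
  maps to itself. With m the maximum, m - A is a nonnegative symmetric form on the complement that
  vanishes at the maximiser x, and such a form must annihilate x.\<close>

lemma exists_eigenvector_orthogonal:
  fixes A :: "complex^'n^'n" and u :: "nat \<Rightarrow> complex^'n"
  assumes A: "hermitian A" and k: "k < CARD('n)"
    and u: "\<And>i. i < k \<Longrightarrow> A *v u i = d i *\<^sub>R u i"
  shows "\<exists>x m. norm x = 1 \<and> A *v x = m *\<^sub>R x \<and> (\<forall>i<k. hip (u i) x = 0)"
proof -
  let ?S = "{x. \<forall>i<k. hip (u i) x = 0}"
  \<comment> \<open>Complex orthogonality to u i is real orthogonality to both u i and \<i> u i.
    These are at most 2k real vectors in a space of real dimension 2 CARD('n), so the complement is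
    nonzero.\<close>
  let ?B = "u ` {..<k} \<union> (\<lambda>i. \<i> *s u i) ` {..<k}"
  have "card ?B \<le> card (u ` {..<k}) + card ((\<lambda>i. \<i> *s u i) ` {..<k})"
    by (rule card_Un_le)
  also have "\<dots> \<le> k + k" by (intro add_mono) (metis card_image_le card_lessThan finite_lessThan)+
  finally have "dim (span ?B) \<le> k + k"
    using dim_le_card'[of ?B] by (simp add: dim_span)
  then have "dim (span ?B) < DIM(complex^'n)" using k by simp
  then obtain x0 where x0: "x0 \<noteq> 0" "\<And>y. y \<in> span ?B \<Longrightarrow> orthogonal x0 y"
    using orthogonal_to_subspace_exists[of ?B] by (metis dim_span)
  have "hip (u i) x0 = 0" if "i < k" for i
  proof -
    have "u i \<in> span ?B" "\<i> *s u i \<in> span ?B" using that by (auto intro: span_base)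
    then have "u i \<bullet> x0 = 0" "(\<i> *s u i) \<bullet> x0 = 0"
      using x0(2) by (metis inner_commute orthogonal_def)+
    moreover have "hip (\<i> *s u i) x0 = - \<i> * hip (u i) x0"
      by (simp add: hip_def sum_distrib_left mult_ac sum_negf)
    ultimately show ?thesis by (simp add: inner_eq_Re_hip complex_eq_iff)
  qed
  then have x0S: "x0 \<in> ?S" by simp
  let ?K = "?S \<inter> sphere 0 1"
  have "closed {x. hip (u i) x = 0}" for i
    unfolding hip_def by (intro closed_Collect_eq continuous_intros)
  then have "closed (\<Inter>i\<in>{..<k}. {x. hip (u i) x = 0})" by auto
  also have "(\<Inter>i\<in>{..<k}. {x. hip (u i) x = 0}) = ?S" by auto
  finally have "compact ?K" by (intro closed_Int_compact) auto
  moreover have "(1 / norm x0) *\<^sub>R x0 \<in> ?K" using x0S x0(1) by (simp add: hip_linear)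
  moreover have "continuous_on ?K (\<lambda>x. x \<bullet> (A *v x))"
    by (intro continuous_intros linear_continuous_on linear_conv_bounded_linear[THEN iffD1] matrix_vector_linear_real)
  ultimately obtain x where x: "x \<in> ?K" and max: "\<And>y. y \<in> ?K \<Longrightarrow> y \<bullet> (A *v y) \<le> x \<bullet> (A *v x)"
    using continuous_attains_sup[of ?K "\<lambda>x. x \<bullet> (A *v x)"] by blast
  define m where "m = x \<bullet> (A *v x)"
  define T where "T y = m *\<^sub>R y - A *v y" for y
  interpret lA: linear "(*v) A" by (rule matrix_vector_linear_real)
  have T_lin: "T (y + s *\<^sub>R z) = T y + s *\<^sub>R T z" for y z s
    by (simp add: T_def lA.add lA.scaleR algebra_simps)
  have TS: "T y \<in> ?S" if "y \<in> ?S" for y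
  proof -
    have "hip (u i) (A *v y) = 0" if "i < k" for i
      using hip_hermitian[OF A, of "u i" y] u[OF that] \<open>y \<in> ?S\<close> that by (simp add: hip_linear)
    then show ?thesis using that by (simp add: T_def hip_linear)
  qed
  have T_sym: "y \<bullet> T z = z \<bullet> T y" for y z
  proof -
    have "y \<bullet> (A *v z) = (A *v y) \<bullet> z"
      by (simp add: inner_eq_Re_hip hip_hermitian[OF A])
    then show ?thesis unfolding T_def inner_diff_right by (simp add: inner_commute)
  qed
  have T_pos: "0 \<le> y \<bullet> T y" if "y \<in> ?S" for y
  proof (cases "y = 0")
    case False
    have "(1 / norm y) *\<^sub>R y \<in> ?K" using that False by (simp add: hip_linear)
    from max[OF this] have "(y \<bullet> (A *v y)) / (norm y)\<^sup>2 \<le> m"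
      by (simp add: m_def lA.scaleR power2_eq_square)
    then show ?thesis using False
      by (simp add: T_def inner_diff_right field_simps power2_norm_eq_inner)
  qed simp
  have x1: "norm x = 1" "x \<in> ?S" using x by auto
  have Tx0: "x \<bullet> T x = 0"
    using x1(1) by (simp add: T_def inner_diff_right m_def power2_norm_eq_inner[symmetric])
  define z where "z = T x"
  have zS: "z \<in> ?S" unfolding z_def by (rule TS[OF x1(2)])
  \<comment> \<open>The form at x + s z, whose constant term is 0. If the linear coefficient were
    positive, a small negative s would make the value negative.\<close>
  have "0 \<le> 2 * s * (z \<bullet> z) + s\<^sup>2 * (z \<bullet> T z)" for s
  proof -
    have "x + s *\<^sub>R z \<in> ?S" using x1(2) zS by (simp add: hip_linear)
    from T_pos[OF this] show ?thesis
      using Tx0 T_sym[of x z] by (simp add: T_lin inner_add_left inner_add_right z_def[symmetric] power2_eq_square algebra_simps)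
  qed note quad = this
  have "z \<bullet> z = 0"
  proof (rule ccontr)
    assume "z \<bullet> z \<noteq> 0"
    then have p: "0 < z \<bullet> z" by (simp add: order.not_eq_order_implies_strict)
    have c: "0 \<le> z \<bullet> T z" by (rule T_pos[OF zS])
    \<comment> \<open>The summand 1 keeps the denominator positive when z \<bullet> T z = 0, and
      bounds s * (z \<bullet> T z) below by - (z \<bullet> z).\<close>
    define s where "s = - (z \<bullet> z) / (z \<bullet> T z + 1)"
    have "s < 0" using p c by (simp add: s_def divide_neg_pos)
    moreover have "0 \<le> s * (2 * (z \<bullet> z) + s * (z \<bullet> T z))"
      using quad[of s] by (simp add: algebra_simps power2_eq_square)
    ultimately have "2 * (z \<bullet> z) + s * (z \<bullet> T z) \<le> 0"
      by (simp add: zero_le_mult_iff)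
    moreover have "s * (z \<bullet> T z) \<ge> - (z \<bullet> z)"
      using p c by (simp add: s_def field_simps)
    ultimately show False using p by simp
  qed
  then have "A *v x = m *\<^sub>R x" by (simp add: z_def T_def)
  then show ?thesis using x1 by auto
qed

lemma exists_orthonormal_eigenvectors:
  fixes A :: "complex^'n^'n"
  assumes A: "hermitian A" and "k \<le> CARD('n)"
  shows "\<exists>(u :: nat \<Rightarrow> complex^'n) d. (\<forall>i<k. A *v u i = d i *\<^sub>R u i) \<and>
           (\<forall>i<k. \<forall>j<k. hip (u i) (u j) = (if i = j then 1 else 0))"
  using assms(2)
proof (induction k)
  case (Suc k)
  then obtain u :: "nat \<Rightarrow> complex^'n" and d where
    u: "\<And>i. i < k \<Longrightarrow> A *v u i = d i *\<^sub>R u i"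
      "\<And>i j. i < k \<Longrightarrow> j < k \<Longrightarrow> hip (u i) (u j) = (if i = j then 1 else 0)"
    by (metis Suc_leD)
  obtain x m where x: "norm x = 1" "A *v x = m *\<^sub>R x" "\<And>i. i < k \<Longrightarrow> hip (u i) x = 0"
    using exists_eigenvector_orthogonal[of A k u d] A u(1) Suc.prems by auto
  have "hip x (u i) = 0" if "i < k" for i
    using x(3)[OF that] hip_cnj[of x "u i"] by simp
  then show ?case
    using u x by (intro exI[of _ "u(k := x)"] exI[of _ "d(k := m)"]) (auto simp: less_Suc_eq hip_self)
qed simp

text \<open>The index type carries an order but no arithmetic, so positions in lists mediate: the
  k-th smallest index is sent to the index holding the k-th smallest value.\<close>

lemma exists_sorting_bij:
  fixes t :: "'n::{finite,linorder} \<Rightarrow> real"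
  shows "\<exists>\<sigma> :: 'n \<Rightarrow> 'n. bij \<sigma> \<and> (\<forall>i j. i \<le> j \<longrightarrow> t (\<sigma> i) \<le> t (\<sigma> j))"
proof -
  define xs where "xs = sorted_list_of_set (UNIV :: 'n set)"
  define ys where "ys = sort_key t xs"
  have xs: "sorted xs" "distinct xs" "set xs = UNIV" by (simp_all add: xs_def)
  have ys: "sorted (map t ys)" "distinct ys" "set ys = UNIV" "length ys = length xs"
    using xs by (simp_all add: ys_def)
  define n where "n = length xs"
  have bx: "bij_betw ((!) xs) {..<n} UNIV" and by': "bij_betw ((!) ys) {..<n} UNIV"
    using bij_betw_nth[of xs "{..<n}" UNIV] bij_betw_nth[of ys "{..<n}" UNIV] xs ys by (simp_all add: n_def)
  define p where "p = the_inv_into {..<n} ((!) xs)"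
  have p: "bij_betw p UNIV {..<n}" unfolding p_def by (rule bij_betw_the_inv_into[OF bx])
  have xp: "xs ! p i = i" for i
    unfolding p_def by (rule f_the_inv_into_f_bij_betw[OF bx]) simp
  have pn: "p i < n" for i using p by (auto simp: bij_betw_def)
  have p_mono: "p i \<le> p j" if "i \<le> j" for i j
  proof (rule ccontr)
    assume "\<not> p i \<le> p j"
    then have "p j < p i" by simp
    then have "xs ! p j \<le> xs ! p i" using xs(1) pn[of i] by (simp add: sorted_nth_mono n_def)
    then have "i = j" using that by (simp add: xp)
    then show False using \<open>p j < p i\<close> by simp
  qed
  have "bij (\<lambda>i. ys ! p i)" using bij_betw_trans[OF p by'] by (simp add: comp_def)
  moreover have "t (ys ! p i) \<le> t (ys ! p j)" if "i \<le> j" for i j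
    using sorted_nth_mono[OF ys(1) p_mono[OF that]] pn[of j] pn[of i] ys(4) by (simp add: n_def)
  ultimately show ?thesis by blast
qed

theorem spectral_theorem:
  fixes A :: "complex^('n::{finite,linorder})^('n::{finite,linorder})"
  assumes A: "hermitian A"
  obtains U t where "unitary U" "A = U ** diagm t ** ctranspose U" "\<And>i j. i \<le> j \<Longrightarrow> t $ i \<le> t $ j"
proof -
  obtain u :: "nat \<Rightarrow> (complex, 'n) vec" and d where
    u: "\<And>i. i < CARD('n) \<Longrightarrow> A *v u i = d i *\<^sub>R u i"
      "\<And>i j. i < CARD('n) \<Longrightarrow> j < CARD('n) \<Longrightarrow> hip (u i) (u j) = (if i = j then 1 else 0)"
    using exists_orthonormal_eigenvectors[OF A order_refl] by blast
  obtain f :: "'n \<Rightarrow> nat" where f: "bij_betw f UNIV {0..<CARD('n)}"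
    using ex_bij_betw_finite_nat[of "UNIV :: 'n set"] by auto
  obtain \<sigma> :: "'n \<Rightarrow> 'n" where \<sigma>: "bij \<sigma>" "\<And>i j. i \<le> j \<Longrightarrow> d (f (\<sigma> i)) \<le> d (f (\<sigma> j))"
    using exists_sorting_bij[of "d \<circ> f"] by auto
  define q where "q = f \<circ> \<sigma>"
  have q: "q i < CARD('n)" "q i = q j \<longleftrightarrow> i = j" for i j
    using bij_betw_trans[OF \<sigma>(1) f] unfolding q_def bij_betw_def by (auto simp: inj_on_def)
  define U :: "((complex, 'n) vec, 'n) vec" where "U = (\<chi> i j. u (q j) $ i)"
  define t :: "(real, 'n) vec" where "t = (\<chi> i. d (q i))"
  have "(ctranspose U ** U) $ i $ j = hip (u (q i)) (u (q j))" for i j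
    by (simp add: U_def ctranspose_def matrix_matrix_mult_def hip_def)
  then have U: "unitary U" unfolding unitary_def by (simp add: vec_eq_iff mat_def u(2) q)
  have "A ** U = U ** diagm t"
  proof (simp add: vec_eq_iff, intro allI)
    fix i j
    have "(A ** U) $ i $ j = (A *v u (q j)) $ i"
      by (simp add: U_def matrix_matrix_mult_def matrix_vector_mult_def)
    then show "(A ** U) $ i $ j = (U ** diagm t) $ i $ j"
      by (simp add: mult_diagm_component u(1) q U_def t_def scaleR_conv_of_real[where 'a = complex] mult.commute)
  qed
  then have "A = U ** diagm t ** ctranspose U"
    using unitaryD(2)[OF U] by (metis matrix_mul_assoc matrix_mul_rid)
  moreover have "t $ i \<le> t $ j" if "i \<le> j" for i j
    using \<sigma>(2)[OF that] by (simp add: t_def q_def)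
  ultimately show ?thesis using that U by blast
qed

subsection \<open>Ordered eigenvalues\<close>

lemma det_diagm_shift: "det (mat z - diagm t) = (\<Prod>i\<in>UNIV. z - complex_of_real (t $ i))"
proof -
  have "det (mat z - diagm t) = (\<Prod>i\<in>UNIV. (mat z - diagm t) $ i $ i)"
    by (rule det_diagonal) (simp add: mat_def diagm_def)
  then show ?thesis by (simp add: mat_def diagm_def)
qed

lemma matrix_diff_distrib:
  fixes A B :: "'a::ring_1^'n^'m"
  shows "(A - B) ** C = A ** C - B ** C" "D ** (A - B) = D ** A - D ** B"
  by (simp_all add: vec_eq_iff matrix_matrix_mult_def left_diff_distrib right_diff_distrib sum_subtractf)

lemma mat_conj:
  assumes "unitary U"
  shows "U ** mat z ** ctranspose U = mat z"
proof -
  have "U ** mat z = mat z ** U"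
    by (simp add: vec_eq_iff matrix_matrix_mult_def mat_def if_distrib[of "\<lambda>x. x * _"] if_distrib[of "\<lambda>x. _ * x"] mult.commute cong: if_cong)
  then show ?thesis using unitaryD(2)[OF assms] by (metis matrix_mul_assoc matrix_mul_rid)
qed

lemma det_conj_shift:
  assumes "unitary U"
  shows "det (mat z - U ** B ** ctranspose U) = det (mat z - B)"
proof -
  have "mat z - U ** B ** ctranspose U = U ** (mat z - B) ** ctranspose U"
    by (simp add: matrix_diff_distrib mat_conj[OF assms])
  moreover have "det U * det (ctranspose U) = 1"
    using unitaryD(2)[OF assms] by (metis det_I det_mul)
  ultimately show ?thesis by (simp add: det_mul mult_ac)
qed

text \<open>The polynomial fixes the multiset of its roots, and a multiset has only one sorted
  listing. This is the uniqueness behind the definite description in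
  \<open>ordered_eigenvalues\<close>.\<close>

lemma roots_determine_sorted:
  fixes s t :: "real^'n::{finite,linorder}"
  assumes s: "\<And>i j. i \<le> j \<Longrightarrow> s $ i \<le> s $ j" and t: "\<And>i j. i \<le> j \<Longrightarrow> t $ i \<le> t $ j"
    and eq: "\<And>z. (\<Prod>i\<in>UNIV. z - complex_of_real (s $ i)) = (\<Prod>i\<in>UNIV. z - complex_of_real (t $ i))"
  shows "s = t"
proof -
  let ?p = "\<lambda>s :: (real, 'n) vec. \<Prod>i\<in>UNIV. [:- complex_of_real (s $ i), 1:]"
  have "poly (?p s) z = poly (?p t) z" for z
    using eq[of z] by (simp add: poly_prod)
  then have p: "?p s = ?p t" by (simp add: poly_eq_poly_eq_iff[symmetric] fun_eq_iff)
  have ord: "proots (?p s) = image_mset complex_of_real (image_mset (($) s) (mset_set UNIV))" for s :: "(real, 'n) vec"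
    by (subst proots_prod)
      (auto simp: sum_unfold_sum_mset image_mset.compositionality comp_def sum_mset_singleton_mset)
  have "image_mset complex_of_real (image_mset (($) s) (mset_set UNIV)) = image_mset complex_of_real (image_mset (($) t) (mset_set UNIV))"
    unfolding ord[symmetric] p ..
  then have m: "image_mset (($) s) (mset_set UNIV) = image_mset (($) t) (mset_set UNIV)"
    by (drule_tac arg_cong[where f = "image_mset Re"]) (simp add: image_mset.compositionality comp_def)
  define xs where "xs = sorted_list_of_set (UNIV :: 'n set)"
  have xs: "sorted xs" "set xs = UNIV" "mset xs = mset_set UNIV"
    unfolding xs_def by (simp_all flip: sorted_list_of_mset_set)
  have "sorted (map (($) s) xs)" "sorted (map (($) t) xs)"
    using xs(1) s t by (simp_all add: sorted_map sorted_wrt_mono_rel[of xs "(\<le>)"])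
  moreover have "mset (map (($) s) xs) = mset (map (($) t) xs)"
    using m xs(3) by simp
  ultimately have "map (($) s) xs = map (($) t) xs"
    by (metis properties_for_sort)
  then show ?thesis using xs(2) by (simp add: vec_eq_iff)
qed

lemma ordered_eigenvalues_eq:
  fixes U :: "complex^('n::{finite,linorder})^('n::{finite,linorder})"
  assumes "unitary U" "\<And>i j. i \<le> j \<Longrightarrow> t $ i \<le> t $ j"
  shows "ordered_eigenvalues (U ** diagm t ** ctranspose U) = t"
  unfolding ordered_eigenvalues_def det_conj_shift[OF assms(1)] det_diagm_shift
proof (rule the_equality)
  fix s :: "(real, 'n) vec"
  assume "(\<forall>i j. i \<le> j \<longrightarrow> s $ i \<le> s $ j) \<and>
         (\<forall>z. (\<Prod>i\<in>UNIV. z - complex_of_real (t $ i)) = (\<Prod>i\<in>UNIV. z - complex_of_real (s $ i)))"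
  then show "s = t" by (intro roots_determine_sorted) (use assms(2) in auto)
qed (use assms(2) in auto)

lemma hermitian_eigen_decomp:
  fixes A :: "complex^('n::{finite,linorder})^('n::{finite,linorder})"
  assumes "hermitian A"
  obtains U where "unitary U" "A = U ** diagm (ordered_eigenvalues A) ** ctranspose U"
    "\<And>i j. i \<le> j \<Longrightarrow> ordered_eigenvalues A $ i \<le> ordered_eigenvalues A $ j"
proof -
  obtain U t where U: "unitary U" "A = U ** diagm t ** ctranspose U" "\<And>i j. i \<le> j \<Longrightarrow> t $ i \<le> t $ j"
    using spectral_theorem[OF assms] by blast
  then have "ordered_eigenvalues A = t" using ordered_eigenvalues_eq by blast
  then show ?thesis using that U by blast
qed

lemma ordered_eigenvalues_mono:
  "hermitian A \<Longrightarrow> i \<le> j \<Longrightarrow> ordered_eigenvalues A $ i \<le> ordered_eigenvalues A $ j"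
  using hermitian_eigen_decomp by blast

lemma trace_square_eigenvalues:
  assumes "hermitian A"
  shows "Re (trace (A ** A)) = (\<Sum>i\<in>UNIV. (ordered_eigenvalues A $ i)\<^sup>2)"
proof -
  define t where "t = ordered_eigenvalues A"
  obtain U where U: "unitary U" "A = U ** diagm t ** ctranspose U"
    unfolding t_def using hermitian_eigen_decomp[OF assms] by metis
  have "A ** A = U ** (diagm t ** diagm t ** ctranspose U)"
    unfolding U(2) by (simp add: matrix_mul_assoc[symmetric] unitary_cancel[OF U(1)])
  then have "trace (A ** A) = trace (diagm t ** diagm t)"
    by (simp add: trace_mul_sym[of U] matrix_mul_assoc[symmetric] unitaryD[OF U(1)])
  then show ?thesis
    by (simp add: trace_def diagm_mult_component t_def[symmetric] power2_eq_square) (simp add: diagm_def)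
qed

section \<open>Compactness and measurability of the eigenvalue map\<close>

lemma continuous_on_matrix_mult [continuous_intros]:
  fixes f :: "'a::topological_space \<Rightarrow> complex^'n^'m" and g :: "'a \<Rightarrow> complex^'k^'n"
  assumes "continuous_on S f" "continuous_on S g"
  shows "continuous_on S (\<lambda>x. f x ** g x)"
  unfolding matrix_matrix_mult_def using assms by (intro continuous_intros)

lemma continuous_on_ctranspose [continuous_intros]:
  assumes "continuous_on S f"
  shows "continuous_on S (\<lambda>x. ctranspose (f x))"
  unfolding ctranspose_def using assms by (intro continuous_intros)

lemma continuous_on_diagm [continuous_intros]:
  assumes "continuous_on S f"
  shows "continuous_on S (\<lambda>x. diagm (f x))"
proof -
  have "continuous_on S (\<lambda>x. if i = j then complex_of_real (f x $ i) else 0)" for i j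
    using assms by (cases "i = j") (auto intro!: continuous_intros)
  then show ?thesis unfolding diagm_def by (intro continuous_intros)
qed

lemma compact_unitary: "compact (Collect (unitary :: complex^'n^'n \<Rightarrow> bool))"
proof (rule compact_eq_bounded_closed[THEN iffD2], intro conjI)
  have "norm U \<le> real CARD('n)" if "unitary U" for U :: "complex^'n^'n"
  proof -
    have "norm (U $ i) \<le> 1" for i
    proof -
      have "(U ** ctranspose U) $ i $ i = complex_of_real ((norm (U $ i))\<^sup>2)"
        using hip_self[of "U $ i"] by (simp add: hip_def ctranspose_def matrix_matrix_mult_def mult.commute)
      moreover have "(U ** ctranspose U) $ i $ i = 1"
        using unitaryD(2)[OF that] by (simp add: mat_def)
      ultimately have "(norm (U $ i))\<^sup>2 = 1" by (metis of_real_eq_1_iff)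
      then show ?thesis using norm_ge_zero[of "U $ i"] by (auto simp: power2_eq_1_iff simp del: norm_ge_zero)
    qed
    then have "(\<Sum>i\<in>UNIV. norm (U $ i)) \<le> (\<Sum>i\<in>(UNIV :: 'n set). 1)" by (intro sum_mono)
    also have "\<dots> = real CARD('n)" by simp
    finally have *: "(\<Sum>i\<in>UNIV. norm (U $ i)) \<le> real CARD('n)" .
    show ?thesis using * L2_set_le_sum[of UNIV "\<lambda>i. norm (U $ i)"]
      unfolding norm_vec_def[of U] by (meson norm_ge_zero order_trans)
  qed
  then show "bounded (Collect (unitary :: complex^'n^'n \<Rightarrow> bool))" by (auto simp: bounded_iff)
  show "closed (Collect (unitary :: complex^'n^'n \<Rightarrow> bool))"
    unfolding unitary_def by (intro closed_Collect_eq continuous_intros)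
qed

text \<open>This set is the image of a compact set, unitary matrices times sorted vectors of C,
  under (U, t) -> U ** diagm t ** ctranspose U. It yields measurability without continuity of the
  eigenvalues, and finiteness of the Lebesgue measure of preimages of bounded sets.\<close>

lemma compact_eigenvalue_preimage:
  fixes C :: "(real^'n::{finite,linorder}) set"
  assumes "compact C"
  shows "compact {A. hermitian A \<and> ordered_eigenvalues A \<in> C}"
proof -
  have "closed {t :: (real, 'n) vec. \<forall>i j. i \<le> j \<longrightarrow> t $ i \<le> t $ j}"
    by (intro closed_Collect_all closed_Collect_imp open_Collect_const closed_Collect_le) (auto intro!: continuous_intros)
  then have "compact (C \<inter> {t. \<forall>i j. i \<le> j \<longrightarrow> t $ i \<le> t $ j})"
    using assms by (rule compact_Int_closed[rotated])
  then have "compact ((\<lambda>(U, t). U ** diagm t ** ctranspose U) `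
      (Collect unitary \<times> (C \<inter> {t. \<forall>i j. i \<le> j \<longrightarrow> t $ i \<le> t $ j})))"
    unfolding case_prod_beta by (intro compact_continuous_image compact_Times compact_unitary continuous_intros)
  also have "(\<lambda>(U, t). U ** diagm t ** ctranspose U) ` (Collect unitary \<times> (C \<inter> {t. \<forall>i j. i \<le> j \<longrightarrow> t $ i \<le> t $ j}))
    = {A. hermitian A \<and> ordered_eigenvalues A \<in> C}" (is "?L = ?R")
  proof
    show "?L \<subseteq> ?R" by (auto simp: hermitian_conj ordered_eigenvalues_eq)
    show "?R \<subseteq> ?L"
    proof
      fix A assume A: "A \<in> ?R"
      then have "hermitian A" by simp
      then obtain U where U: "unitary U" "A = U ** diagm (ordered_eigenvalues A) ** ctranspose U"
        by (rule hermitian_eigen_decomp)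
      show "A \<in> ?L"
      proof (rule image_eqI[of _ _ "(U, ordered_eigenvalues A)"])
        show "A = (case (U, ordered_eigenvalues A) of (U, t) \<Rightarrow> U ** diagm t ** ctranspose U)"
          unfolding prod.case by (rule U(2))
        show "(U, ordered_eigenvalues A) \<in> Collect unitary \<times> (C \<inter> {t. \<forall>i j. i \<le> j \<longrightarrow> t $ i \<le> t $ j})"
          using A U(1) ordered_eigenvalues_mono[of A] by auto
      qed
    qed
  qed
  finally show ?thesis .
qed

lemma closed_hermitian: "closed (Collect (hermitian :: complex^'n^'n \<Rightarrow> bool))"
proof -
  have "Collect (hermitian :: complex^'n^'n \<Rightarrow> bool) = {A. ctranspose A = A}"
    by (auto simp: hermitian_iff)
  then show ?thesis by (simp add: closed_Collect_eq continuous_intros)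
qed

text \<open>A closed set is a countable union of compact sets, whose preimages are compact. The
  restriction to Hermitian matrices is essential to the argument: elsewhere a real list of
  eigenvalues may fail to exist and the description is arbitrary.\<close>

lemma ordered_eigenvalues_measurable:
  "(ordered_eigenvalues :: complex^('n::{finite,linorder})^('n::{finite,linorder}) \<Rightarrow> _) \<in> borel_measurable (restrict_space borel (Collect hermitian))"
proof (rule borel_measurableI)
  let ?M = "restrict_space borel (Collect hermitian) :: ((complex, 'n) vec, 'n) vec measure"
  have closed: "ordered_eigenvalues -` C \<inter> Collect hermitian \<in> sets borel" if "closed C" for C :: "(real, 'n) vec set"
  proof -
    have "ordered_eigenvalues -` C \<inter> Collect hermitian
        = (\<Union>n::nat. {A. hermitian A \<and> ordered_eigenvalues A \<in> C \<inter> cball 0 (real n)})"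
      by (auto simp: real_arch_simple)
    also have "\<dots> \<in> sets borel"
      using that by (intro sets.countable_UN'' borel_compact compact_eigenvalue_preimage closed_Int_compact) auto
    finally show ?thesis .
  qed
  fix S :: "(real, 'n) vec set" assume "open S"
  have "ordered_eigenvalues -` S \<inter> Collect hermitian = Collect hermitian - (ordered_eigenvalues -` (- S) \<inter> Collect hermitian)"
    by auto
  also have "\<dots> \<in> sets borel"
    using closed[of "- S"] \<open>open S\<close> borel_closed[OF closed_hermitian] by (intro sets.Diff) auto
  finally show "ordered_eigenvalues -` S \<inter> space ?M \<in> sets ?M"
    unfolding sets_restrict_space space_restrict_space
    by (intro image_eqI[of _ _ "ordered_eigenvalues -` S \<inter> Collect hermitian"]) auto
qed

subsection \<open>Real coordinates on the Hermitian matrices\<close>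

text \<open>The change of variables theorem of the library needs an index type of class \<^class>\<open>wellorder\<close>.
  Any well-order on the pairs of indices will do.\<close>

typedef 'a idx = "UNIV :: ('a \<times> 'a) set"
  by simp

instance idx :: (finite) finite
proof
  have "(UNIV :: 'a idx set) = range Abs_idx"
    by (metis Rep_idx_inverse surjI)
  then show "finite (UNIV :: 'a idx set)" by (metis finite finite_imageI)
qed

definition idx_rank :: "'a::finite idx \<Rightarrow> nat" where
  "idx_rank = (SOME f. inj f)"

lemma inj_idx_rank: "inj (idx_rank :: 'a::finite idx \<Rightarrow> nat)"
  unfolding idx_rank_def using finite_imp_inj_to_nat_seg[OF finite, of "UNIV :: 'a idx set"]
  by (metis (mono_tags) someI_ex)

instantiation idx :: (finite) wellorder
begin

definition less_eq_idx :: "'a idx \<Rightarrow> 'a idx \<Rightarrow> bool" where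
  "less_eq_idx x y \<longleftrightarrow> idx_rank x \<le> idx_rank y"
definition less_idx :: "'a idx \<Rightarrow> 'a idx \<Rightarrow> bool" where
  "less_idx x y \<longleftrightarrow> idx_rank x < idx_rank y"

instance
proof
  fix x y :: "'a idx"
  show "x \<le> y \<Longrightarrow> y \<le> x \<Longrightarrow> x = y"
    using inj_idx_rank by (auto simp: less_eq_idx_def inj_on_def)
next
  fix P and a :: "'a idx"
  assume "\<And>x :: 'a idx. (\<And>y. y < x \<Longrightarrow> P y) \<Longrightarrow> P x"
  then show "P a"
    unfolding less_idx_def by (rule measure_induct_rule)
qed (auto simp: less_eq_idx_def less_idx_def)

end

abbreviation idx :: "'a \<Rightarrow> 'a \<Rightarrow> 'a idx" where
  "idx i j \<equiv> Abs_idx (i, j)"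

lemma idx_inject [simp]: "idx i j = idx k l \<longleftrightarrow> i = k \<and> j = l"
  by (simp add: Abs_idx_inject)

lemma idx_cases: obtains i j where "k = idx i j"
  by (metis Rep_idx_inverse surj_pair)

lemma all_idx: "(\<forall>k. P k) \<longleftrightarrow> (\<forall>i j. P (idx i j))"
  by (metis idx_cases)

lemma prod_idx:
  fixes f :: "'n::finite idx \<Rightarrow> 'b::comm_monoid_mult"
  shows "(\<Prod>k\<in>UNIV. f k) = (\<Prod>i\<in>UNIV. \<Prod>j\<in>UNIV. f (idx i j))"
proof -
  have "bij_betw Abs_idx (UNIV \<times> UNIV) (UNIV :: 'n idx set)"
    by (rule bij_betwI[where g = Rep_idx]) (auto simp: Rep_idx_inverse Abs_idx_inverse)
  then have "(\<Prod>k\<in>UNIV. f k) = (\<Prod>p\<in>UNIV \<times> UNIV. f (Abs_idx p))"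
    by (rule prod.reindex_bij_betw[symmetric])
  then show ?thesis by (simp only: prod.cartesian_product case_prod_unfold prod.collapse)
qed

definition to_mat :: "real^('n idx) \<Rightarrow> real^'n^'n" where
  "to_mat v = (\<chi> i j. v $ idx i j)"

definition hc :: "real^(('n::{finite,linorder}) idx) \<Rightarrow> complex^('n::{finite,linorder})^('n::{finite,linorder})" where
  "hc v = hermitian_of_coords (to_mat v)"

text \<open>Only the diagonal and the upper triangle are read, which gives a linear map on all
  complex matrices that inverts \<open>hc\<close> on the Hermitian ones.\<close>

definition hinv :: "complex^('n::{finite,linorder})^('n::{finite,linorder}) \<Rightarrow> real^(('n::{finite,linorder}) idx)" where
  "hinv A = (\<chi> k. let (i, j) = Rep_idx k in if i \<le> j then Re (A $ i $ j) else Im (A $ j $ i))"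

lemma hinv_idx: "hinv A $ idx i j = (if i \<le> j then Re (A $ i $ j) else Im (A $ j $ i))"
  by (simp add: hinv_def Abs_idx_inverse)

lemma hc_component:
  "hc v $ i $ j = (if i = j then complex_of_real (v $ idx i i)
     else if i < j then Complex (v $ idx i j) (v $ idx j i)
     else Complex (v $ idx j i) (- v $ idx i j))"
  by (simp add: hc_def hermitian_of_coords_def to_mat_def)

lemma hermitian_hc [simp]: "hermitian (hc v)"
  unfolding hermitian_def by (auto simp: hc_component complex_eq_iff)

lemma hinv_hc [simp]: "hinv (hc v) = v"
  unfolding vec_eq_iff all_idx by (auto simp: hinv_idx hc_component)

lemma hc_hinv: "hermitian A \<Longrightarrow> hc (hinv A) = A"
proof -
  assume A: "hermitian A"
  have h: "A $ j $ i = cnj (A $ i $ j)" for i j using A unfolding hermitian_def by metis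
  have c: "Re (A $ j $ i) = Re (A $ i $ j)" "- Im (A $ j $ i) = Im (A $ i $ j)" for i j
    using arg_cong[OF h[of j i], of Re] arg_cong[OF h[of j i], of Im] by (simp_all only: cnj.simps minus_minus)
  have "Im (A $ i $ i) = 0" for i using c(2)[of i i] by simp
  then show "hc (hinv A) = A"
    unfolding vec_eq_iff by (auto simp: hc_component hinv_idx complex_eq_iff intro: c)
qed

lemma linear_hc: "linear hc"
  by (rule linearI) (auto simp: vec_eq_iff hc_component complex_eq_iff)

lemma linear_hinv: "linear hinv"
  by (rule linearI) (auto simp: vec_eq_iff all_idx hinv_idx)

lemma continuous_on_hc [continuous_intros]: "continuous_on S f \<Longrightarrow> continuous_on S (\<lambda>x. hc (f x))"
  using continuous_on_compose2[OF linear_continuous_on[of hc UNIV]] linear_hc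
  by (auto simp: linear_conv_bounded_linear)

text \<open>The real and imaginary parts of an entry sit at the positions (i,j) and (j,i). Symmetry
  of m scales both alike, so an entrywise multiplier is diagonal in the real coordinates.\<close>

lemma hinv_symmetric_multiplier:
  assumes "\<And>i j. m i j = m j i"
  shows "hinv (\<chi> i j. complex_of_real (m i j) * hc v $ i $ j) $ idx i j = m i j * v $ idx i j"
  using assms[of i j] by (auto simp: hinv_idx hc_component)

lemma prod_Basis_vec:
  "(\<Prod>b\<in>(Basis :: ('a::euclidean_space^'n) set). f b) = (\<Prod>i\<in>UNIV. \<Prod>b\<in>Basis. f (axis i b))"
proof -
  have "bij_betw (\<lambda>(i, b). axis i b) (UNIV \<times> Basis) (Basis :: ('a^'n) set)"
    by (auto simp: bij_betw_def inj_on_def Basis_vec_def axis_eq_axis nonzero_Basis)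
  then have "(\<Prod>b\<in>(Basis :: ('a^'n) set). f b) = (\<Prod>p\<in>UNIV \<times> Basis. f (case p of (i, b) \<Rightarrow> axis i b))"
    by (rule prod.reindex_bij_betw[symmetric])
  then show ?thesis by (simp add: prod.cartesian_product case_prod_unfold)
qed

text \<open>Links Lebesgue measure on nested vectors, used to define
  \<open>hermitian_lborel\<close>, with the one on a single index type, where Jacobians are
  determinants of matrices. Boxes correspond to boxes of the same volume.\<close>

lemma lborel_eq_distr_to_mat: "(lborel :: (real^'n^'n) measure) = distr lborel borel to_mat"
proof (rule lborel_eqI)
  have lin: "linear (to_mat :: _ \<Rightarrow> real^'n^'n)"
    by (rule linearI) (auto simp: to_mat_def vec_eq_iff)
  then have [measurable]: "(to_mat :: _ \<Rightarrow> real^'n^'n) \<in> borel_measurable borel"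
    by (intro borel_measurable_continuous_onI linear_continuous_on) (simp add: linear_conv_bounded_linear)
  fix l u :: "real^'n^'n" assume lu: "\<And>b. b \<in> Basis \<Longrightarrow> l \<bullet> b \<le> u \<bullet> b"
  define c where "c w = (\<chi> k. w $ fst (Rep_idx k) $ snd (Rep_idx k))" for w :: "real^'n^'n"
  have c: "c w $ idx i j = w $ i $ j" for w i j by (simp add: c_def Abs_idx_inverse)
  have "axis i (axis j 1) \<in> (Basis :: (real^'n^'n) set)" for i j by (auto simp: Basis_vec_def)
  from lu[OF this] have le: "l $ i $ j \<le> u $ i $ j" for i j by (simp add: inner_axis)
  then have le': "c l $ k \<le> c u $ k" for k by (cases k rule: idx_cases) (simp add: c)
  have "to_mat -` box l u = box (c l) (c u)"
    unfolding set_eq_iff by (simp add: mem_box Basis_vec_def inner_axis all_idx c to_mat_def)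
  then have "emeasure (distr lborel borel to_mat) (box l u) = emeasure lborel (box (c l) (c u))"
    by (simp add: emeasure_distr)
  also have "\<dots> = ennreal (\<Prod>b\<in>Basis. (c u - c l) \<bullet> b)"
    by (rule emeasure_lborel_box) (auto simp: Basis_vec_def inner_axis le')
  also have "(\<Prod>b\<in>Basis. (c u - c l) \<bullet> b) = (\<Prod>b\<in>Basis. (u - l) \<bullet> b)"
    by (simp add: prod_Basis_vec inner_axis prod_idx c)
  finally show "emeasure (distr lborel borel to_mat) (box l u) = ennreal (\<Prod>b\<in>Basis. (u - l) \<bullet> b)" .
qed simp

subsection \<open>Polynomial functional calculus\<close>

primrec rpoly :: "real list \<Rightarrow> real \<Rightarrow> real" where
  "rpoly [] x = 0"
| "rpoly (c # cs) x = c + x * rpoly cs x"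

text \<open>The divided difference (p(x) - p(y)) / (x - y), computed along Horner's scheme: for p =
  c + x q it is q(y) + x q[x,y]. Without a division it makes sense at x = y, where it is
  p'(x).\<close>

primrec divdiff :: "real list \<Rightarrow> real \<Rightarrow> real \<Rightarrow> real" where
  "divdiff [] x y = 0"
| "divdiff (c # cs) x y = rpoly cs y + x * divdiff cs x y"

primrec mpoly :: "real list \<Rightarrow> complex^'n^'n \<Rightarrow> complex^'n^'n" where
  "mpoly [] A = 0"
| "mpoly (c # cs) A = mat (complex_of_real c) + A ** mpoly cs A"

primrec dmpoly :: "real list \<Rightarrow> complex^'n^'n \<Rightarrow> complex^'n^'n \<Rightarrow> complex^'n^'n" where
  "dmpoly [] A X = 0"
| "dmpoly (c # cs) A X = X ** mpoly cs A + A ** dmpoly cs A X"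

lemma divdiff_mult: "(x - y) * divdiff cs x y = rpoly cs x - rpoly cs y"
proof (induction cs)
  case (Cons c cs)
  have "(x - y) * divdiff (c # cs) x y = (x - y) * rpoly cs y + x * ((x - y) * divdiff cs x y)"
    by (simp add: algebra_simps)
  then show ?case unfolding Cons by (simp add: algebra_simps)
qed simp

lemma divdiff_eq: "x \<noteq> y \<Longrightarrow> divdiff cs x y = (rpoly cs x - rpoly cs y) / (x - y)"
  using divdiff_mult[of x y cs] by (simp add: field_simps)

lemma divdiff_sym: "divdiff cs x y = divdiff cs y x"
  by (cases "x = y") (auto simp: divdiff_eq field_simps)

lemma rpoly_has_field_derivative: "(rpoly cs has_field_derivative divdiff cs x x) (at x within S)"
  by (induction cs) (auto intro!: derivative_eq_intros simp: fun_eq_iff)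

lemma continuous_on_rpoly [continuous_intros]: "continuous_on S f \<Longrightarrow> continuous_on S (\<lambda>x. rpoly cs (f x))"
  by (induction cs) (auto intro!: continuous_intros)

lemma continuous_on_divdiff [continuous_intros]:
  "continuous_on S f \<Longrightarrow> continuous_on S g \<Longrightarrow> continuous_on S (\<lambda>x. divdiff cs (f x) (g x))"
  by (induction cs) (auto intro!: continuous_intros)

lemma bounded_bilinear_matrix_mult: "bounded_bilinear ((**) :: complex^'n^'m \<Rightarrow> complex^'k^'n \<Rightarrow> complex^'k^'m)"
proof -
  have "bilinear ((**) :: complex^'n^'m \<Rightarrow> complex^'k^'n \<Rightarrow> complex^'k^'m)"
    unfolding bilinear_def
    by (auto intro!: linearI simp: vec_eq_iff matrix_matrix_mult_def distrib_left distrib_right sum.distrib scaleR_sum_right)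
  then show ?thesis by (simp add: bilinear_conv_bounded_bilinear)
qed

lemma mpoly_has_derivative: "(mpoly cs has_derivative dmpoly cs A) (at A within S)"
proof (induction cs)
  case (Cons c cs)
  have "((\<lambda>A. mat (complex_of_real c) + A ** mpoly cs A) has_derivative (\<lambda>X. 0 + (A ** dmpoly cs A X + X ** mpoly cs A))) (at A within S)"
    by (intro has_derivative_add has_derivative_const bounded_bilinear.FDERIV[OF bounded_bilinear_matrix_mult] has_derivative_ident Cons.IH)
  then show ?case by (simp add: fun_eq_iff add.commute)
qed (simp add: fun_eq_iff)

lemma matrix_add_distrib:
  fixes A B :: "'a::semiring_1^'n^'m"
  shows "(A + B) ** C = A ** C + B ** C" "D ** (A + B) = D ** A + D ** B"
  by (simp_all add: vec_eq_iff matrix_matrix_mult_def distrib_left distrib_right sum.distrib)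

lemma conj_mult:
  assumes "unitary U"
  shows "(U ** A ** ctranspose U) ** (U ** B ** ctranspose U) = U ** (A ** B) ** ctranspose U"
  by (simp add: matrix_mul_assoc[symmetric] unitary_cancel[OF assms])

lemma mpoly_conj:
  assumes "unitary U"
  shows "mpoly cs (U ** A ** ctranspose U) = U ** mpoly cs A ** ctranspose U"
proof (induction cs)
  case (Cons c cs)
  show ?case
    unfolding mpoly.simps Cons conj_mult[OF assms] matrix_add_distrib mat_conj[OF assms] ..
qed simp

lemma dmpoly_conj:
  assumes "unitary U"
  shows "dmpoly cs (U ** A ** ctranspose U) (U ** X ** ctranspose U) = U ** dmpoly cs A X ** ctranspose U"
proof (induction cs)
  case (Cons c cs)
  show ?case
    unfolding dmpoly.simps Cons mpoly_conj[OF assms] conj_mult[OF assms] matrix_add_distrib ..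
qed simp

lemma mpoly_diagm: "mpoly cs (diagm t) = diagm (\<chi> i. rpoly cs (t $ i))"
proof (induction cs)
  case Nil
  show ?case by (simp add: vec_eq_iff diagm_def)
next
  case (Cons c cs)
  show ?case by (simp add: Cons vec_eq_iff diagm_mult_component) (simp add: mat_def diagm_def)
qed

text \<open>The recursions of \<open>dmpoly\<close> and \<open>divdiff\<close> agree entrywise:
  right multiplication by q(A) scales entry (i,j) by q(t_j), and left multiplication by A scales it
  by t_i.\<close>

lemma dmpoly_diagm: "dmpoly cs (diagm t) X $ i $ j = complex_of_real (divdiff cs (t $ i) (t $ j)) * X $ i $ j"
  by (induction cs) (simp_all add: mpoly_diagm mult_diagm_component diagm_mult_component algebra_simps)

section \<open>The functional calculus in real coordinates and its Jacobian\<close>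

definition hpoly :: "real list \<Rightarrow> real^(('n::{finite,linorder}) idx) \<Rightarrow> real^(('n::{finite,linorder}) idx)" where
  "hpoly cs v = hinv (mpoly cs (hc v))"

definition dhpoly :: "real list \<Rightarrow> real^(('n::{finite,linorder}) idx) \<Rightarrow> real^(('n::{finite,linorder}) idx) \<Rightarrow> real^(('n::{finite,linorder}) idx)" where
  "dhpoly cs v w = hinv (dmpoly cs (hc v) (hc w))"

definition eigs :: "real^(('n::{finite,linorder}) idx) \<Rightarrow> real^('n::{finite,linorder})" where
  "eigs v = ordered_eigenvalues (hc v)"

lemma hpoly_has_derivative: "(hpoly cs has_derivative dhpoly cs v) (at v within S)"
proof -
  have hc: "(hc has_derivative hc) (at v within S)"
    using linear_hc linear_conv_bounded_linear bounded_linear_imp_has_derivative by blast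
  have "((\<lambda>v. mpoly cs (hc v)) has_derivative (\<lambda>w. dmpoly cs (hc v) (hc w))) (at v within S)"
    using diff_chain_within[OF hc mpoly_has_derivative] by (simp add: comp_def)
  then show ?thesis
    unfolding hpoly_def[abs_def] dhpoly_def[abs_def]
    using bounded_linear.has_derivative linear_hinv linear_conv_bounded_linear by blast
qed

lemma eigs_mono: "i \<le> j \<Longrightarrow> eigs v $ i \<le> eigs v $ j"
  unfolding eigs_def by (rule ordered_eigenvalues_mono) simp

lemma hc_eigen_decomp:
  obtains U where "unitary U" "hc v = U ** diagm (eigs v) ** ctranspose U"
  unfolding eigs_def using hermitian_eigen_decomp[OF hermitian_hc[of v]] by metis

lemma hc_hpoly:
  assumes "unitary U" "hc v = U ** diagm t ** ctranspose U"
  shows "hc (hpoly cs v) = U ** diagm (\<chi> i. rpoly cs (t $ i)) ** ctranspose U"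
  unfolding hpoly_def assms(2) mpoly_conj[OF assms(1)] mpoly_diagm
  by (simp add: hc_hinv hermitian_conj)

definition conj_coords :: "complex^('n::{finite,linorder})^('n::{finite,linorder}) \<Rightarrow> real^(('n::{finite,linorder}) idx) \<Rightarrow> real^(('n::{finite,linorder}) idx)" where
  "conj_coords U w = hinv (U ** hc w ** ctranspose U)"

lemma linear_conj_coords: "linear (conj_coords U)"
proof -
  have "linear (\<lambda>A. U ** A ** ctranspose U)"
    using bounded_bilinear.bounded_linear_left[OF bounded_bilinear_matrix_mult]
      bounded_bilinear.bounded_linear_right[OF bounded_bilinear_matrix_mult]
      bounded_linear_compose linear_conv_bounded_linear by blast
  then show ?thesis
    unfolding conj_coords_def[abs_def]
    using linear_compose[OF linear_compose[OF linear_hc] linear_hinv] by (simp add: comp_def)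
qed

lemma conj_coords_inverse:
  assumes "unitary U"
  shows "conj_coords U (conj_coords (ctranspose U) w) = w"
proof -
  have "hc (conj_coords (ctranspose U) w) = ctranspose U ** hc w ** U"
    using hermitian_conj[of "hc w" "ctranspose U"] by (simp add: conj_coords_def hc_hinv)
  then show ?thesis
    using unitaryD(2)[OF assms] unfolding conj_coords_def[of U]
    by (simp add: matrix_mul_assoc[symmetric] unitary_cancel[OF assms])
qed

text \<open>Conjugations by U and by its inverse undo each other, so passing to an eigenbasis leaves
  the Jacobian determinant unchanged.\<close>

lemma det_conj_coords:
  assumes "unitary U"
  shows "det (matrix (conj_coords U)) * det (matrix (conj_coords (ctranspose U))) = 1"
proof -
  have "conj_coords U \<circ> conj_coords (ctranspose U) = id"
    by (auto simp: conj_coords_inverse[OF assms])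
  then have "matrix (conj_coords U) ** matrix (conj_coords (ctranspose U)) = mat 1"
    using matrix_compose[OF linear_conj_coords linear_conj_coords, of U "ctranspose U"] matrix_id_mat_1 by metis
  then show ?thesis by (metis det_I det_mul)
qed

text \<open>In an eigenbasis the derivative of the functional calculus multiplies entry $(i,j)$ by the
  divided difference at $(t_i,t_j)$.\<close>

lemma dhpoly_decomp:
  assumes U: "unitary U" "hc v = U ** diagm t ** ctranspose U"
  shows "dhpoly cs v = conj_coords U \<circ> dhpoly cs (hinv (diagm t)) \<circ> conj_coords (ctranspose U)"
proof
  fix w
  define Z where "Z = ctranspose U ** hc w ** U"
  have Z: "hermitian Z" unfolding Z_def using hermitian_conj[of "hc w" "ctranspose U"] by simp
  have w: "hc w = U ** Z ** ctranspose U"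
    unfolding Z_def using unitaryD(2)[OF U(1)] by (simp add: matrix_mul_assoc[symmetric] unitary_cancel[OF U(1)])
  \<comment> \<open>A matrix is recovered from its coordinates only if it is Hermitian; here this
    comes from the symmetry of divided differences.\<close>
  have h: "hermitian (dmpoly cs (diagm t) Z)"
    unfolding hermitian_def
  proof (intro allI)
    fix i j
    have "Z $ j $ i = cnj (Z $ i $ j)" using Z unfolding hermitian_def by metis
    then show "dmpoly cs (diagm t) Z $ j $ i = cnj (dmpoly cs (diagm t) Z $ i $ j)"
      unfolding dmpoly_diagm divdiff_sym[of cs "t $ j" "t $ i"] by simp
  qed
  have "dhpoly cs v w = hinv (U ** dmpoly cs (diagm t) Z ** ctranspose U)"
    unfolding dhpoly_def U(2) w dmpoly_conj[OF U(1)] ..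
  also have "\<dots> = conj_coords U (dhpoly cs (hinv (diagm t)) (hinv Z))"
    by (simp add: conj_coords_def dhpoly_def hc_hinv Z h)
  also have "hinv Z = conj_coords (ctranspose U) w" by (simp add: conj_coords_def Z_def)
  finally show "dhpoly cs v w = (conj_coords U \<circ> dhpoly cs (hinv (diagm t)) \<circ> conj_coords (ctranspose U)) w"
    by simp
qed

lemma dhpoly_diagm: "dhpoly cs (hinv (diagm t)) w $ idx i j = divdiff cs (t $ i) (t $ j) * w $ idx i j"
proof -
  have "dmpoly cs (diagm t) (hc w) = (\<chi> i j. complex_of_real (divdiff cs (t $ i) (t $ j)) * hc w $ i $ j)"
    by (simp add: vec_eq_iff dmpoly_diagm)
  then show ?thesis
    unfolding dhpoly_def hc_hinv[OF hermitian_diagm]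
    by (simp only:) (rule hinv_symmetric_multiplier, rule divdiff_sym)
qed

lemma linear_dhpoly: "linear (dhpoly cs v)"
  using hpoly_has_derivative[of cs v UNIV] has_derivative_linear by blast

text \<open>The derivative is similar to a diagonal map. Each pair i < j owns two real coordinates,
  hence two equal factors, which is the source of the squared Vandermonde. The entries of t may come
  in any order; the null set argument uses an unsorted one.\<close>

lemma det_dhpoly:
  fixes v :: "real^(('n::{finite,linorder}) idx)"
  assumes U: "unitary U" "hc v = U ** diagm t ** ctranspose U"
  shows "det (matrix (dhpoly cs v)) = (\<Prod>i\<in>UNIV. \<Prod>j\<in>UNIV. divdiff cs (t $ i) (t $ j))"
proof -
  let ?D = "dhpoly cs (hinv (diagm t))"
  have "matrix (dhpoly cs v) = matrix (conj_coords U) ** matrix ?D ** matrix (conj_coords (ctranspose U))"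
    unfolding dhpoly_decomp[OF U]
    by (simp add: matrix_compose linear_conj_coords linear_dhpoly linear_compose)
  then have "det (matrix (dhpoly cs v)) = det (matrix ?D)"
    using det_conj_coords[OF U(1)] by (simp add: det_mul mult_ac)
  also have "\<dots> = (\<Prod>k\<in>UNIV. matrix ?D $ k $ k)"
  proof (rule det_diagonal)
    fix k l :: "'n idx" assume "k \<noteq> l"
    then show "matrix ?D $ k $ l = 0"
      by (cases k rule: idx_cases) (auto simp: matrix_def dhpoly_diagm axis_def)
  qed
  finally show ?thesis by (simp add: prod_idx matrix_def dhpoly_diagm axis_def)
qed

lemma eigs_hpoly:
  assumes "mono_on J (rpoly cs)" "\<And>i. eigs v $ i \<in> J"
  shows "eigs (hpoly cs v) = (\<chi> i. rpoly cs (eigs v $ i))"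
proof -
  obtain U where U: "unitary U" "hc v = U ** diagm (eigs v) ** ctranspose U" by (rule hc_eigen_decomp)
  show ?thesis
    unfolding eigs_def[of "hpoly cs v"] hc_hpoly[OF U]
  proof (rule ordered_eigenvalues_eq[OF U(1)])
    fix i j :: 'a assume "i \<le> j"
    then show "(\<chi> i. rpoly cs (eigs v $ i)) $ i \<le> (\<chi> i. rpoly cs (eigs v $ i)) $ j"
      using mono_onD[OF assms(1) assms(2) assms(2) eigs_mono[of i j v]] by simp
  qed
qed

text \<open>Let W be the change between the two eigenbases. It intertwines the diagonal matrices of
  p-values, so W_ij is nonzero only where p(t_j) = p(s_i), with t and s the eigenvalues of v and w.
  Injectivity of p turns this into t_j = s_i, so W intertwines the eigenvalues themselves.\<close>

lemma inj_on_hpoly: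
  assumes "inj_on (rpoly cs) J" and S: "\<And>v i. v \<in> S \<Longrightarrow> eigs v $ i \<in> J"
  shows "inj_on (hpoly cs) S"
proof (rule inj_onI)
  fix v w assume v: "v \<in> S" and w: "w \<in> S" and eq: "hpoly cs v = hpoly cs w"
  obtain U where U: "unitary U" "hc v = U ** diagm (eigs v) ** ctranspose U" by (rule hc_eigen_decomp)
  obtain V where V: "unitary V" "hc w = V ** diagm (eigs w) ** ctranspose V" by (rule hc_eigen_decomp)
  define W where "W = ctranspose V ** U"
  have "U ** diagm (\<chi> i. rpoly cs (eigs v $ i)) ** ctranspose U = V ** diagm (\<chi> i. rpoly cs (eigs w $ i)) ** ctranspose V"
    using eq hc_hpoly[OF U, of cs] hc_hpoly[OF V, of cs] by simp
  then have "ctranspose V ** (U ** diagm (\<chi> i. rpoly cs (eigs v $ i)) ** ctranspose U) ** U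
           = ctranspose V ** (V ** diagm (\<chi> i. rpoly cs (eigs w $ i)) ** ctranspose V) ** U"
    by simp
  then have W: "W ** diagm (\<chi> i. rpoly cs (eigs v $ i)) = diagm (\<chi> i. rpoly cs (eigs w $ i)) ** W"
    using unitaryD(1)[OF U(1)] unfolding W_def
    by (simp add: matrix_mul_assoc[symmetric] unitary_cancel[OF V(1)])
  have "W ** diagm (eigs v) = diagm (eigs w) ** W"
    unfolding vec_eq_iff mult_diagm_component diagm_mult_component
  proof (intro allI)
    fix i j
    have "W $ i $ j * complex_of_real (rpoly cs (eigs v $ j)) = complex_of_real (rpoly cs (eigs w $ i)) * W $ i $ j"
      using arg_cong[OF W, of "\<lambda>A. A $ i $ j"] by (simp add: mult_diagm_component diagm_mult_component)
    then have "W $ i $ j = 0 \<or> rpoly cs (eigs v $ j) = rpoly cs (eigs w $ i)"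
      by (simp add: mult.commute)
    then have "W $ i $ j = 0 \<or> eigs v $ j = eigs w $ i"
      using inj_onD[OF assms(1) _ S[OF v] S[OF w]] by blast
    then show "W $ i $ j * complex_of_real (eigs v $ j) = complex_of_real (eigs w $ i) * W $ i $ j"
      by auto
  qed
  then have "V ** (W ** diagm (eigs v)) ** ctranspose U = V ** (diagm (eigs w) ** W) ** ctranspose U" by simp
  then have "hc v = hc w"
    unfolding W_def U(2) V(2) using unitaryD(2)[OF U(1)]
    by (simp add: matrix_mul_assoc[symmetric] unitary_cancel[OF V(1)])
  then show "v = w" by (metis hinv_hc)
qed

subsection \<open>The change of variables\<close>

text \<open>The product runs over ordered pairs, so this is the square of the Vandermonde determinant.\<close>

definition vdm :: "real^'n \<Rightarrow> real" where
  "vdm t = (\<Prod>i\<in>UNIV. \<Prod>j\<in>UNIV. if i = j then 1 else \<bar>t $ i - t $ j\<bar>)"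

lemma vdm_nonneg: "0 \<le> vdm t"
  by (auto simp: vdm_def intro!: prod_nonneg)

lemma continuous_on_vdm [continuous_intros]:
  "continuous_on S f \<Longrightarrow> continuous_on S (\<lambda>x. vdm (f x))"
proof -
  assume f: "continuous_on S f"
  have "continuous_on S (\<lambda>x. if i = j then 1 else \<bar>f x $ i - f x $ j\<bar>)" for i j
    using f by (cases "i = j") (auto intro!: continuous_intros)
  then show ?thesis unfolding vdm_def by (intro continuous_intros)
qed

lemma measurable_vdm [measurable]: "vdm \<in> borel_measurable borel"
  by (intro borel_measurable_continuous_onI continuous_on_vdm continuous_on_id)

lemma measurable_eigs [measurable]: "eigs \<in> borel_measurable borel"
proof -
  have "hc \<in> measurable borel (restrict_space borel (Collect hermitian))"
    by (rule measurable_restrict_space2)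
      (auto intro!: borel_measurable_continuous_onI continuous_on_hc continuous_on_id)
  from measurable_compose[OF this ordered_eigenvalues_measurable] show ?thesis
    by (simp add: eigs_def[abs_def])
qed

lemma compact_eigs_preimage:
  assumes "compact C"
  shows "compact {v. eigs v \<in> C}"
proof -
  have "compact (hinv ` {A. hermitian A \<and> ordered_eigenvalues A \<in> C})"
    using linear_hinv compact_eigenvalue_preimage[OF assms]
    by (intro compact_continuous_image linear_continuous_on) (auto simp: linear_conv_bounded_linear)
  also have "hinv ` {A. hermitian A \<and> ordered_eigenvalues A \<in> C} = {v. eigs v \<in> C}" (is "?L = ?R")
  proof
    show "?L \<subseteq> ?R" by (auto simp: eigs_def hc_hinv)
    show "?R \<subseteq> ?L"
    proof
      fix v assume "v \<in> ?R"
      then show "v \<in> ?L" by (intro image_eqI[of _ _ "hc v"]) (auto simp: eigs_def)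
    qed
  qed
  finally show ?thesis .
qed

lemma nn_integral_lebesgue_absolutely_integrable:
  fixes f :: "'a::euclidean_space \<Rightarrow> real"
  assumes "f absolutely_integrable_on S" "\<And>x. x \<in> S \<Longrightarrow> 0 \<le> f x"
  shows "(\<integral>\<^sup>+x. indicator S x * ennreal (f x) \<partial>lborel) = ennreal (integral S f)"
proof -
  have "(\<integral>\<^sup>+x. indicator S x * ennreal (f x) \<partial>lborel) = (\<integral>\<^sup>+x. ennreal (indicator S x *\<^sub>R f x) \<partial>lebesgue)"
    unfolding nn_integral_completion by (intro nn_integral_cong) (auto simp: indicator_def)
  also have "\<dots> = ennreal (\<integral>x. indicator S x *\<^sub>R f x \<partial>lebesgue)"
    using assms by (intro nn_integral_eq_integral) (auto simp: set_integrable_def indicator_def)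
  also have "(\<integral>x. indicator S x *\<^sub>R f x \<partial>lebesgue) = integral S f"
    using set_lebesgue_integral_eq_integral(2)[OF assms(1)] by (simp add: set_lebesgue_integral_def)
  finally show ?thesis .
qed

text \<open>The image of Lebesgue measure with the squared Vandermonde divided out. Where
  eigenvalues coincide, 1 / 0 = 0 makes the weight vanish.\<close>

definition rho :: "(real^('n::{finite,linorder})) set \<Rightarrow> ennreal" where
  "rho B = (\<integral>\<^sup>+v. indicator B (eigs v) * ennreal (1 / vdm (eigs v)) \<partial>lborel)"

text \<open>For a polynomial p the Jacobian is the product of p'(t_i) times vdm(p(t)) / vdm(t); in
  the measure \<open>rho\<close> the Vandermonde factors cancel and only the product of p'(t_i)
  survives. There is an inequality because the image of the preimage of B need not fill the preimage
  of B'. The bound K serves integrability.\<close>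

lemma rho_hpoly_le:
  fixes B B' :: "(real^('n::{finite,linorder})) set"
  assumes [measurable]: "B \<in> sets borel" and "bounded B"
    and mono: "strict_mono_on J (rpoly cs)" and BJ: "\<And>t i. t \<in> B \<Longrightarrow> t $ i \<in> J"
    and BB': "\<And>t. t \<in> B \<Longrightarrow> (\<chi> i. rpoly cs (t $ i)) \<in> B'"
    and distinct: "\<And>t i j. t \<in> B \<Longrightarrow> t $ i = t $ j \<Longrightarrow> i = j"
    and pos: "\<And>t i. t \<in> B \<Longrightarrow> 0 \<le> divdiff cs (t $ i) (t $ i)"
    and K: "\<And>t. t \<in> B \<Longrightarrow> (\<Prod>i\<in>UNIV. divdiff cs (t $ i) (t $ i)) / vdm t \<le> K"
  shows "(\<integral>\<^sup>+v. indicator B (eigs v) * ennreal ((\<Prod>i\<in>UNIV. divdiff cs (eigs v $ i) (eigs v $ i)) / vdm (eigs v)) \<partial>lborel)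
    \<le> rho B'"
proof -
  define S where "S = {v. eigs v \<in> B}"
  define w where "w t = (\<Prod>i\<in>UNIV. divdiff cs (t $ i) (t $ i)) / vdm t" for t :: "(real, 'n) vec"
  have [measurable]: "w \<in> borel_measurable borel"
    unfolding w_def by (intro borel_measurable_divide borel_measurable_continuous_onI continuous_intros)
  have S[measurable]: "S \<in> sets borel" unfolding S_def by measurable
  obtain C where C: "compact C" "B \<subseteq> C"
    using \<open>bounded B\<close> compact_closure closure_subset by blast
  have "emeasure lborel S \<le> emeasure lborel {v. eigs v \<in> C}"
    using C compact_eigs_preimage[OF C(1)] by (intro emeasure_mono) (auto simp: S_def intro: borel_compact)
  also have "\<dots> < \<infinity>" by (rule emeasure_compact_finite[OF compact_eigs_preimage[OF C(1)]])
  finally have fin: "emeasure lborel S < \<infinity>" .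
  have w_nonneg: "0 \<le> w t" if "t \<in> B" for t
    using pos[OF that] vdm_nonneg by (auto simp: w_def intro!: divide_nonneg_nonneg prod_nonneg)
  have eigs_p: "eigs (hpoly cs v) = (\<chi> i. rpoly cs (eigs v $ i))" if "v \<in> S" for v
    using that by (intro eigs_hpoly[OF strict_mono_on_imp_mono_on[OF mono]] BJ) (simp add: S_def)
  have jac: "\<bar>det (matrix (dhpoly cs v))\<bar> *\<^sub>R (1 / vdm (eigs (hpoly cs v))) = w (eigs v)" if v: "v \<in> S" for v
  proof -
    let ?t = "eigs v"
    have tB: "?t \<in> B" using v by (simp add: S_def)
    obtain U where U: "unitary U" "hc v = U ** diagm ?t ** ctranspose U" by (rule hc_eigen_decomp)
    \<comment> \<open>Diagonal factors are derivatives, off-diagonal ones are difference quotients.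
      Writing all three factors for every pair lets the double product split into a derivative part
      and a quotient of two \<open>vdm\<close>.\<close>
    have "\<bar>divdiff cs (?t $ i) (?t $ j)\<bar>
       = (if i = j then divdiff cs (?t $ i) (?t $ i) else 1) * (if i = j then 1 else \<bar>rpoly cs (?t $ i) - rpoly cs (?t $ j)\<bar>)
          / (if i = j then 1 else \<bar>?t $ i - ?t $ j\<bar>)" for i j
    proof (cases "i = j")
      case False
      then have "?t $ i \<noteq> ?t $ j" using distinct[OF tB] by blast
      then show ?thesis using False by (simp add: divdiff_eq abs_divide)
    qed (use pos[OF tB] in simp)
    then have "\<bar>det (matrix (dhpoly cs v))\<bar> = (\<Prod>i\<in>UNIV. \<Prod>j\<in>UNIV. if i = j then divdiff cs (?t $ i) (?t $ i) else 1)
         * vdm (\<chi> i. rpoly cs (?t $ i)) / vdm ?t"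
      by (simp add: det_dhpoly[OF U] abs_prod vdm_def prod_dividef prod.distrib cong: if_cong)
    also have "(\<Prod>i\<in>UNIV. \<Prod>j\<in>UNIV. if i = j then divdiff cs (?t $ i) (?t $ i) else 1) = (\<Prod>i\<in>UNIV. divdiff cs (?t $ i) (?t $ i))"
      by (intro prod.cong) (simp_all add: prod.delta)
    finally have "\<bar>det (matrix (dhpoly cs v))\<bar> = w ?t * vdm (eigs (hpoly cs v))"
      by (simp add: w_def eigs_p[OF v])
    moreover have "vdm (eigs (hpoly cs v)) \<noteq> 0"
      unfolding eigs_p[OF v] vdm_def using distinct[OF tB] strict_mono_on_imp_inj_on[OF mono] BJ[OF tB]
      by (auto simp: inj_on_eq_iff)
    ultimately show ?thesis by simp
  qed
  have int: "(\<lambda>v. w (eigs v)) absolutely_integrable_on S"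
    unfolding set_integrable_def
  proof (rule integrable_completion[THEN iffD2])
    show "(\<lambda>x. indicator S x *\<^sub>R w (eigs x)) \<in> borel_measurable lborel" by measurable
    show "integrable lborel (\<lambda>x. indicator S x *\<^sub>R w (eigs x))"
    proof (rule Bochner_Integration.integrable_bound)
      show "integrable lborel (\<lambda>x. indicator S x *\<^sub>R K)"
        using fin by (intro integrable_scaleR_left integrable_real_indicator) auto
      show "AE x in lborel. norm (indicator S x *\<^sub>R w (eigs x)) \<le> norm (indicator S x *\<^sub>R K)"
        using w_nonneg K by (intro AE_I2) (fastforce simp: indicator_def S_def w_def)
    qed measurable
  qed
  have "(\<lambda>v. \<bar>det (matrix (dhpoly cs v))\<bar> *\<^sub>R (1 / vdm (eigs (hpoly cs v)))) absolutely_integrable_on S"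
    using int by (subst set_integrable_cong[OF refl refl jac]) auto
  \<comment> \<open>The change of variables theorem concerns vector-valued integrands, so the scalar
    weight is viewed in dimension one.\<close>
  moreover have cv: "(\<lambda>v. \<bar>det (matrix (dhpoly cs v))\<bar> *\<^sub>R (vec (1 / vdm (eigs (hpoly cs v))) :: real^1)) absolutely_integrable_on S \<and>
      integral S (\<lambda>v. \<bar>det (matrix (dhpoly cs v))\<bar> *\<^sub>R vec (1 / vdm (eigs (hpoly cs v)))) = (vec b :: real^1)
    \<longleftrightarrow> (\<lambda>v. vec (1 / vdm (eigs v)) :: real^1) absolutely_integrable_on hpoly cs ` S \<and>
      integral (hpoly cs ` S) (\<lambda>v. vec (1 / vdm (eigs v))) = (vec b :: real^1)" for b
    by (rule has_absolute_integral_change_of_variables)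
      (use BJ in \<open>auto intro!: hpoly_has_derivative inj_on_hpoly[OF strict_mono_on_imp_inj_on[OF mono]] simp: S_def S[unfolded S_def]\<close>)
  ultimately have cov: "(\<lambda>v. 1 / vdm (eigs v)) absolutely_integrable_on hpoly cs ` S"
    "integral (hpoly cs ` S) (\<lambda>v. 1 / vdm (eigs v)) = integral S (\<lambda>v. \<bar>det (matrix (dhpoly cs v))\<bar> *\<^sub>R (1 / vdm (eigs (hpoly cs v))))"
    using cv[of "integral S (\<lambda>v. \<bar>det (matrix (dhpoly cs v))\<bar> *\<^sub>R (1 / vdm (eigs (hpoly cs v))))"]
    by (simp_all add: absolutely_integrable_on_1_iff integral_on_1_eq)
  have "(\<integral>\<^sup>+v. indicator B (eigs v) * ennreal (w (eigs v)) \<partial>lborel) = (\<integral>\<^sup>+v. indicator S v * ennreal (w (eigs v)) \<partial>lborel)"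
    by (intro nn_integral_cong) (auto simp: S_def indicator_def)
  also have "\<dots> = ennreal (integral S (\<lambda>v. w (eigs v)))"
    by (rule nn_integral_lebesgue_absolutely_integrable[OF int]) (auto simp: S_def w_nonneg)
  also have "integral S (\<lambda>v. w (eigs v)) = integral (hpoly cs ` S) (\<lambda>v. 1 / vdm (eigs v))"
    unfolding cov(2) by (intro integral_cong) (rule jac[symmetric])
  also have "ennreal \<dots> = (\<integral>\<^sup>+v. indicator (hpoly cs ` S) v * ennreal (1 / vdm (eigs v)) \<partial>lborel)"
    by (rule nn_integral_lebesgue_absolutely_integrable[OF cov(1), symmetric]) (simp add: vdm_nonneg)
  also have "\<dots> \<le> rho B'"
    unfolding rho_def using BB' eigs_p
    by (intro nn_integral_mono mult_right_mono) (auto simp: indicator_def S_def)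
  finally show ?thesis by (simp add: w_def)
qed

subsection \<open>Repeated eigenvalues are negligible\<close>

text \<open>A matrix with a repeated eigenvalue is, up to a shift, the square of a matrix with opposite eigenvalues
  $r$ and $-r$, and there the derivative of squaring is singular.\<close>

lemma negligible_repeated_eigenvalue:
  "negligible {v :: real^(('n::{finite,linorder}) idx). \<exists>i j. i \<noteq> j \<and> eigs v $ i = eigs v $ j}"
proof -
  \<comment> \<open>The polynomial x^2 - n, whose divided difference at (x, y) is x + y.\<close>
  define cs where "cs n = [- real n, 0, 1]" for n
  define Z where "Z n = {v :: (real, 'n idx) vec. det (matrix (dhpoly (cs n) v)) = 0}" for n
  have neg: "negligible (hpoly (cs n) ` Z n)" for n
  proof (rule baby_Sard)
    show "(hpoly (cs n) has_derivative dhpoly (cs n) v) (at v within Z n)" for v :: "(real, 'n idx) vec"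
      by (rule hpoly_has_derivative)
    show "rank (matrix (dhpoly (cs n) v)) < CARD('n idx)" if "v \<in> Z n" for v
      using that by (simp add: Z_def det_eq_0_rank)
  qed simp
  have "{v :: (real, 'n idx) vec. \<exists>i j. i \<noteq> j \<and> eigs v $ i = eigs v $ j} \<subseteq> (\<Union>n. hpoly (cs n) ` Z n)"
  proof
    fix v :: "(real, 'n idx) vec"
    assume "v \<in> {v. \<exists>i j. i \<noteq> j \<and> eigs v $ i = eigs v $ j}"
    then obtain a b where ab: "a \<noteq> b" "eigs v $ a = eigs v $ b" by auto
    define t where "t = eigs v"
    obtain U where U: "unitary U" "hc v = U ** diagm t ** ctranspose U"
      unfolding t_def by (rule hc_eigen_decomp)
    obtain n :: nat where n: "(\<Sum>i\<in>UNIV. \<bar>t $ i\<bar>) \<le> real n" using real_arch_simple by blast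
    have tn: "0 \<le> t $ i + real n" for i
    proof -
      have "\<bar>t $ i\<bar> \<le> (\<Sum>i\<in>UNIV. \<bar>t $ i\<bar>)" by (rule member_le_sum) auto
      then show ?thesis using n by linarith
    qed
    \<comment> \<open>A square root of t + n with the sign flipped at b only. As t_a = t_b, this
      gives s_a + s_b = 0, a zero factor of the Jacobian.\<close>
    define s where "s = (\<chi> i. (if i = b then -1 else 1) * sqrt (t $ i + real n))"
    define k where "k = hinv (U ** diagm s ** ctranspose U)"
    have k: "hc k = U ** diagm s ** ctranspose U"
      unfolding k_def by (simp add: hc_hinv hermitian_conj)
    have "rpoly (cs n) (s $ i) = t $ i" for i
      using tn[of i] by (cases "i = b") (simp_all add: cs_def s_def)
    then have "hc (hpoly (cs n) k) = hc v"
      unfolding hc_hpoly[OF U(1) k] U(2) by (simp add: vec_lambda_eta)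
    then have "v = hpoly (cs n) k" by (metis hinv_hc)
    moreover have "divdiff (cs n) (s $ a) (s $ b) = 0"
      using ab by (simp add: cs_def s_def t_def)
    then have "det (matrix (dhpoly (cs n) k)) = 0"
      unfolding det_dhpoly[OF U(1) k] by (metis (mono_tags, lifting) UNIV_I finite prod_zero)
    ultimately show "v \<in> (\<Union>n. hpoly (cs n) ` Z n)" by (auto simp: Z_def)
  qed
  moreover have "negligible (\<Union>n. hpoly (cs n) ` Z n)"
    using neg by (intro negligible_countable_Union) auto
  ultimately show ?thesis by (rule negligible_subset[rotated])
qed

subsection \<open>Interpolation by increasing polynomials\<close>

text \<open>Powers concentrated at the two ends realise the end values at arbitrarily small integral
  cost r, and a parabola vanishing at both ends supplies the remaining integral.\<close>

lemma gap_function: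
  fixes y z \<alpha> \<beta> \<gamma> :: real
  assumes "y < z" "0 < \<alpha>" "0 < \<beta>" "0 < \<gamma>"
  obtains q where "continuous_on UNIV q" "\<And>x. x \<in> {y..z} \<Longrightarrow> 0 < q x" "q y = \<alpha>" "q z = \<beta>"
    "(q has_integral \<gamma>) {y..z}"
proof -
  define L where "L = z - y"
  have L: "0 < L" using assms by (simp add: L_def)
  obtain k :: nat where k: "(\<alpha> + \<beta>) * L / \<gamma> < real k" using reals_Archimedean2 by blast
  have "0 < (\<alpha> + \<beta>) * L / \<gamma>" using assms L by (auto intro!: divide_pos_pos mult_pos_pos)
  then have k0: "0 < real k" using k by linarith
  define r where "r = (\<alpha> + \<beta>) * L / (real k + 1)"
  have "r < \<gamma>" using k assms L k0 unfolding r_def by (simp add: field_simps)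
  \<comment> \<open>The parabola (x - y) * (z - x) has integral L^3 / 6 over {y..z}.\<close>
  define c where "c = (\<gamma> - r) * 6 / L ^ 3"
  have c: "0 < c" using \<open>r < \<gamma>\<close> L by (simp add: c_def)
  define q where "q x = \<alpha> * ((z - x) / L) ^ k + \<beta> * ((x - y) / L) ^ k + c * ((x - y) * (z - x))" for x
  define Q where "Q x = - (\<alpha> * L / (real k + 1)) * ((z - x) / L) ^ (k + 1) + \<beta> * L / (real k + 1) * ((x - y) / L) ^ (k + 1)
     + c * (L * (x - y)\<^sup>2 / 2 - (x - y) ^ 3 / 3)" for x
  have der: "(Q has_real_derivative q x) (at x within S)" for x S
  proof -
    have "((\<lambda>x. ((z - x) / L) ^ (k + 1)) has_real_derivative (real k + 1) * ((z - x) / L) ^ k * (- 1 / L)) (at x within S)"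
    proof -
      have "((\<lambda>x. (z - x) / L) has_real_derivative - 1 / L) (at x within S)"
        using L by (auto intro!: derivative_eq_intros)
      from DERIV_power[OF this, of "k + 1"] show ?thesis by (simp add: mult_ac add.commute)
    qed
    moreover have "((\<lambda>x. ((x - y) / L) ^ (k + 1)) has_real_derivative (real k + 1) * ((x - y) / L) ^ k * (1 / L)) (at x within S)"
    proof -
      have "((\<lambda>x. (x - y) / L) has_real_derivative 1 / L) (at x within S)"
        using L by (auto intro!: derivative_eq_intros)
      from DERIV_power[OF this, of "k + 1"] show ?thesis by (simp add: mult_ac add.commute)
    qed
    moreover have "((\<lambda>x. c * (L * (x - y)\<^sup>2 / 2 - (x - y) ^ 3 / 3)) has_real_derivative c * ((x - y) * (z - x))) (at x within S)"
    proof -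
      have "((\<lambda>x. L * (x - y)\<^sup>2 / 2 - (x - y) ^ 3 / 3) has_real_derivative L * (x - y) - (x - y)\<^sup>2) (at x within S)"
        by (auto intro!: derivative_eq_intros)
      from DERIV_cmult[OF this, of c] show ?thesis by (simp add: L_def power2_eq_square algebra_simps)
    qed
    ultimately have "(Q has_real_derivative
        - (\<alpha> * L / (real k + 1)) * ((real k + 1) * ((z - x) / L) ^ k * (- 1 / L))
        + \<beta> * L / (real k + 1) * ((real k + 1) * ((x - y) / L) ^ k * (1 / L)) + c * ((x - y) * (z - x))) (at x within S)"
      unfolding Q_def by (intro DERIV_add[OF DERIV_add[OF DERIV_cmult DERIV_cmult]])
    also have "- (\<alpha> * L / (real k + 1)) * ((real k + 1) * ((z - x) / L) ^ k * (- 1 / L)) = \<alpha> * ((z - x) / L) ^ k"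
      using L k0 by simp
    also have "\<beta> * L / (real k + 1) * ((real k + 1) * ((x - y) / L) ^ k * (1 / L)) = \<beta> * ((x - y) / L) ^ k"
      using L k0 by simp
    finally show ?thesis by (simp add: q_def)
  qed
  have "(q has_integral Q z - Q y) {y..z}"
    using assms(1) der by (intro fundamental_theorem_of_calculus) (auto simp: has_real_derivative_iff_has_vector_derivative[symmetric])
  also have "Q z - Q y = \<gamma>"
  proof -
    have "Q z = \<beta> * L / (real k + 1) + c * L ^ 3 / 6"
      using L by (simp add: Q_def L_def[symmetric] power2_eq_square power3_eq_cube field_simps)
    moreover have "Q y = - (\<alpha> * L / (real k + 1))" using L by (simp add: Q_def L_def[symmetric])
    moreover have "c * L ^ 3 / 6 = \<gamma> - r" using L by (simp add: c_def)
    moreover have "r = \<alpha> * L / (real k + 1) + \<beta> * L / (real k + 1)"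
      by (simp add: r_def distrib_right add_divide_distrib)
    ultimately show ?thesis by linarith
  qed
  finally have "(q has_integral \<gamma>) {y..z}" .
  moreover have "0 < q x" if x: "x \<in> {y..z}" for x
  proof -
    have nn: "0 \<le> \<alpha> * ((z - x) / L) ^ k" "0 \<le> \<beta> * ((x - y) / L) ^ k" "0 \<le> c * ((x - y) * (z - x))"
      using x assms L c by auto
    consider "x = y" | "x = z" | "y < x" "x < z" using x by fastforce
    then show ?thesis
    proof cases
      case 3
      then have "0 < c * ((x - y) * (z - x))" using c by simp
      then show ?thesis unfolding q_def using nn by linarith
    qed (use assms L k0 in \<open>auto simp: q_def L_def power_0_left\<close>)
  qed
  moreover have "continuous_on UNIV q" unfolding q_def using L by (intro continuous_intros) auto
  moreover have "q y = \<alpha>" "q z = \<beta>" using L k0 by (auto simp: q_def L_def)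
  ultimately show ?thesis using that by blast
qed

text \<open>This g will be the derivative of an increasing map with slope \<alpha> i on the i-th
  interval and rise \<gamma> i over the i-th gap. The last conjunct strengthens the induction: g
  stays constant to the right of the last interval begun, so it can be cut at b m and
  continued.\<close>

lemma interpolating_derivative:
  fixes a b \<alpha> \<gamma> :: "nat \<Rightarrow> real"
  assumes "\<And>i. i < n \<Longrightarrow> a i < b i" "\<And>i. Suc i < n \<Longrightarrow> b i < a (Suc i)"
    and "\<And>i. i < n \<Longrightarrow> 0 < \<alpha> i" "\<And>i. Suc i < n \<Longrightarrow> 0 < \<gamma> i"
  shows "\<exists>g. continuous_on UNIV g \<and> (\<forall>x. 0 < g x) \<and> (\<forall>i<n. \<forall>x\<in>{a i..b i}. g x = \<alpha> i) \<and>
     (\<forall>i. Suc i < n \<longrightarrow> (g has_integral \<gamma> i) {b i..a (Suc i)}) \<and>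
     (\<forall>m x. n = Suc m \<longrightarrow> a m \<le> x \<longrightarrow> g x = \<alpha> m)"
  using assms
proof (induction n)
  case 0
  show ?case by (intro exI[of _ "\<lambda>_. 1"]) auto
next
  case (Suc n)
  show ?case
  proof (cases n)
    case 0
    then show ?thesis using Suc.prems by (intro exI[of _ "\<lambda>_. \<alpha> 0"]) auto
  next
    case (Suc m)
    obtain g where g: "continuous_on UNIV g" "\<And>x. 0 < g x" "\<And>i x. i < n \<Longrightarrow> x \<in> {a i..b i} \<Longrightarrow> g x = \<alpha> i"
      "\<And>i. Suc i < n \<Longrightarrow> (g has_integral \<gamma> i) {b i..a (Suc i)}" "\<And>x. a m \<le> x \<Longrightarrow> g x = \<alpha> m"
    proof -
      have "\<exists>g. continuous_on UNIV g \<and> (\<forall>x. 0 < g x) \<and> (\<forall>i<n. \<forall>x\<in>{a i..b i}. g x = \<alpha> i) \<and>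
         (\<forall>i. Suc i < n \<longrightarrow> (g has_integral \<gamma> i) {b i..a (Suc i)}) \<and>
         (\<forall>m x. n = Suc m \<longrightarrow> a m \<le> x \<longrightarrow> g x = \<alpha> m)"
        by (rule Suc.IH) (use Suc.prems in auto)
      then show ?thesis using that Suc by blast
    qed
    have ab: "a m < b m" "b m < a n" "a n < b n" using Suc.prems(1,2)[of m] Suc.prems(1)[of n] Suc by auto
    obtain q where q: "continuous_on UNIV q" "\<And>x. x \<in> {b m..a n} \<Longrightarrow> 0 < q x" "q (b m) = \<alpha> m" "q (a n) = \<alpha> n"
      "(q has_integral \<gamma> m) {b m..a n}"
      using gap_function[of "b m" "a n" "\<alpha> m" "\<alpha> n" "\<gamma> m"] ab Suc.prems(3)[of m] Suc.prems(3)[of n] Suc.prems(4)[of m] Suc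
      by auto
    \<comment> \<open>The old function up to the end of interval m, then the gap function, then the
      new slope. The values agree at both seams.\<close>
    define h where "h x = (if x \<le> b m then g x else if x \<le> a n then q x else \<alpha> n)" for x
    have cont: "continuous_on UNIV h"
      unfolding h_def
    proof (rule continuous_on_cases_le)
      show "continuous_on {x \<in> UNIV. b m \<le> x} (\<lambda>x. if x \<le> a n then q x else \<alpha> n)"
        using q(4) by (intro continuous_on_cases_le) (auto intro!: continuous_intros continuous_on_subset[OF q(1)])
    qed (use g(1,5) q(3) ab in \<open>auto intro!: continuous_intros continuous_on_subset[OF g(1)]\<close>)
    have a_mono: "b i \<le> a j" if "i < j" "j \<le> n" for i j
      using that
    proof (induction j)
      case (Suc j)
      have "b j \<le> a (Suc j)" "a j \<le> b j" using Suc.prems \<open>\<And>i. Suc i < Suc n \<Longrightarrow> b i < a (Suc i)\<close>[of j]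
          \<open>\<And>i. i < Suc n \<Longrightarrow> a i < b i\<close>[of j] by auto
      then show ?case using Suc by (cases "i = j") auto
    qed simp
    have b_le: "b i \<le> b m" if "i < n" for i
      using a_mono[of i m] ab that Suc by (cases "i = m") auto
    show ?thesis
    proof (intro exI[of _ h] conjI allI impI ballI)
      show "continuous_on UNIV h" by (rule cont)
      show "0 < h x" for x using g(2) q(2)[of x] Suc.prems(3)[of n] by (auto simp: h_def)
      show "h x = \<alpha> i" if "i < Suc n" "x \<in> {a i..b i}" for i x
      proof (cases "i = n")
        case True
        then show ?thesis using that ab q(4) by (auto simp: h_def)
      next
        case False
        then have "i < n" using that by simp
        then show ?thesis using b_le[of i] g(3)[of i x] that by (auto simp: h_def)
      qed
      show "(h has_integral \<gamma> i) {b i..a (Suc i)}" if "Suc i < Suc n" for i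
      proof (cases "i = m")
        case True
        have "h x = q x" if "x \<in> {b m..a n}" for x
          using that g(5)[of x] q(3) ab by (auto simp: h_def)
        then show ?thesis using q(5) True Suc has_integral_cong[of "{b m..a n}" h q] by simp
      next
        case False
        then have i: "Suc i < n" using that Suc by simp
        have "h x = g x" if "x \<in> {b i..a (Suc i)}" for x
          using that b_le[of "Suc i"] i Suc.prems(1)[of "Suc i"] by (auto simp: h_def)
        then show ?thesis using g(4)[OF i] has_integral_cong[of "{b i..a (Suc i)}" h g] by simp
      qed
      show "h x = \<alpha> k" if "Suc n = Suc k" "a k \<le> x" for k x
        using that ab q(4) by (auto simp: h_def)
    qed
  qed
qed

lemma rpoly_map_upt: "rpoly (map b [0..<n]) x = (\<Sum>i<n. b i * x ^ i)"
proof (induction n arbitrary: b)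
  case (Suc n)
  have "rpoly (map b [0..<Suc n]) x = b 0 + x * rpoly (map (\<lambda>i. b (Suc i)) [0..<n]) x"
    by (simp add: upt_conv_Cons map_Suc_upt[symmetric] comp_def del: upt_Suc)
  then show ?case unfolding Suc by (simp add: sum.lessThan_Suc_shift sum_distrib_left mult_ac del: sum.lessThan_Suc)
qed simp

text \<open>Weierstrass approximation is applied to the derivative and integrated term by term, so
  that the polynomial and its derivative are controlled together.\<close>

lemma exists_rpoly_derivative:
  fixes g :: "real \<Rightarrow> real"
  assumes "continuous_on {A..B} g" "0 < \<epsilon>"
  obtains cs where "rpoly cs A = c" "\<And>x. x \<in> {A..B} \<Longrightarrow> \<bar>divdiff cs x x - g x\<bar> < \<epsilon>"
proof -
  obtain p where p: "real_polynomial_function p" "\<And>x. x \<in> {A..B} \<Longrightarrow> \<bar>g x - p x\<bar> < \<epsilon>"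
    using Stone_Weierstrass_real_polynomial_function[of "{A..B}" g \<epsilon>] assms by auto
  then obtain a n where a: "p = (\<lambda>x. \<Sum>i\<le>n. a i * x ^ i)"
    by (auto simp: real_polynomial_function_iff_sum)
  define s where "s = (\<Sum>i\<le>n. a i / real (Suc i) * A ^ Suc i)"
  \<comment> \<open>Coefficients of the antiderivative; the constant term is fixed by the value c at
    A.\<close>
  define b where "b i = (case i of 0 \<Rightarrow> c - s | Suc j \<Rightarrow> a j / real (Suc j))" for i
  define cs where "cs = map b [0..<Suc (Suc n)]"
  have r: "rpoly cs x = c - s + (\<Sum>i\<le>n. a i / real (Suc i) * x ^ Suc i)" for x
    unfolding cs_def rpoly_map_upt
    by (subst sum.lessThan_Suc_shift) (simp add: b_def lessThan_Suc_atMost)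
  have "((\<lambda>x. a i / real (Suc i) * x ^ Suc i) has_real_derivative a i * x ^ i) (at x)" for i x
    by (rule DERIV_cong[OF DERIV_cmult[OF DERIV_pow]]) simp
  then have "(rpoly cs has_real_derivative 0 + (\<Sum>i\<le>n. a i * x ^ i)) (at x)" for x
    unfolding r[abs_def] by (intro DERIV_add DERIV_const DERIV_sum)
  then have "divdiff cs x x = p x" for x
    unfolding a using DERIV_unique[OF rpoly_has_field_derivative] by simp
  then show ?thesis using p(2) by (intro that[of cs]) (auto simp: r s_def abs_minus_commute)
qed

text \<open>The model is the increasing map with derivative g that carries each {a i..b i} affinely
  onto {a' i..b' i} and each gap onto the corresponding gap. A polynomial with nearly this
  derivative, starting at the same value, stays close to it.\<close>

lemma interpolating_polynomial:
  fixes a b a' b' :: "nat \<Rightarrow> real"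
  assumes ab: "\<And>i. i < n \<Longrightarrow> a i < b i" "\<And>i. Suc i < n \<Longrightarrow> b i < a (Suc i)"
    and ab': "\<And>i. i < n \<Longrightarrow> a' i < b' i" "\<And>i. Suc i < n \<Longrightarrow> b' i < a' (Suc i)"
    and "0 < n" "0 < \<epsilon>"
  obtains cs where "strict_mono_on {a 0..b (n - 1)} (rpoly cs)"
    "\<And>i x. i < n \<Longrightarrow> x \<in> {a i..b i} \<Longrightarrow> \<bar>divdiff cs x x - (b' i - a' i) / (b i - a i)\<bar> < \<epsilon>"
    "\<And>i x. i < n \<Longrightarrow> x \<in> {a i..b i} \<Longrightarrow> a' i - \<epsilon> < rpoly cs x \<and> rpoly cs x < b' i + \<epsilon>"
proof -
  define A B where "A = a 0" and "B = b (n - 1)"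
  define \<alpha> where "\<alpha> i = (b' i - a' i) / (b i - a i)" for i
  have \<alpha>: "0 < \<alpha> i" if "i < n" for i using ab(1)[OF that] ab'(1)[OF that] by (simp add: \<alpha>_def)
  obtain g where g: "continuous_on UNIV g" "\<And>x. 0 < g x" "\<And>i x. i < n \<Longrightarrow> x \<in> {a i..b i} \<Longrightarrow> g x = \<alpha> i"
      "\<And>i. Suc i < n \<Longrightarrow> (g has_integral (a' (Suc i) - b' i)) {b i..a (Suc i)}"
    using interpolating_derivative[of n a b \<alpha> "\<lambda>i. a' (Suc i) - b' i"] ab ab' \<alpha> by auto
  have AB_i: "A \<le> a i \<and> b i \<le> B" if "i < n" for i
  proof
    show "A \<le> a i" using that
    proof (induction i)
      case (Suc i)
      then show ?case using ab(1)[of i] ab(2)[of i] by simp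
    qed (simp add: A_def)
    have "b i \<le> b (i + k)" if "i + k < n" for k using that
    proof (induction k)
      case (Suc k)
      then show ?case using ab(1)[of "Suc (i + k)"] ab(2)[of "i + k"] by simp
    qed simp
    from this[of "n - 1 - i"] show "b i \<le> B" using that by (simp add: B_def)
  qed
  have AB: "A < B" using AB_i[of 0] ab(1)[of 0] \<open>0 < n\<close> by simp
  obtain x0 where x0: "x0 \<in> {A..B}" "\<And>x. x \<in> {A..B} \<Longrightarrow> g x0 \<le> g x"
    using continuous_attains_inf[of "{A..B}" g] continuous_on_subset[OF g(1)] AB by auto
  \<comment> \<open>The three bounds keep the derivative positive, the slopes within \<epsilon>, and
    the error accumulated over {A..B} below \<epsilon>.\<close>
  define \<delta> where "\<delta> = min (g x0) (min \<epsilon> (\<epsilon> / (2 * (B - A))))"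
  have \<delta>: "0 < \<delta>" "\<delta> \<le> g x0" "\<delta> \<le> \<epsilon>" "\<delta> \<le> \<epsilon> / (2 * (B - A))"
    using \<open>0 < \<epsilon>\<close> AB g(2) by (auto simp: \<delta>_def)
  have "\<delta> * (B - A) \<le> \<epsilon> / 2" using \<delta>(4) AB by (simp add: field_simps)
  then have \<delta>AB: "\<delta> * (B - A) < \<epsilon>" using \<open>0 < \<epsilon>\<close> by linarith
  obtain cs where cs: "rpoly cs A = a' 0" "\<And>x. x \<in> {A..B} \<Longrightarrow> \<bar>divdiff cs x x - g x\<bar> < \<delta>"
    using exists_rpoly_derivative[of A B g \<delta> "a' 0"] continuous_on_subset[OF g(1)] \<delta>(1) by auto
  have g_int: "g integrable_on {x..y}" for x y
    by (rule integrable_continuous_real[OF continuous_on_subset[OF g(1)]]) simp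
  have aint: "integral {A..a i} g = a' i - a' 0" if "i < n" for i
    using that
  proof (induction i)
    case 0
    then show ?case by (simp add: A_def)
  next
    case (Suc i)
    have "(g has_integral \<alpha> i * (b i - a i)) {a i..b i}"
    proof -
      have "((\<lambda>_. \<alpha> i) has_integral \<alpha> i * (b i - a i)) {a i..b i}"
        using has_integral_const_real[of "\<alpha> i" "a i" "b i"] ab(1)[of i] Suc.prems by (simp add: mult.commute)
      then show ?thesis using g(3)[of i] Suc.prems has_integral_cong[of "{a i..b i}" g "\<lambda>_. \<alpha> i"] by simp
    qed
    then have "integral {a i..b i} g = b' i - a' i"
      using ab(1)[of i] Suc.prems by (simp add: integral_unique \<alpha>_def)
    moreover have "integral {b i..a (Suc i)} g = a' (Suc i) - b' i"
      using g(4)[OF Suc.prems] by (rule integral_unique)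
    moreover have "integral {A..a i} g + integral {a i..b i} g = integral {A..b i} g"
      using AB_i[of i] ab(1)[of i] Suc.prems by (intro Henstock_Kurzweil_Integration.integral_combine g_int) auto
    moreover have "integral {A..b i} g + integral {b i..a (Suc i)} g = integral {A..a (Suc i)} g"
      using AB_i[of i] ab[of i] Suc.prems by (intro Henstock_Kurzweil_Integration.integral_combine g_int) auto
    ultimately show ?case using Suc by simp
  qed
  have rp: "\<bar>rpoly cs x - (a' i + \<alpha> i * (x - a i))\<bar> < \<epsilon>" if i: "i < n" and x: "x \<in> {a i..b i}" for i x
  proof -
    have xAB: "A \<le> x" "x \<le> B" using AB_i[OF i] x by auto
    have "((\<lambda>x. divdiff cs x x) has_integral rpoly cs x - rpoly cs A) {A..x}"
      using xAB rpoly_has_field_derivative by (intro fundamental_theorem_of_calculus)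
        (auto simp: has_real_derivative_iff_has_vector_derivative[symmetric])
    moreover have "(g has_integral integral {A..x} g) {A..x}" using g_int by (rule integrable_integral)
    ultimately have "((\<lambda>x. divdiff cs x x - g x) has_integral rpoly cs x - rpoly cs A - integral {A..x} g) {A..x}"
      by (rule has_integral_diff)
    then have "\<bar>rpoly cs x - rpoly cs A - integral {A..x} g\<bar> \<le> \<delta> * (x - A)"
      using has_integral_bound_real[of \<delta> "{}" "\<lambda>x. divdiff cs x x - g x" _ A x] \<delta>(1) cs(2) xAB
      by (force intro: less_imp_le)
    also have "\<dots> \<le> \<delta> * (B - A)" using xAB \<delta>(1) by (intro mult_left_mono) auto
    also have "\<dots> < \<epsilon>" by (rule \<delta>AB)
    finally have "\<bar>rpoly cs x - a' 0 - integral {A..x} g\<bar> < \<epsilon>" by (simp add: cs(1))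
    moreover have "integral {A..a i} g + integral {a i..x} g = integral {A..x} g"
      using AB_i[OF i] x by (intro Henstock_Kurzweil_Integration.integral_combine g_int) auto
    moreover have "integral {a i..x} g = \<alpha> i * (x - a i)"
    proof -
      have "integral {a i..x} g = integral {a i..x} (\<lambda>_. \<alpha> i)"
        using g(3)[OF i] x by (intro integral_cong) auto
      then show ?thesis using x by simp
    qed
    ultimately show ?thesis using aint[OF i] by (simp add: algebra_simps)
  qed
  show ?thesis
  proof
    have pos: "0 < divdiff cs x x" if "x \<in> {A..B}" for x
      using cs(2)[OF that] x0(2)[OF that] \<delta>(2) by linarith
    show "strict_mono_on {a 0..b (n - 1)} (rpoly cs)"
    proof (rule strict_mono_onI)
      fix x y assume xy: "x \<in> {a 0..b (n - 1)}" "y \<in> {a 0..b (n - 1)}" "x < y"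
      show "rpoly cs x < rpoly cs y"
      proof (rule DERIV_pos_imp_increasing[OF xy(3)])
        fix z assume "x \<le> z" "z \<le> y"
        then have "z \<in> {A..B}" using xy by (auto simp: A_def B_def)
        then show "\<exists>D. (rpoly cs has_real_derivative D) (at z) \<and> 0 < D"
          using pos rpoly_has_field_derivative by blast
      qed
    qed
    show "\<bar>divdiff cs x x - (b' i - a' i) / (b i - a i)\<bar> < \<epsilon>" if "i < n" "x \<in> {a i..b i}" for i x
      using cs(2)[of x] g(3)[OF that] AB_i[OF that(1)] that(2) \<delta>(3) unfolding \<alpha>_def[symmetric] by auto
    show "a' i - \<epsilon> < rpoly cs x \<and> rpoly cs x < b' i + \<epsilon>" if "i < n" "x \<in> {a i..b i}" for i x
    proof -
      have "0 \<le> \<alpha> i * (x - a i)" using \<alpha>[OF that(1)] that(2) by simp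
      moreover have "\<alpha> i * (x - a i) \<le> \<alpha> i * (b i - a i)"
        using \<alpha>[OF that(1)] that(2) by (intro mult_left_mono) auto
      moreover have "\<alpha> i * (b i - a i) = b' i - a' i" using ab(1)[OF that(1)] by (simp add: \<alpha>_def)
      ultimately show ?thesis using rp[OF that] by linarith
    qed
  qed
qed

subsection \<open>The eigenvalue density\<close>

text \<open>For a nonempty closed box this says that it lies in the open chamber; by compactness
  \<open>vdm\<close> is then bounded away from 0 on it.\<close>

definition separated :: "real^('n::{finite,linorder}) \<Rightarrow> real^('n::{finite,linorder}) \<Rightarrow> bool" where
  "separated a b \<longleftrightarrow> (\<forall>i j. i < j \<longrightarrow> b $ i < a $ j)"

lemma separated_less:
  assumes "separated a b" "t \<in> cbox a b" "i < j"
  shows "t $ i < t $ j"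
  using assms unfolding separated_def mem_box_cart by (meson le_less_trans less_le_trans)

lemma separated_distinct:
  assumes "separated a b" "t \<in> cbox a b" "t $ i = t $ j"
  shows "i = j"
  using separated_less[OF assms(1,2), of i j] separated_less[OF assms(1,2), of j i] assms(3)
  by (metis less_irrefl neqE)

lemma vdm_pos: "(\<And>i j. t $ i = t $ j \<Longrightarrow> i = j) \<Longrightarrow> 0 < vdm t"
  unfolding vdm_def by (intro prod_pos ballI) auto

lemma weight_bounded_on_separated_box:
  fixes f :: "real^('n::{finite,linorder}) \<Rightarrow> real"
  assumes "separated a b" "continuous_on UNIV f"
  obtains K where "\<And>t. t \<in> cbox a b \<Longrightarrow> f t / vdm t \<le> K"
proof -
  have "vdm t \<noteq> 0" if "t \<in> cbox a b" for t
    using vdm_pos[of t] separated_distinct[OF assms(1) that] by fastforce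
  then have "continuous_on (cbox a b) (\<lambda>t. f t / vdm t)"
    by (intro continuous_intros continuous_on_subset[OF assms(2)]) auto
  then have "bounded ((\<lambda>t. f t / vdm t) ` cbox a b)"
    by (intro compact_imp_bounded compact_continuous_image compact_cbox)
  then obtain K where "\<And>t. t \<in> cbox a b \<Longrightarrow> norm (f t / vdm t) \<le> K"
    by (auto simp: bounded_iff)
  then have "f t / vdm t \<le> K" if "t \<in> cbox a b" for t
    using that abs_le_D1 unfolding real_norm_def by blast
  then show ?thesis by (rule that)
qed

lemma rho_box_finite:
  assumes "separated a b"
  shows "rho (box a b) < \<infinity>"
proof -
  obtain K where K: "\<And>t. t \<in> cbox a b \<Longrightarrow> 1 / vdm t \<le> K"
    using weight_bounded_on_separated_box[OF assms, of "\<lambda>_. 1"] by auto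
  have "rho (box a b) \<le> (\<integral>\<^sup>+v. ennreal K * indicator {v. eigs v \<in> cbox a b} v \<partial>lborel)"
    unfolding rho_def
    by (intro nn_integral_mono) (use box_subset_cbox K in \<open>auto simp: indicator_def intro!: ennreal_leI\<close>)
  also have "\<dots> = ennreal K * emeasure lborel {v. eigs v \<in> cbox a b}"
    by (rule nn_integral_cmult_indicator) (simp add: borel_compact compact_eigs_preimage)
  also have "\<dots> < \<infinity>"
    using emeasure_compact_finite[OF compact_eigs_preimage[OF compact_cbox[of a b]]] by (simp add: ennreal_mult_less_top)
  finally show ?thesis .
qed

lemma exists_increasing_enumeration:
  obtains e :: "nat \<Rightarrow> 'n::{finite,linorder}" where
    "\<And>i. \<exists>k<CARD('n). e k = i" "\<And>k l. k < l \<Longrightarrow> l < CARD('n) \<Longrightarrow> e k < e l"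
proof -
  define xs where "xs = sorted_list_of_set (UNIV :: 'n set)"
  have xs: "sorted_wrt (<) xs" "set xs = UNIV" "length xs = CARD('n)"
    by (simp_all add: xs_def)
  show ?thesis
  proof
    show "\<exists>k<CARD('n). xs ! k = i" for i using xs(2,3) by (metis UNIV_I in_set_conv_nth)
    show "xs ! k < xs ! l" if "k < l" "l < CARD('n)" for k l
      using sorted_wrt_nth_less[OF xs(1)] that xs(3) by simp
  qed
qed

lemma exists_box_polynomial:
  fixes a b a' b' :: "real^('n::{finite,linorder})"
  assumes ab: "\<And>i. a $ i < b $ i" "separated a b" and ab': "\<And>i. a' $ i < b' $ i" "separated a' b'" and "0 < \<epsilon>"
  obtains J cs where "strict_mono_on J (rpoly cs)" "\<And>i. {a $ i..b $ i} \<subseteq> J"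
    "\<And>i x. x \<in> {a $ i..b $ i} \<Longrightarrow> \<bar>divdiff cs x x - (b' $ i - a' $ i) / (b $ i - a $ i)\<bar> < \<epsilon>"
    "\<And>i x. x \<in> {a $ i..b $ i} \<Longrightarrow> a' $ i - \<epsilon> < rpoly cs x \<and> rpoly cs x < b' $ i + \<epsilon>"
proof -
  obtain e :: "nat \<Rightarrow> 'n" where e: "\<And>i. \<exists>k<CARD('n). e k = i" "\<And>k l. k < l \<Longrightarrow> l < CARD('n) \<Longrightarrow> e k < e l"
    by (rule exists_increasing_enumeration) blast
  let ?N = "CARD('n)"
  have step: "b $ e i < a $ e (Suc i)" "b' $ e i < a' $ e (Suc i)" if "Suc i < ?N" for i
    using ab(2) ab'(2) e(2)[OF lessI that] by (auto simp: separated_def)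
  obtain cs where cs: "strict_mono_on {a $ e 0..b $ e (?N - 1)} (rpoly cs)"
    "\<And>i x. i < ?N \<Longrightarrow> x \<in> {a $ e i..b $ e i} \<Longrightarrow> \<bar>divdiff cs x x - (b' $ e i - a' $ e i) / (b $ e i - a $ e i)\<bar> < \<epsilon>"
    "\<And>i x. i < ?N \<Longrightarrow> x \<in> {a $ e i..b $ e i} \<Longrightarrow> a' $ e i - \<epsilon> < rpoly cs x \<and> rpoly cs x < b' $ e i + \<epsilon>"
    using interpolating_polynomial[of ?N "\<lambda>i. a $ e i" "\<lambda>i. b $ e i" "\<lambda>i. a' $ e i" "\<lambda>i. b' $ e i" \<epsilon>,
        OF ab(1) step(1) ab'(1) step(2) zero_less_card_finite \<open>0 < \<epsilon>\<close>] by blast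
  have "{a $ i..b $ i} \<subseteq> {a $ e 0..b $ e (?N - 1)}" for i
  proof -
    obtain k where k: "k < ?N" "e k = i" using e(1) by blast
    have "a $ e 0 \<le> a $ i"
    proof (cases "k = 0")
      case False
      then have "b $ e 0 < a $ i" using e(2)[of 0 k] k ab(2) by (auto simp: separated_def)
      then show ?thesis using ab(1)[of "e 0"] by simp
    qed (use k in simp)
    moreover have "b $ i \<le> b $ e (?N - 1)"
    proof (cases "k = ?N - 1")
      case False
      then have "b $ i < a $ e (?N - 1)" using e(2)[of k "?N - 1"] k ab(2) by (auto simp: separated_def)
      then show ?thesis using ab(1)[of "e (?N - 1)"] by simp
    qed (use k in simp)
    ultimately show ?thesis by auto
  qed
  then show ?thesis using that[OF cs(1)] cs(2,3) e(1) by metis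
qed

text \<open>An increasing polynomial nearly realises the coordinatewise affine map between the
  boxes, whose Jacobian on the chamber is the ratio of the volumes. The error is removed by a
  limit.\<close>

lemma rho_box_le:
  fixes a b a' b' :: "real^('n::{finite,linorder})"
  assumes ab: "\<And>i. a $ i < b $ i" "separated a b" and ab': "\<And>i. a' $ i < b' $ i" "separated a' b'"
  shows "rho (box a b) * ennreal (\<Prod>i\<in>UNIV. (b' $ i - a' $ i) / (b $ i - a $ i)) \<le> rho (box a' b')"
proof -
  \<comment> \<open>Slope of the affine map onto the target interval shrunk by \<eta> at each end,
    less the permitted error \<eta> of the derivative. The shrinking absorbs the error in the
    values, so images stay inside box a' b'.\<close>
  define L where "L \<eta> i = (b' $ i - a' $ i - 2 * \<eta>) / (b $ i - a $ i) - \<eta>" for \<eta> i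
  have le: "rho (box a b) * ennreal (\<Prod>i\<in>UNIV. L \<eta> i) \<le> rho (box a' b')"
    if \<eta>: "0 < \<eta>" "\<And>i. 2 * \<eta> < b' $ i - a' $ i" "\<And>i. 0 < L \<eta> i" for \<eta>
  proof -
    define a'' b'' where "a'' = (\<chi> i. a' $ i + \<eta>)" and "b'' = (\<chi> i. b' $ i - \<eta>)"
    have n1: "a'' $ i < b'' $ i" for i using \<eta>(2)[of i] by (simp add: a''_def b''_def)
    have n2: "separated a'' b''"
      using ab'(2) \<eta>(1) unfolding separated_def a''_def b''_def by (fastforce intro: less_trans)
    obtain J cs where cs: "strict_mono_on J (rpoly cs)" "\<And>i. {a $ i..b $ i} \<subseteq> J"
      "\<And>i x. x \<in> {a $ i..b $ i} \<Longrightarrow> \<bar>divdiff cs x x - (b'' $ i - a'' $ i) / (b $ i - a $ i)\<bar> < \<eta>"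
      "\<And>i x. x \<in> {a $ i..b $ i} \<Longrightarrow> a'' $ i - \<eta> < rpoly cs x \<and> rpoly cs x < b'' $ i + \<eta>"
      by (rule exists_box_polynomial[OF ab n1 n2 \<eta>(1)]) (rule that)
    have dd: "L \<eta> i \<le> divdiff cs (t $ i) (t $ i)" if "t \<in> cbox a b" for t i
      using cs(3)[of "t $ i" i] that by (simp add: L_def a''_def b''_def mem_box_cart abs_less_iff)
    have sub: "t \<in> cbox a b" if "t \<in> box a b" for t using that box_subset_cbox by blast
    obtain K where K: "\<And>t. t \<in> cbox a b \<Longrightarrow> (\<Prod>i\<in>UNIV. divdiff cs (t $ i) (t $ i)) / vdm t \<le> K"
      by (rule weight_bounded_on_separated_box[OF ab(2), of "\<lambda>t. \<Prod>i\<in>UNIV. divdiff cs (t $ i) (t $ i)"])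
        (auto intro!: continuous_intros)
    have "rho (box a b) * ennreal (\<Prod>i\<in>UNIV. L \<eta> i)
      = (\<integral>\<^sup>+v. indicator (box a b) (eigs v) * ennreal (1 / vdm (eigs v)) * ennreal (\<Prod>i\<in>UNIV. L \<eta> i) \<partial>lborel)"
      unfolding rho_def by (intro nn_integral_multc[symmetric]) measurable
    also have "\<dots> \<le> (\<integral>\<^sup>+v. indicator (box a b) (eigs v) * ennreal ((\<Prod>i\<in>UNIV. divdiff cs (eigs v $ i) (eigs v $ i)) / vdm (eigs v)) \<partial>lborel)"
    proof (intro nn_integral_mono)
      fix v
      have "1 / vdm (eigs v) * (\<Prod>i\<in>UNIV. L \<eta> i) \<le> (\<Prod>i\<in>UNIV. divdiff cs (eigs v $ i) (eigs v $ i)) / vdm (eigs v)"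
        if "eigs v \<in> box a b"
      proof -
        have "(\<Prod>i\<in>UNIV. L \<eta> i) \<le> (\<Prod>i\<in>UNIV. divdiff cs (eigs v $ i) (eigs v $ i))"
          using dd[OF sub[OF that]] \<eta>(3) by (intro prod_mono) (auto intro: less_imp_le)
        from divide_right_mono[OF this vdm_nonneg] show ?thesis by simp
      qed
      then show "indicator (box a b) (eigs v) * ennreal (1 / vdm (eigs v)) * ennreal (\<Prod>i\<in>UNIV. L \<eta> i)
        \<le> indicator (box a b) (eigs v) * ennreal ((\<Prod>i\<in>UNIV. divdiff cs (eigs v $ i) (eigs v $ i)) / vdm (eigs v))"
        using vdm_nonneg[of "eigs v"] by (auto simp: indicator_def ennreal_mult'[symmetric] intro!: ennreal_leI)
    qed
    also have "\<dots> \<le> rho (box a' b')"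
    proof (rule rho_hpoly_le[OF _ _ cs(1)])
      show "t $ i \<in> J" if "t \<in> box a b" for t i
        using sub[OF that] cs(2)[of i] by (auto simp: mem_box_cart)
      show "(\<chi> i. rpoly cs (t $ i)) \<in> box a' b'" if "t \<in> box a b" for t
        using sub[OF that] cs(4) by (simp add: mem_box_cart a''_def b''_def)
      show "i = j" if "t \<in> box a b" "t $ i = t $ j" for t i j
        using separated_distinct[OF ab(2) sub] that by blast
      show "0 \<le> divdiff cs (t $ i) (t $ i)" if "t \<in> box a b" for t i
        using dd[OF sub[OF that], of i] \<eta>(3)[of i] by linarith
      show "(\<Prod>i\<in>UNIV. divdiff cs (t $ i) (t $ i)) / vdm t \<le> K" if "t \<in> box a b" for t
        using K sub[OF that] by blast
    qed auto
    finally show ?thesis .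
  qed
  have lim: "(\<lambda>\<eta>. L \<eta> i) \<midarrow>0\<rightarrow> (b' $ i - a' $ i) / (b $ i - a $ i)" for i
    unfolding L_def using ab(1)[of i] by (auto intro!: tendsto_eq_intros)
  then have lim': "((\<lambda>\<eta>. L \<eta> i) \<longlongrightarrow> (b' $ i - a' $ i) / (b $ i - a $ i)) (at_right 0)" for i
    by (rule filterlim_mono) (auto simp: at_le)
  \<comment> \<open>Multiplication by the extended real \<open>rho (box a b)\<close> is continuous
    because that value is finite.\<close>
  have "((\<lambda>\<eta>. rho (box a b) * ennreal (\<Prod>i\<in>UNIV. L \<eta> i)) \<longlongrightarrow>
      rho (box a b) * ennreal (\<Prod>i\<in>UNIV. (b' $ i - a' $ i) / (b $ i - a $ i))) (at_right 0)"
    using rho_box_finite[OF ab(2)]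
    by (intro ennreal_tendsto_cmult tendsto_ennrealI tendsto_prod lim') auto
  moreover have "\<forall>\<^sub>F \<eta> in at_right 0. \<forall>i. 0 < L \<eta> i"
    using ab(1) ab'(1) by (intro eventually_all_finite order_tendstoD(1)[OF lim']) simp
  moreover have "\<forall>\<^sub>F \<eta> in at_right 0. \<forall>i. 2 * \<eta> < b' $ i - a' $ i"
  proof (intro eventually_all_finite)
    fix i
    have "((\<lambda>\<eta>. 2 * \<eta>) \<longlongrightarrow> 2 * 0) (at_right (0::real))" by (intro tendsto_intros)
    then show "\<forall>\<^sub>F \<eta> in at_right 0. 2 * \<eta> < b' $ i - a' $ i"
      using ab'(1)[of i] by (intro order_tendstoD(2)) auto
  qed
  then have "\<forall>\<^sub>F \<eta> in at_right 0. rho (box a b) * ennreal (\<Prod>i\<in>UNIV. L \<eta> i) \<le> rho (box a' b')"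
    using eventually_at_right_less[of "0::real"] \<open>\<forall>\<^sub>F \<eta> in at_right 0. \<forall>i. 0 < L \<eta> i\<close>
    by eventually_elim (auto intro: le)
  ultimately show ?thesis by (intro tendsto_upperbound) auto
qed

lemma emeasure_box_cart:
  assumes "\<And>i. a $ i \<le> b $ i"
  shows "emeasure lborel (box a b :: (real^'n) set) = ennreal (\<Prod>i\<in>UNIV. b $ i - a $ i)"
proof -
  have "emeasure lborel (box a b) = ennreal (\<Prod>i\<in>Basis. (b - a) \<bullet> i)"
    using assms by (intro emeasure_lborel_box) (auto simp: Basis_vec_def inner_axis)
  then show ?thesis by (simp add: prod_Basis_vec inner_axis)
qed

text \<open>Comparing an arbitrary separated box with one fixed reference box, in both directions,
  turns the inequality into an equality of ratios.\<close>

lemma rho_box_proportional: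
  obtains \<kappa> :: real where "0 \<le> \<kappa>"
    "\<And>a b :: real^('n::{finite,linorder}). separated a b \<Longrightarrow> rho (box a b) = ennreal \<kappa> * emeasure lborel (box a b)"
proof -
  define vol where "vol a b = (\<Prod>i\<in>UNIV. b $ i - a $ i)" for a b :: "(real, 'n) vec"
  define r where "r i = real (card {j. j < i})" for i :: 'n
  have r: "r i + 1 \<le> r j" if "i < j" for i j
  proof -
    have "{k. k < i} \<subset> {k. k < j}" using that by (auto intro: less_trans)
    then have "card {k. k < i} < card {k. k < j}" by (intro psubset_card_mono) auto
    then show ?thesis by (simp add: r_def)
  qed
  \<comment> \<open>Consecutive ranks differ by 1, so intervals of length 1/2 starting at the ranks
    are separated.\<close>
  define a0 b0 where "a0 = (\<chi> i. r i)" and "b0 = (\<chi> i. r i + 1/2)"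
  have ab0: "a0 $ i < b0 $ i" "separated a0 b0" for i
    using r by (fastforce simp: a0_def b0_def separated_def)+
  have vol_pos: "0 < vol a b" if "\<And>i. a $ i < b $ i" for a b
    using that by (auto simp: vol_def intro: prod_pos)
  define \<kappa> where "\<kappa> = enn2real (rho (box a0 b0)) / vol a0 b0"
  show ?thesis
  proof
    show "0 \<le> \<kappa>" using vol_pos[OF ab0(1)] by (simp add: \<kappa>_def)
    fix a b :: "(real, 'n) vec" assume sep: "separated a b"
    show "rho (box a b) = ennreal \<kappa> * emeasure lborel (box a b)"
    proof (cases "\<forall>i. a $ i < b $ i")
      case False
      then obtain i where "b $ i \<le> a $ i" by (auto simp: not_less)
      then have "box a b = {}" by (auto simp: mem_box_cart dest!: spec[of _ i])
      then show ?thesis by (simp add: rho_def)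
    next
      case True
      then have ab: "a $ i < b $ i" for i by simp
      have e: "emeasure lborel (box a b) = ennreal (vol a b)"
        unfolding vol_def using ab by (intro emeasure_box_cart less_imp_le)
      define x where "x = enn2real (rho (box a b))"
      define x0 where "x0 = enn2real (rho (box a0 b0))"
      have rx: "rho (box a b) = ennreal x" using rho_box_finite[OF sep] by (simp add: x_def)
      have rx0: "rho (box a0 b0) = ennreal x0" using rho_box_finite[OF ab0(2)] by (simp add: x0_def)
      have "0 \<le> x" "0 \<le> x0" by (simp_all add: x_def x0_def)
      have "ennreal (x * (vol a0 b0 / vol a b)) \<le> ennreal x0"
        using rho_box_le[OF ab sep ab0] \<open>0 \<le> x\<close> by (simp add: rx rx0 vol_def prod_dividef ennreal_mult'[symmetric] mult.commute)
      then have "x * (vol a0 b0 / vol a b) \<le> x0" using \<open>0 \<le> x0\<close> by simp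
      moreover have "ennreal (x0 * (vol a b / vol a0 b0)) \<le> ennreal x"
        using rho_box_le[OF ab0 ab sep] \<open>0 \<le> x0\<close> by (simp add: rx rx0 vol_def prod_dividef ennreal_mult'[symmetric] mult.commute)
      then have "x0 * (vol a b / vol a0 b0) \<le> x" using \<open>0 \<le> x\<close> by simp
      ultimately have "x = \<kappa> * vol a b"
        using vol_pos[OF ab] vol_pos[OF ab0(1)] unfolding \<kappa>_def x0_def[symmetric] by (simp add: field_simps)
      then show ?thesis using vol_pos[OF ab] by (simp add: rx e ennreal_mult'')
    qed
  qed
qed

section \<open>From separated boxes to Borel subsets of the chamber\<close>

definition chamber :: "(real^('n::{finite,linorder})) set" where
  "chamber = {t. \<forall>i j. i < j \<longrightarrow> t $ i < t $ j}"

lemma chamber_distinct: "t \<in> chamber \<Longrightarrow> t $ i = t $ j \<Longrightarrow> i = j"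
  by (cases i j rule: linorder_cases) (fastforce simp: chamber_def)+

lemma vdm_pos_chamber: "t \<in> chamber \<Longrightarrow> 0 < vdm t"
  by (rule vdm_pos) (rule chamber_distinct)

lemma open_chamber: "open (chamber :: (real^('n::{finite,linorder})) set)"
proof -
  have "open {t :: (real, 'n) vec. i < j \<longrightarrow> t $ i < t $ j}" for i j
    by (cases "i < j") (auto intro!: open_Collect_less continuous_intros)
  then have "open (\<Inter>i. \<Inter>j. {t :: (real, 'n) vec. i < j \<longrightarrow> t $ i < t $ j})"
    by (intro open_INT finite ballI)
  also have "(\<Inter>i. \<Inter>j. {t :: (real, 'n) vec. i < j \<longrightarrow> t $ i < t $ j}) = chamber"
    by (auto simp: chamber_def)
  finally show ?thesis .
qed

lemma chamber_borel [measurable]: "chamber \<in> sets borel"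
  by (rule borel_open[OF open_chamber])

definition separated_boxes :: "(real^('n::{finite,linorder})) set set" where
  "separated_boxes = {box a b | a b. separated a b}"

lemma separated_boxes_subset: "B \<in> separated_boxes \<Longrightarrow> B \<subseteq> chamber"
  using separated_less box_subset_cbox by (fastforce simp: separated_boxes_def chamber_def)

lemma Int_stable_separated_boxes: "Int_stable (separated_boxes :: (real^('n::{finite,linorder})) set set)"
proof (rule Int_stableI)
  fix A B :: "(real, 'n) vec set" assume "A \<in> separated_boxes" "B \<in> separated_boxes"
  then obtain a b a' b' where A: "A = box a b" "separated a b" and B: "B = box a' b'" "separated a' b'"
    by (auto simp: separated_boxes_def)
  let ?c = "\<chi> i. max (a $ i) (a' $ i)" and ?d = "\<chi> i. min (b $ i) (b' $ i)"
  have "A \<inter> B = box ?c ?d" by (auto simp: A B mem_box_cart)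
  moreover have "separated ?c ?d"
    using A(2) B(2) by (auto simp: separated_def min_less_iff_disj less_max_iff_disj)
  ultimately show "A \<inter> B \<in> separated_boxes" by (auto simp: separated_boxes_def)
qed

text \<open>Around each point there is a box whose closure stays in U, hence in the chamber, and
  such a box is separated. Lindelof's theorem extracts a countable cover.\<close>

lemma open_chamber_separated_boxes:
  fixes U :: "(real^('n::{finite,linorder})) set"
  assumes "open U" "U \<subseteq> chamber"
  obtains D where "countable D" "D \<subseteq> separated_boxes" "\<Union>D = U"
proof -
  have "\<exists>B\<in>separated_boxes. x \<in> B \<and> B \<subseteq> U" if "x \<in> U" for x
  proof -
    obtain a b where ab: "cbox a b \<subseteq> U" "x \<in> box a b"
      by (rule open_contains_cbox[OF \<open>open U\<close> \<open>x \<in> U\<close>]) (rule that)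
    have "a $ i < b $ i" for i using ab(2) by (auto simp: mem_box_cart intro: less_trans)
    have "separated a b"
      unfolding separated_def
    proof (intro allI impI)
      fix i j :: 'n assume "i < j"
      \<comment> \<open>The corner of the closed box that is extreme against the order: its i-th
        entry is as large and its j-th as small as possible.\<close>
      define t where "t = (\<chi> k. if k = i then b $ k else a $ k)"
      have "t \<in> cbox a b" using \<open>\<And>i. a $ i < b $ i\<close> by (auto simp: t_def mem_box_cart less_imp_le)
      then have "t \<in> chamber" using ab(1) assms(2) by blast
      then have "t $ i < t $ j" using \<open>i < j\<close> by (simp add: chamber_def)
      then show "b $ i < a $ j" using less_imp_neq[OF \<open>i < j\<close>] by (simp add: t_def)
    qed
    then show ?thesis using ab box_subset_cbox by (intro bexI[of _ "box a b"]) (auto simp: separated_boxes_def)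
  qed
  then have U: "\<Union>{B \<in> separated_boxes. B \<subseteq> U} = U" by blast
  obtain D where "D \<subseteq> {B \<in> separated_boxes. B \<subseteq> U}" "countable D" "\<Union>D = \<Union>{B \<in> separated_boxes. B \<subseteq> U}"
    by (rule Lindelof[of "{B \<in> separated_boxes. B \<subseteq> U}"]) (auto simp: separated_boxes_def)
  then show ?thesis using U by (intro that[of D]) auto
qed

lemma sets_restrict_chamber:
  "sets (restrict_space borel (chamber :: (real^('n::{finite,linorder})) set)) = sigma_sets chamber separated_boxes"
proof
  let ?W = "chamber :: (real, 'n) vec set"
  have "sets (restrict_space borel ?W) = sigma_sets ?W ((\<inter>) ?W ` {S. open S})"
    unfolding sets_restrict_space sets_borel by (rule sigma_sets_Int) (auto simp: open_chamber)
  also have "\<dots> \<subseteq> sigma_sets ?W separated_boxes"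
  proof (rule sigma_sets_mono, safe)
    fix S :: "(real, 'n) vec set" assume "open S"
    then have "open (?W \<inter> S)" using open_chamber by auto
    then obtain D where "countable D" "D \<subseteq> separated_boxes" "\<Union>D = ?W \<inter> S"
      using open_chamber_separated_boxes[of "?W \<inter> S"] by blast
    then show "?W \<inter> S \<in> sigma_sets ?W separated_boxes"
      using sigma_sets_UNION[of D ?W separated_boxes] by (metis sigma_sets.Basic subsetD)
  qed
  finally show "sets (restrict_space borel ?W) \<subseteq> sigma_sets ?W separated_boxes" .
  have "separated_boxes \<subseteq> sets (restrict_space borel ?W)"
    using separated_boxes_subset by (auto simp: sets_restrict_space_iff) (auto simp: separated_boxes_def)
  from sets.sigma_sets_subset[OF this] show "sigma_sets ?W separated_boxes \<subseteq> sets (restrict_space borel ?W)"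
    by (simp add: space_restrict_space)
qed

text \<open>The Weyl integration formula, up to the value of the constant.\<close>

theorem nn_integral_eigs:
  obtains \<kappa> :: real where "0 \<le> \<kappa>"
    "\<And>h. h \<in> borel_measurable borel \<Longrightarrow>
      (\<integral>\<^sup>+v. h (eigs v :: real^('n::{finite,linorder})) \<partial>lborel) = (\<integral>\<^sup>+t. ennreal (\<kappa> * vdm t * indicator chamber t) * h t \<partial>lborel)"
proof -
  let ?W = "chamber :: (real, 'n) vec set"
  obtain \<kappa> :: real where \<kappa>: "0 \<le> \<kappa>"
    "\<And>a b :: (real, 'n) vec. separated a b \<Longrightarrow> rho (box a b) = ennreal \<kappa> * emeasure lborel (box a b)"
    by (rule rho_box_proportional) (rule that)
  \<comment> \<open>The Vandermonde factor is divided out of both measures: on a separated box N1 is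
    \<open>rho\<close> and N2 is \<kappa> times the volume. They agree on a generating family closed
    under intersection.\<close>
  define N1 where "N1 = distr (density lborel (\<lambda>v. indicator ?W (eigs v) * ennreal (1 / vdm (eigs v)))) borel eigs"
  define N2 where "N2 = density lborel (\<lambda>t. ennreal \<kappa> * indicator ?W t)"
  have sets: "sets N1 = sets borel" "sets N2 = sets borel" by (simp_all add: N1_def N2_def)
  have N2_box: "emeasure N2 B = ennreal \<kappa> * emeasure lborel B" if "B \<in> separated_boxes" for B
  proof -
    have [measurable]: "B \<in> sets borel" using that by (auto simp: separated_boxes_def)
    have "emeasure N2 B = (\<integral>\<^sup>+t. ennreal \<kappa> * indicator B t \<partial>lborel)"
      unfolding N2_def using separated_boxes_subset[OF that]
      by (subst emeasure_density) (auto intro!: nn_integral_cong simp: indicator_def)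
    then show ?thesis by (simp add: nn_integral_cmult_indicator)
  qed
  have N1_box: "emeasure N1 B = rho B" if "B \<in> separated_boxes" for B
  proof -
    have [measurable]: "B \<in> sets borel" using that by (auto simp: separated_boxes_def)
    have [measurable]: "eigs -` B \<in> sets borel" using measurable_sets[OF measurable_eigs, of B] by simp
    have "emeasure N1 B = (\<integral>\<^sup>+v. indicator ?W (eigs v) * ennreal (1 / vdm (eigs v)) * indicator (eigs -` B) v \<partial>lborel)"
      unfolding N1_def by (simp add: emeasure_distr emeasure_density)
    also have "\<dots> = rho B"
      unfolding rho_def using separated_boxes_subset[OF that]
      by (intro nn_integral_cong) (auto simp: indicator_def)
    finally show ?thesis .
  qed
  obtain D where D: "countable D" "D \<subseteq> separated_boxes" "\<Union>D = ?W"
    using open_chamber_separated_boxes[OF open_chamber order_refl] by blast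
  have "N1 = N2"
  proof (rule measure_eqI_restrict_generator[OF Int_stable_separated_boxes])
    show "separated_boxes \<subseteq> Pow ?W" using separated_boxes_subset by auto
    show "emeasure N1 B = emeasure N2 B" if "B \<in> separated_boxes" for B
      using \<kappa>(2) N1_box[OF that] N2_box[OF that] that by (auto simp: separated_boxes_def)
    show "sets (restrict_space N1 ?W) = sigma_sets ?W separated_boxes"
      "sets (restrict_space N2 ?W) = sigma_sets ?W separated_boxes"
      using sets by (simp_all add: sets_restrict_chamber[symmetric] cong: sets_restrict_space_cong)
    show "AE x in N1. x \<in> ?W"
      unfolding N1_def by (subst AE_distr_iff) (auto simp: AE_density indicator_def)
    show "AE x in N2. x \<in> ?W"
      unfolding N2_def by (subst AE_density) (auto simp: indicator_def)
    show "countable (insert {} D)" "insert {} D \<noteq> {}" "\<Union>(insert {} D) = ?W" using D by auto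
    \<comment> \<open>The empty box makes the covering family nonempty without exhibiting a point of
      the chamber.\<close>
    have "box 1 0 = ({} :: (real, 'n) vec set)"
      by (auto simp: mem_box_cart) (metis less_trans not_one_less_zero)
    moreover have "separated 1 (0 :: (real, 'n) vec)" by (simp add: separated_def)
    ultimately have e: "{} \<in> (separated_boxes :: (real, 'n) vec set set)"
      unfolding separated_boxes_def by (metis (mono_tags, lifting) mem_Collect_eq)
    show "insert {} D \<subseteq> separated_boxes" using D e by auto
    show "emeasure N1 B \<noteq> \<infinity>" if "B \<in> insert {} D" for B
    proof -
      have "B \<in> separated_boxes" using that D e by auto
      then show ?thesis using rho_box_finite N1_box[of B] by (force simp: separated_boxes_def)
    qed
  qed (use sets in auto)
  show ?thesis
  proof
    show "0 \<le> \<kappa>" by (rule \<kappa>(1))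
    fix h :: "(real, 'n) vec \<Rightarrow> ennreal" assume [measurable]: "h \<in> borel_measurable borel"
    \<comment> \<open>Almost all spectra are simple, so multiplying by \<open>vdm\<close> undoes the
      division almost everywhere.\<close>
    have "AE v in lborel. eigs v \<in> ?W"
    proof -
      have "AE v in lebesgue. v \<notin> {v. \<exists>i j. i \<noteq> j \<and> eigs v $ i = (eigs v :: (real, 'n) vec) $ j}"
        using negligible_repeated_eigenvalue by (intro AE_not_in) (simp add: negligible_iff_null_sets)
      then have "AE v in lborel. v \<notin> {v. \<exists>i j. i \<noteq> j \<and> eigs v $ i = (eigs v :: (real, 'n) vec) $ j}"
        by (simp add: AE_completion_iff)
      then show ?thesis
      proof (rule AE_mp, intro AE_I2 impI)
        fix v assume "v \<notin> {v. \<exists>i j. i \<noteq> j \<and> eigs v $ i = (eigs v :: (real, 'n) vec) $ j}"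
        then show "eigs v \<in> ?W"
          using eigs_mono[of _ _ v] by (auto simp: chamber_def order.strict_iff_order)
      qed
    qed
    then have "(\<integral>\<^sup>+v. h (eigs v) \<partial>lborel)
        = (\<integral>\<^sup>+v. indicator ?W (eigs v) * ennreal (1 / vdm (eigs v)) * (ennreal (vdm (eigs v)) * h (eigs v)) \<partial>lborel)"
    proof (intro nn_integral_cong_AE, elim AE_mp, intro AE_I2 impI)
      fix v assume v: "eigs v \<in> ?W"
      have "ennreal (1 / vdm (eigs v)) * ennreal (vdm (eigs v)) = 1"
        using vdm_pos_chamber[OF v] by (simp add: ennreal_mult''[symmetric])
      then show "h (eigs v) = indicator ?W (eigs v) * ennreal (1 / vdm (eigs v)) * (ennreal (vdm (eigs v)) * h (eigs v))"
        using v by (simp add: mult.assoc[symmetric])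
    qed
    also have "\<dots> = (\<integral>\<^sup>+t. ennreal (vdm t) * h t \<partial>N1)"
      unfolding N1_def by (simp add: nn_integral_distr nn_integral_density)
    also have "\<dots> = (\<integral>\<^sup>+t. ennreal \<kappa> * indicator ?W t * (ennreal (vdm t) * h t) \<partial>lborel)"
      unfolding \<open>N1 = N2\<close> N2_def by (simp add: nn_integral_density)
    also have "\<dots> = (\<integral>\<^sup>+t. ennreal (\<kappa> * vdm t * indicator ?W t) * h t \<partial>lborel)"
      by (intro nn_integral_cong) (auto simp: indicator_def ennreal_mult'' vdm_nonneg mult.assoc)
    finally show "(\<integral>\<^sup>+v. h (eigs v) \<partial>lborel) = (\<integral>\<^sup>+t. ennreal (\<kappa> * vdm t * indicator ?W t) * h t \<partial>lborel)" .
  qed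
qed

subsection \<open>Log-concavity\<close>

definition gue_density :: "real^('n::{finite,linorder}) \<Rightarrow> real" where
  "gue_density t = vdm t * exp (- (\<Sum>i\<in>UNIV. (t $ i)\<^sup>2)) * indicator chamber t"

text \<open>On the chamber each difference has a sign depending only on the order of i and j, so its
  absolute value is linear along segments. AM-GM then gives log-concavity of every factor.\<close>

lemma vdm_log_concave:
  assumes s: "s \<in> chamber" and t: "t \<in> chamber" and l: "0 < l" "l < 1"
  shows "vdm s powr l * vdm t powr (1 - l) \<le> vdm (l *\<^sub>R s + (1 - l) *\<^sub>R t)"
proof -
  define d where "d s i j = (if i = j then 1 else \<bar>s $ i - s $ j\<bar>)" for s :: "(real, 'a) vec" and i j
  have d_nonneg: "0 \<le> d s i j" for s i j by (simp add: d_def)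
  have vdm_d: "vdm s = (\<Prod>i\<in>UNIV. \<Prod>j\<in>UNIV. d s i j)" for s by (simp add: vdm_def d_def)
  have powr: "vdm s powr r = (\<Prod>i\<in>UNIV. \<Prod>j\<in>UNIV. d s i j powr r)" for s r
    unfolding vdm_d by (simp add: prod_powr_distrib prod_nonneg d_nonneg)
  have "d s i j powr l * d t i j powr (1 - l) \<le> d (l *\<^sub>R s + (1 - l) *\<^sub>R t) i j" for i j
  proof (cases "i = j")
    case False
    have pos: "0 < \<bar>s $ i - s $ j\<bar>" "0 < \<bar>t $ i - t $ j\<bar>"
      using chamber_distinct[OF s] chamber_distinct[OF t] False by auto
    have "\<bar>s $ i - s $ j\<bar> powr l * \<bar>t $ i - t $ j\<bar> powr (1 - l) \<le> l * \<bar>s $ i - s $ j\<bar> + (1 - l) * \<bar>t $ i - t $ j\<bar>"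
      using Youngs_inequality_0[of l "1 - l"] pos l by simp
    also have "\<dots> = \<bar>l * (s $ i - s $ j) + (1 - l) * (t $ i - t $ j)\<bar>"
    proof (cases "i < j")
      case True
      then have "s $ i - s $ j < 0" "t $ i - t $ j < 0" using s t by (auto simp: chamber_def)
      then have "l * (s $ i - s $ j) \<le> 0" "(1 - l) * (t $ i - t $ j) \<le> 0"
        using l by (auto intro!: mult_nonneg_nonpos)
      then show ?thesis using \<open>s $ i - s $ j < 0\<close> \<open>t $ i - t $ j < 0\<close> by (simp add: abs_of_nonpos algebra_simps)
    next
      case False
      then have "0 < s $ i - s $ j" "0 < t $ i - t $ j" using s t \<open>i \<noteq> j\<close> by (auto simp: chamber_def)
      then show ?thesis using l by (simp add: abs_of_nonneg)
    qed
    finally show ?thesis using False by (simp add: d_def algebra_simps)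
  qed (simp add: d_def)
  then have "(\<Prod>i\<in>UNIV. \<Prod>j\<in>UNIV. d s i j powr l * d t i j powr (1 - l)) \<le> vdm (l *\<^sub>R s + (1 - l) *\<^sub>R t)"
    unfolding vdm_d by (intro prod_mono conjI prod_nonneg) (auto simp: d_nonneg)
  then show ?thesis by (simp add: powr prod.distrib)
qed

lemma gue_density_log_concave:
  assumes l: "0 < l" "l < 1"
  shows "gue_density s powr l * gue_density t powr (1 - l) \<le> gue_density (l *\<^sub>R s + (1 - l) *\<^sub>R t)"
proof (cases "s \<in> chamber \<and> t \<in> chamber")
  case True
  then have st: "s \<in> chamber" "t \<in> chamber" by auto
  let ?u = "l *\<^sub>R s + (1 - l) *\<^sub>R t"
  have u: "?u \<in> chamber"
    using st l by (auto simp: chamber_def intro!: add_strict_mono mult_strict_left_mono)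
  have "(?u $ i)\<^sup>2 \<le> l * (s $ i)\<^sup>2 + (1 - l) * (t $ i)\<^sup>2" for i
  proof -
    \<comment> \<open>The exact defect in the convexity of the square.\<close>
    have "l * (s $ i)\<^sup>2 + (1 - l) * (t $ i)\<^sup>2 - (?u $ i)\<^sup>2 = l * (1 - l) * (s $ i - t $ i)\<^sup>2"
      by (simp add: power2_eq_square algebra_simps)
    also have "\<dots> \<ge> 0" using l by simp
    finally show ?thesis by simp
  qed
  then have "(\<Sum>i\<in>UNIV. (?u $ i)\<^sup>2) \<le> (\<Sum>i\<in>UNIV. l * (s $ i)\<^sup>2 + (1 - l) * (t $ i)\<^sup>2)" by (rule sum_mono)
  then have "(\<Sum>i\<in>UNIV. (?u $ i)\<^sup>2) \<le> l * (\<Sum>i\<in>UNIV. (s $ i)\<^sup>2) + (1 - l) * (\<Sum>i\<in>UNIV. (t $ i)\<^sup>2)"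
    by (simp only: sum.distrib sum_distrib_left)
  then have "exp (- (\<Sum>i\<in>UNIV. (s $ i)\<^sup>2)) powr l * exp (- (\<Sum>i\<in>UNIV. (t $ i)\<^sup>2)) powr (1 - l) \<le> exp (- (\<Sum>i\<in>UNIV. (?u $ i)\<^sup>2))"
    by (simp add: powr_def exp_add[symmetric])
  with vdm_log_concave[OF st l]
  have "(vdm s powr l * vdm t powr (1 - l)) * (exp (- (\<Sum>i\<in>UNIV. (s $ i)\<^sup>2)) powr l * exp (- (\<Sum>i\<in>UNIV. (t $ i)\<^sup>2)) powr (1 - l))
      \<le> vdm ?u * exp (- (\<Sum>i\<in>UNIV. (?u $ i)\<^sup>2))"
    by (intro mult_mono) (auto simp: vdm_nonneg)
  then show ?thesis
    using st u by (simp add: gue_density_def powr_mult vdm_nonneg mult_ac)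
qed (use l in \<open>auto simp: gue_density_def vdm_nonneg\<close>)

lemma gue_density_bounded: "\<exists>K. \<forall>t :: real^('n::{finite,linorder}). norm t \<le> r \<longrightarrow> gue_density t \<le> K"
proof -
  have "bounded (vdm ` (cball 0 r :: (real, 'n) vec set))"
    by (intro compact_imp_bounded compact_continuous_image continuous_on_vdm continuous_on_id compact_cball)
  then obtain K where "\<forall>x\<in>(cball 0 r :: (real, 'n) vec set). \<bar>vdm x\<bar> \<le> K" by (auto simp: bounded_iff)
  then have K: "\<bar>vdm t\<bar> \<le> K" if "norm t \<le> r" for t :: "(real, 'n) vec" using that by simp
  have "gue_density t \<le> vdm t" for t :: "(real, 'n) vec"
    using vdm_nonneg[of t] by (auto simp: gue_density_def indicator_def intro!: mult_left_le sum_nonneg)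
  then show ?thesis using K abs_le_D1 by (meson order_trans)
qed

lemma measurable_gue_density [measurable]: "gue_density \<in> borel_measurable borel"
  unfolding gue_density_def
  by (intro borel_measurable_times measurable_vdm borel_measurable_indicator chamber_borel
      borel_measurable_continuous_onI continuous_intros)

section \<open>The law of the ordered eigenvalues\<close>

lemma measurable_hermitian_of_coords [measurable]: "hermitian_of_coords \<in> borel_measurable borel"
proof -
  have "linear hermitian_of_coords"
    by (rule linearI) (auto simp: hermitian_of_coords_def vec_eq_iff complex_eq_iff)
  then show ?thesis
    by (intro borel_measurable_continuous_onI linear_continuous_on) (simp add: linear_conv_bounded_linear)
qed

lemma nn_integral_hermitian_lborel:
  assumes [measurable]: "g \<in> borel_measurable borel"
  shows "(\<integral>\<^sup>+A. g A \<partial>hermitian_lborel) = (\<integral>\<^sup>+v. g (hc v) \<partial>lborel)"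
proof -
  have "linear to_mat" by (rule linearI) (auto simp: to_mat_def vec_eq_iff)
  then have [measurable]: "to_mat \<in> borel_measurable borel"
    by (intro borel_measurable_continuous_onI linear_continuous_on) (simp add: linear_conv_bounded_linear)
  show ?thesis
    unfolding hermitian_lborel_def
    by (subst nn_integral_distr, simp, simp, subst lborel_eq_distr_to_mat)
      (simp add: nn_integral_distr hc_def)
qed

theorem mainTheorem3:
  fixes M :: "'a measure" and X :: "'a \<Rightarrow> complex^('n::{finite,linorder})^('n::{finite,linorder})"
  assumes "prob_space M"
    and "GUE_matrix M X"
  shows "(\<lambda>\<omega>. ordered_eigenvalues (X \<omega>)) \<in> borel_measurable M \<and>
         log_concave_prob (distr M borel (\<lambda>\<omega>. ordered_eigenvalues (X \<omega>)))"
proof -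
  interpret prob_space M by fact
  obtain c where herm: "\<And>\<omega>. \<omega> \<in> space M \<Longrightarrow> hermitian (X \<omega>)"
    and X: "distributed M hermitian_lborel X (\<lambda>A. ennreal (c * exp (- Re (trace (A ** A)))))"
    using assms(2) unfolding GUE_matrix_def by auto
  let ?f = "\<lambda>A :: ((complex, 'n) vec, 'n) vec. ennreal (c * exp (- Re (trace (A ** A))))"
  have sets_H: "sets (hermitian_lborel :: ((complex, 'n) vec, 'n) vec measure) = sets borel"
    by (simp add: hermitian_lborel_def)
  have X_meas: "X \<in> measurable M borel"
    using distributed_measurable[OF X] by (simp add: measurable_cong_sets[OF refl sets_H])
  have f_meas [measurable]: "?f \<in> borel_measurable borel"
    using distributed_borel_measurable[OF X] by (simp add: measurable_cong_sets[OF sets_H refl])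
  have "X \<in> measurable M (restrict_space borel (Collect hermitian))"
    using X_meas herm by (intro measurable_restrict_space2) auto
  from measurable_compose[OF this ordered_eigenvalues_measurable]
  have meas: "(\<lambda>\<omega>. ordered_eigenvalues (X \<omega>)) \<in> borel_measurable M" .
  obtain \<kappa> :: real where \<kappa>: "0 \<le> \<kappa>"
    "\<And>h. h \<in> borel_measurable borel \<Longrightarrow>
      (\<integral>\<^sup>+v. h (eigs v :: (real, 'n) vec) \<partial>lborel) = (\<integral>\<^sup>+t. ennreal (\<kappa> * vdm t * indicator chamber t) * h t \<partial>lborel)"
    by (rule nn_integral_eigs) (rule that)
  \<comment> \<open>\<open>ennreal\<close> sends a negative c to density 0, which the maximum
    reproduces for real densities.\<close>
  define C where "C = max c 0 * \<kappa>"
  define F where "F t = C * gue_density t" for t :: "(real, 'n) vec"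
  have C: "0 \<le> C" using \<kappa>(1) by (simp add: C_def)
  have g0: "0 \<le> gue_density t" for t :: "(real, 'n) vec" by (simp add: gue_density_def vdm_nonneg)
  let ?\<mu> = "distr M borel (\<lambda>\<omega>. ordered_eigenvalues (X \<omega>))"
  have law: "?\<mu> = density lborel F"
  proof (rule measure_eqI)
    fix A assume "A \<in> sets ?\<mu>"
    then have A[measurable]: "A \<in> sets borel" by simp
    define A' where "A' = {B. hermitian B \<and> ordered_eigenvalues B \<in> A}"
    have "ordered_eigenvalues -` A \<inter> Collect hermitian \<in> sets (restrict_space borel (Collect hermitian))"
      using measurable_sets[OF ordered_eigenvalues_measurable A] by (simp add: space_restrict_space)
    then have A'[measurable]: "A' \<in> sets borel"
      using borel_closed[OF closed_hermitian] unfolding A'_def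
      by (subst (asm) sets_restrict_space_iff) (auto simp: vimage_def Int_def conj_commute)
    have "emeasure ?\<mu> A = emeasure M (X -` A' \<inter> space M)"
      using meas herm by (subst emeasure_distr) (auto simp: A'_def intro!: arg_cong[where f = "emeasure M"])
    also have "\<dots> = (\<integral>\<^sup>+B. ?f B * indicator A' B \<partial>hermitian_lborel)"
      by (rule distributed_emeasure[OF X]) (simp add: sets_H A')
    also have "\<dots> = (\<integral>\<^sup>+v. ?f (hc v) * indicator A' (hc v) \<partial>lborel)"
      by (rule nn_integral_hermitian_lborel) measurable
    \<comment> \<open>For Hermitian matrices the trace of the square is the sum of squared
      eigenvalues, so the integrand depends on v only through \<open>eigs v\<close> and the Weyl
      formula applies.\<close>
    also have "\<dots> = (\<integral>\<^sup>+v. ennreal (c * exp (- (\<Sum>i\<in>UNIV. (eigs v $ i)\<^sup>2))) * indicator A (eigs v) \<partial>lborel)"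
      by (intro nn_integral_cong)
        (auto simp: trace_square_eigenvalues eigs_def A'_def indicator_def)
    also have "\<dots> = (\<integral>\<^sup>+t. ennreal (\<kappa> * vdm t * indicator chamber t) * (ennreal (c * exp (- (\<Sum>i\<in>UNIV. (t $ i)\<^sup>2))) * indicator A t) \<partial>lborel)"
    proof -
      have [measurable]: "(\<lambda>t :: (real, 'n) vec. ennreal (c * exp (- (\<Sum>i\<in>UNIV. (t $ i)\<^sup>2)))) \<in> borel_measurable borel"
        by (intro measurable_compose[OF borel_measurable_continuous_onI measurable_ennreal] continuous_intros)
      show ?thesis by (rule \<kappa>(2)) measurable
    qed
    also have "\<dots> = (\<integral>\<^sup>+t. ennreal (F t) * indicator A t \<partial>lborel)"
    proof (intro nn_integral_cong)
      fix t :: "(real, 'n) vec"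
      have "ennreal (c * exp (- (\<Sum>i\<in>UNIV. (t $ i)\<^sup>2))) = ennreal (max c 0 * exp (- (\<Sum>i\<in>UNIV. (t $ i)\<^sup>2)))"
        by (cases "0 \<le> c") (auto simp: ennreal_neg mult_nonpos_nonneg)
      moreover have "ennreal (\<kappa> * vdm t * indicator chamber t) * ennreal (max c 0 * exp (- (\<Sum>i\<in>UNIV. (t $ i)\<^sup>2))) = ennreal (F t)"
        by (subst ennreal_mult''[symmetric]) (simp_all add: F_def C_def gue_density_def mult_ac)
      ultimately show "ennreal (\<kappa> * vdm t * indicator chamber t) * (ennreal (c * exp (- (\<Sum>i\<in>UNIV. (t $ i)\<^sup>2))) * indicator A t) = ennreal (F t) * indicator A t"
        by (simp add: mult.assoc[symmetric])
    qed
    also have "\<dots> = emeasure (density lborel F) A"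
      unfolding F_def by (subst emeasure_density) auto
    finally show "emeasure ?\<mu> A = emeasure (density lborel F) A" .
  qed simp
  have "log_concave_prob (density lborel F)"
  proof (rule log_concave_prob_density)
    show "F \<in> borel_measurable borel" unfolding F_def by measurable
    show "0 \<le> F t" for t using C g0 by (simp add: F_def)
    show "\<exists>K. \<forall>t. norm t \<le> r \<longrightarrow> F t \<le> K" for r
      using gue_density_bounded[of r] C unfolding F_def by (metis mult_left_mono)
    show "F s powr l * F t powr (1 - l) \<le> F (l *\<^sub>R s + (1 - l) *\<^sub>R t)" if l: "0 < l" "l < 1" for s t l
    proof -
      \<comment> \<open>Homogeneity of degree one of the weighted geometric mean, valid also for C =
        0 since \<open>0 powr l = 0\<close>.\<close>
      have "C powr l * C powr (1 - l) = C"
        using C l by (cases "C = 0") (simp_all add: powr_add[symmetric])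
      then have "F s powr l * F t powr (1 - l) = C * (gue_density s powr l * gue_density t powr (1 - l))"
        using C g0 by (simp add: F_def powr_mult mult_ac)
      also have "\<dots> \<le> F (l *\<^sub>R s + (1 - l) *\<^sub>R t)"
        unfolding F_def using C gue_density_log_concave[OF l] by (intro mult_left_mono) auto
      finally show ?thesis .
    qed
    \<comment> \<open>The normalisation is read off from the law itself; no Gaussian integral is
      evaluated.\<close>
    show "prob_space (density lborel F)" unfolding law[symmetric] using meas by (rule prob_space_distr)
  qed
  then show ?thesis using meas law by simp
qed

end
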